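(* Let $\Omega\subset\mathbb{C}^n$ be open, let $T$ be a positive pluriharmonic current of bi-dimension $(p,p)$, $p\geq 2$, on $\Omega$, and let $g\in Psh^{-}(\Omega)\cap\mathcal{C}^{1}(\Omega\setminus L_{g})$. If $L_{g}$ is compact and $L_{g}=P_{g}$, then for every $0<\varepsilon<1$ the current $|g|^{1+\varepsilon}T$ is well defined, i.e. for every sequence $(g_j)$ of smooth plurisubharmonic functions on $\Omega$ decreasing to $g$ and converging to $g$ in $\mathcal{C}^1(\Omega\setminus L_g)$, the currents $|g_j|^{1+\varepsilon}T$ converge weakly$^*$ to a current denoted $|g|^{1+\varepsilon}T$.
   Context: $Psh^{-}(\Omega)$ is the set of negative plurisubharmonic functions on $\Omega$. For $g\in Psh^{-}(\Omega)$, $L_g$ is the set of points $z\in\Omega$ such that $g$ is unbounded in every neighborhood of $z$, and $P_g=\{g=-\infty\}$. A current $T$ is pluriharmonic if $dd^{c}T=0$. *)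

theory Defs
  imports "HOL-Analysis.Analysis"
begin

definition dd :: "('a::real_normed_vector) \<Rightarrow> ('a \<Rightarrow> 'b::real_normed_vector) \<Rightarrow> 'a \<Rightarrow> 'b" where
  "dd v f = (\<lambda>x. frechet_derivative f (at x) v)"

fun iter_dd :: "('a::real_normed_vector) list \<Rightarrow> ('a \<Rightarrow> 'b::real_normed_vector) \<Rightarrow> 'a \<Rightarrow> 'b" where
  "iter_dd [] f = f"
| "iter_dd (v # vs) f = dd v (iter_dd vs f)"

definition smooth_on :: "'a::real_normed_vector set \<Rightarrow> ('a \<Rightarrow> 'b::real_normed_vector) \<Rightarrow> bool" where
  "smooth_on S f \<longleftrightarrow> (\<forall>vs. \<forall>x\<in>S. iter_dd vs f differentiable at x)"

definition C1_on :: "'a::real_normed_vector set \<Rightarrow> ('a \<Rightarrow> 'b::real_normed_vector) \<Rightarrow> bool" where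
  "C1_on S f \<longleftrightarrow> (\<forall>x\<in>S. f differentiable at x) \<and> (\<forall>v. continuous_on S (dd v f))"

definition wirt_dz :: "'n \<Rightarrow> (complex^'n \<Rightarrow> complex) \<Rightarrow> complex^'n \<Rightarrow> complex" where
  "wirt_dz j u = (\<lambda>z. (dd (axis j 1) u z - \<i> * dd (axis j \<i>) u z) / 2)"

definition wirt_dzbar :: "'n \<Rightarrow> (complex^'n \<Rightarrow> complex) \<Rightarrow> complex^'n \<Rightarrow> complex" where
  "wirt_dzbar j u = (\<lambda>z. (dd (axis j 1) u z + \<i> * dd (axis j \<i>) u z) / 2)"

(* Differential forms of bidegree (q,q):  phi = sum_{|I|=|J|=q}        *)
(*   phi I J  dz_I /\ dzbar_J,   I, J increasing multi-indices,        *)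
(* represented by the coefficient family  phi :: 'n set => 'n set => _ *)

type_synonym 'n form = "'n set \<Rightarrow> 'n set \<Rightarrow> complex^'n \<Rightarrow> complex"

definition form_support_ok :: "nat \<Rightarrow> (complex^'n) set \<Rightarrow> 'n form \<Rightarrow> bool" where
  "form_support_ok q \<Omega> \<phi> \<longleftrightarrow>
     (\<forall>I J. \<not> (card I = q \<and> card J = q) \<longrightarrow> \<phi> I J = (\<lambda>_. 0)) \<and>
     (\<exists>K. compact K \<and> K \<subseteq> \<Omega> \<and> (\<forall>I J z. z \<notin> K \<longrightarrow> \<phi> I J z = 0))"

definition cc_form :: "nat \<Rightarrow> (complex^'n) set \<Rightarrow> 'n form \<Rightarrow> bool" where
  "cc_form q \<Omega> \<phi> \<longleftrightarrow> form_support_ok q \<Omega> \<phi> \<and> (\<forall>I J. continuous_on UNIV (\<phi> I J))"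

definition test_form :: "nat \<Rightarrow> (complex^'n) set \<Rightarrow> 'n form \<Rightarrow> bool" where
  "test_form q \<Omega> \<phi> \<longleftrightarrow> form_support_ok q \<Omega> \<phi> \<and> (\<forall>I J. smooth_on UNIV (\<phi> I J))"

(* sign of  dz_j /\ dz_K = sgn j K dz_{K u {j}}  (j not in K) *)
definition sgn_ins :: "'n::linorder \<Rightarrow> 'n set \<Rightarrow> complex" where
  "sgn_ins j K = (-1) ^ card {m\<in>K. m < j}"

(* coefficients of  d d^c psi  (up to the harmless constant i/pi) for a
   (q,q)-form psi: the (q+1,q+1)-form  ddbar psi  *)
definition ddbar_form :: "nat \<Rightarrow> ('n::{finite,linorder}) form \<Rightarrow> 'n form" where
  "ddbar_form q \<psi> = (\<lambda>I J z.
     if card I = Suc q \<and> card J = Suc q then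
       (\<Sum>j\<in>I. \<Sum>k\<in>J. (-1) ^ q * sgn_ins j (I - {j}) * sgn_ins k (J - {k}) *
           wirt_dz j (wirt_dzbar k (\<psi> (I - {j}) (J - {k}))) z)
     else 0)"

definition minor_det :: "nat \<Rightarrow> (nat \<Rightarrow> 'n::linorder \<Rightarrow> complex) \<Rightarrow> 'n set \<Rightarrow> complex" where
  "minor_det p A I = (let e = sorted_list_of_set I in
      \<Sum>\<pi> | \<pi> permutes {..<p}. of_int (sign \<pi>) * (\<Prod>k<p. A k (e ! (\<pi> k))))"

(* coefficients of the constant strongly positive (p,p)-form
   i a_1/\conj(a_1) /\ ... /\ i a_p/\conj(a_p),  a_k = sum_j A k j dz_j *)
definition spos_form :: "nat \<Rightarrow> (nat \<Rightarrow> 'n::linorder \<Rightarrow> complex) \<Rightarrow> 'n set \<Rightarrow> 'n set \<Rightarrow> complex" where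
  "spos_form p A I J =
     (if card I = p \<and> card J = p then
        \<i> ^ p * (-1) ^ (p * (p - 1) div 2) * minor_det p A I * cnj (minor_det p A J)
      else 0)"

definition order0_current :: "nat \<Rightarrow> (complex^('n::{finite,linorder})) set \<Rightarrow> ('n form \<Rightarrow> complex) \<Rightarrow> bool" where
  "order0_current p \<Omega> T \<longleftrightarrow>
     (\<forall>\<phi> \<psi> a b. cc_form p \<Omega> \<phi> \<longrightarrow> cc_form p \<Omega> \<psi> \<longrightarrow>
        T (\<lambda>I J z. a * \<phi> I J z + b * \<psi> I J z) = a * T \<phi> + b * T \<psi>)"

definition positive_current :: "nat \<Rightarrow> (complex^('n::{finite,linorder})) set \<Rightarrow> ('n form \<Rightarrow> complex) \<Rightarrow> bool" where
  "positive_current p \<Omega> T \<longleftrightarrow> order0_current p \<Omega> T \<and>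
     (\<forall>(f::_ \<Rightarrow> real) A.
        continuous_on UNIV f \<longrightarrow> (\<forall>z. f z \<ge> 0) \<longrightarrow>
        (\<exists>K. compact K \<and> K \<subseteq> \<Omega> \<and> (\<forall>z. z \<notin> K \<longrightarrow> f z = 0)) \<longrightarrow>
        T (\<lambda>I J z. of_real (f z) * spos_form p A I J) \<in> \<real> \<and>
        Re (T (\<lambda>I J z. of_real (f z) * spos_form p A I J)) \<ge> 0)"

definition pluriharmonic_current :: "nat \<Rightarrow> (complex^('n::{finite,linorder})) set \<Rightarrow> ('n form \<Rightarrow> complex) \<Rightarrow> bool" where
  "pluriharmonic_current p \<Omega> T \<longleftrightarrow>
     (\<forall>\<psi>. test_form (p - 1) \<Omega> \<psi> \<longrightarrow> T (ddbar_form (p - 1) \<psi>) = 0)"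

definition mult_current :: "(complex^'n \<Rightarrow> real) \<Rightarrow> ('n form \<Rightarrow> complex) \<Rightarrow> 'n form \<Rightarrow> complex" where
  "mult_current f T = (\<lambda>\<phi>. T (\<lambda>I J z. of_real (f z) * \<phi> I J z))"

definition disc_in :: "(complex^'n) set \<Rightarrow> complex^'n \<Rightarrow> complex^'n \<Rightarrow> bool" where
  "disc_in \<Omega> a b \<longleftrightarrow> (\<forall>\<zeta>. cmod \<zeta> \<le> 1 \<longrightarrow> a + \<zeta> *s b \<in> \<Omega>)"

definition psh_neg :: "(complex^'n) set \<Rightarrow> (complex^'n \<Rightarrow> ereal) \<Rightarrow> bool" where
  "psh_neg \<Omega> g \<longleftrightarrow>
     (\<forall>z\<in>\<Omega>. g z \<le> 0) \<and>
     (\<forall>z\<in>\<Omega>. \<forall>c. g z < c \<longrightarrow> eventually (\<lambda>w. g w < c) (at z)) \<and>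
     (\<forall>z\<in>\<Omega>. \<exists>w\<in>connected_component_set \<Omega> z. g w \<noteq> -\<infinity>) \<and>
     (\<forall>a b. disc_in \<Omega> a b \<longrightarrow>
        (\<integral>\<^sup>+ \<theta>. indicator {0..2*pi} \<theta> * e2ennreal (- g (a + cis \<theta> *s b)) \<partial>lborel)
          \<le> ennreal (2 * pi) * e2ennreal (- g a))"

definition psh_real :: "(complex^'n) set \<Rightarrow> (complex^'n \<Rightarrow> real) \<Rightarrow> bool" where
  "psh_real \<Omega> u \<longleftrightarrow>
     (\<forall>z\<in>\<Omega>. \<forall>c. u z < c \<longrightarrow> eventually (\<lambda>w. u w < c) (at z)) \<and>
     (\<forall>a b. disc_in \<Omega> a b \<longrightarrow>
        (\<lambda>\<theta>. u (a + cis \<theta> *s b)) integrable_on {0..2*pi} \<and>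
        2 * pi * u a \<le> integral {0..2*pi} (\<lambda>\<theta>. u (a + cis \<theta> *s b)))"

definition unbdd_locus :: "(complex^'n) set \<Rightarrow> (complex^'n \<Rightarrow> ereal) \<Rightarrow> (complex^'n) set" where
  "unbdd_locus \<Omega> g = {z\<in>\<Omega>. \<forall>U. open U \<and> z \<in> U \<longrightarrow>
       (\<forall>M::real. \<exists>w\<in>U \<inter> \<Omega>. \<bar>g w\<bar> > ereal M)}"

definition polar_set :: "(complex^'n) set \<Rightarrow> (complex^'n \<Rightarrow> ereal) \<Rightarrow> (complex^'n) set" where
  "polar_set \<Omega> g = {z\<in>\<Omega>. g z = -\<infinity>}"

definition admissible_seq :: "(complex^'n) set \<Rightarrow> (complex^'n \<Rightarrow> ereal) \<Rightarrow> (nat \<Rightarrow> complex^'n \<Rightarrow> real) \<Rightarrow> bool" where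
  "admissible_seq \<Omega> g gs \<longleftrightarrow>
     (\<forall>j. smooth_on \<Omega> (gs j) \<and> psh_real \<Omega> (gs j)) \<and>
     (\<forall>j. \<forall>z\<in>\<Omega>. gs (Suc j) z \<le> gs j z) \<and>
     (\<forall>z\<in>\<Omega>. (\<lambda>j. ereal (gs j z)) \<longlonglongrightarrow> g z) \<and>
     (\<forall>K. compact K \<and> K \<subseteq> \<Omega> - unbdd_locus \<Omega> g \<longrightarrow>
        uniform_limit K gs (\<lambda>z. real_of_ereal (g z)) sequentially \<and>
        (\<forall>v. uniform_limit K (\<lambda>j. dd v (gs j)) (dd v (\<lambda>z. real_of_ereal (g z))) sequentially))"

end

theory Submission
  imports Defs "Jordan_Normal_Form.Determinant"
begin

no_notation vec_index (infixl "$" 100)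

text \<open>
  Write \<open>\<beta>\<close> for the Kaehler form and let \<open>G = c - g_j \<ge> 1\<close> near the support of a cutoff \<open>\<eta>\<close>.
  Everything rests on a bound of \<open>\<integral> \<eta> G^r T \<and> \<beta>^p\<close>, uniform in \<open>j\<close>, for every \<open>r = 1 + s\<close> with
  \<open>0 < s < 1\<close>. It is obtained by testing \<open>dd^c T = 0\<close> three times: with \<open>\<eta> G \<beta>^{p-1}\<close>, which bounds
  the mass of \<open>dd^c g_j \<and> T\<close>; with \<open>\<eta> (|z|^2 - B) G^s dd^c g_j \<and> \<beta>^{p-2}\<close>, which bounds
  \<open>\<integral> \<eta> G^s dd^c g_j \<and> T \<and> \<beta>^{p-1}\<close>; and with \<open>\<eta> (|z|^2 + B) G^r \<beta>^{p-1}\<close>. For \<open>B\<close> large the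
  terms mixing \<open>d|z|^2\<close> and \<open>dG\<close> are absorbed by the square \<open>dG \<and> d^c G\<close>, whose coefficient
  \<open>(|z|^2 \<mp> B) s (s - 1)\<close>, respectively with \<open>r\<close>, is positive. Where \<open>\<eta>\<close> is not constant, \<open>g_j\<close> is
  bounded in \<open>C^1\<close> because \<open>L_g\<close> is compact.

  Given the bound for some \<open>s > \<epsilon>\<close>, truncating \<open>|g_j|\<close> at height \<open>M\<close> changes \<open>|g_j|^{1+\<epsilon>} T\<close> by
  \<open>O(M^{\<epsilon>-s})\<close>. The truncations of \<open>g_j\<close> decrease to the truncation of \<open>g\<close>, which is continuous
  because \<open>L_g = P_g\<close>, hence converge uniformly by Dini's theorem; so the limit exists and depends on
  \<open>g\<close> only.
\<close>

section \<open>Smooth functions\<close>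

text \<open>As \<open>G\<close> is a constant minus a plurisubharmonic function, the Levi form of
  \<open>G powr r\<close> contains the negative term - r G^(r-1) dd^c g_j, so a single test cannot
  close. Each test pays for its bad term with the one before it, and the exponent of
  \<open>G\<close> in front of dd^c g_j drops from s to 0. For 0 < s < 1 the square of dG carries
  the negative coefficient s (s - 1); the multiplier |z|^2 - B < 0 makes both this term and the term
  in dd^c g_j positive. This is where s < 1 enters, and with it \<epsilon> < 1. That test wedges two
  Levi forms and leaves the power p - 2 of \<beta>, whence p \<ge> 2. The definition of a positive
  current speaks only of functions times constant decomposable forms and contains no continuity. The
  bound by the mass and positivity on forms with varying coefficients are therefore derived. After
  that, an inequality between (1,1)-forms may be integrated as soon as it holds pointwise for
  Hermitian matrices, because a positive semidefinite matrix is a sum of rank-one ones.\<close>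

lemma dd_eq: "(f has_derivative f') (at x) \<Longrightarrow> dd v f x = f' v"
  unfolding dd_def by (simp add: frechet_derivative_at[symmetric])

lemma has_derivative_dd: "f differentiable at x \<Longrightarrow> (f has_derivative (\<lambda>v. dd v f x)) (at x)"
  unfolding dd_def by (simp add: frechet_derivative_works)

lemma linear_dd: "f differentiable at x \<Longrightarrow> linear (\<lambda>v. dd v f x)"
  using has_derivative_dd has_derivative_linear by blast

text \<open>Smoothness of finite order, with each new derivative taken next to \<open>f\<close>,
  whereas \<open>iter_dd\<close> adds derivatives on the outside. This order lets the sum, product
  and chain rules go through by induction on \<open>n\<close> with the functions
  generalized.\<close>

fun smooth_n :: "nat \<Rightarrow> 'a::real_normed_vector set \<Rightarrow> ('a \<Rightarrow> 'b::real_normed_vector) \<Rightarrow> bool" where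
  "smooth_n 0 S f \<longleftrightarrow> (\<forall>x\<in>S. f differentiable at x)"
| "smooth_n (Suc n) S f \<longleftrightarrow> (\<forall>x\<in>S. f differentiable at x) \<and> (\<forall>v. smooth_n n S (dd v f))"

lemma iter_dd_snoc: "iter_dd (vs @ [v]) f = iter_dd vs (dd v f)"
  by (induction vs) auto

lemma smooth_n_iff_iter_dd:
  "smooth_n n S f \<longleftrightarrow> (\<forall>vs. length vs \<le> n \<longrightarrow> (\<forall>x\<in>S. iter_dd vs f differentiable at x))"
proof (induction n arbitrary: f)
  case (Suc n)
  have "(\<forall>x\<in>S. iter_dd vs f differentiable at x)"
    if "\<forall>x\<in>S. f differentiable at x"
      "\<And>v vs. length vs \<le> n \<Longrightarrow> \<forall>x\<in>S. iter_dd vs (dd v f) differentiable at x"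
      "length vs \<le> Suc n" for vs
  proof (cases vs rule: rev_cases)
    case Nil then show ?thesis using that by simp
  next
    case (snoc ys y)
    then show ?thesis using that(2)[of ys y] that(3) by (simp add: iter_dd_snoc)
  qed
  moreover have "\<forall>x\<in>S. iter_dd vs (dd v f) differentiable at x"
    if "\<forall>vs. length vs \<le> Suc n \<longrightarrow> (\<forall>x\<in>S. iter_dd vs f differentiable at x)" "length vs \<le> n" for v vs
    using that(1)[rule_format, of "vs @ [v]"] that(2) by (simp add: iter_dd_snoc)
  moreover have "\<forall>x\<in>S. f differentiable at x"
    if "\<forall>vs. length vs \<le> Suc n \<longrightarrow> (\<forall>x\<in>S. iter_dd vs f differentiable at x)"
    using that[rule_format, of "[]"] by simp
  ultimately show ?case unfolding smooth_n.simps Suc.IH by meson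
qed simp

lemma smooth_on_iff_smooth_n: "smooth_on S f \<longleftrightarrow> (\<forall>n. smooth_n n S f)"
  unfolding smooth_on_def smooth_n_iff_iter_dd by auto

lemma smooth_n_imp_differentiable: "smooth_n n S f \<Longrightarrow> x \<in> S \<Longrightarrow> f differentiable at x"
  by (cases n) auto

lemma smooth_n_mono: "smooth_n n S f \<Longrightarrow> m \<le> n \<Longrightarrow> smooth_n m S f"
  unfolding smooth_n_iff_iter_dd by auto

lemma smooth_on_imp_differentiable: "smooth_on S f \<Longrightarrow> x \<in> S \<Longrightarrow> f differentiable at x"
  unfolding smooth_on_def by (metis iter_dd.simps(1))

lemma smooth_on_dd: "smooth_on S f \<Longrightarrow> smooth_on S (dd v f)"
  unfolding smooth_on_iff_smooth_n by (metis smooth_n.simps(2))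

lemma smooth_on_subset: "smooth_on S f \<Longrightarrow> R \<subseteq> S \<Longrightarrow> smooth_on R f"
  unfolding smooth_on_def by auto

lemma smooth_on_imp_continuous_on: "smooth_on S f \<Longrightarrow> continuous_on S f"
  by (meson continuous_at_imp_continuous_on differentiable_imp_continuous_within
      smooth_on_imp_differentiable)

text \<open>\<open>frechet_derivative\<close> is a choice among the derivatives at the point.
  Functions agreeing near \<open>x\<close> have the same derivatives there, so the choices coincide
  even if no derivative exists.\<close>

lemma dd_cong_open:
  assumes "open S" "x \<in> S" "\<And>y. y \<in> S \<Longrightarrow> f y = g y"
  shows "dd v f x = dd v g x"
proof -
  have "(f has_derivative h) (at x) \<longleftrightarrow> (g has_derivative h) (at x)" for h
    using assms has_derivative_transform_within_open[of _ _ x UNIV S] by metis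
  then show ?thesis unfolding dd_def frechet_derivative_def by simp
qed

lemma differentiable_cong_open:
  assumes "f differentiable at x" "open S" "x \<in> S" "\<And>y. y \<in> S \<Longrightarrow> f y = g y"
  shows "g differentiable at x"
  using assms unfolding differentiable_def
  by (metis has_derivative_transform_within_open)

lemma smooth_n_cong:
  assumes "open S"
  shows "smooth_n n S f \<Longrightarrow> (\<And>y. y \<in> S \<Longrightarrow> f y = g y) \<Longrightarrow> smooth_n n S g"
proof (induction n arbitrary: f g)
  case 0
  then show ?case using assms differentiable_cong_open by (metis smooth_n.simps(1))
next
  case (Suc n)
  have "smooth_n n S (dd v g)" for v
    by (rule Suc.IH[of "dd v f"]) (use Suc.prems dd_cong_open[OF assms, of _ f g] in auto)
  moreover have "g differentiable at x" if "x \<in> S" for x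
    using Suc.prems differentiable_cong_open[OF _ assms that] smooth_n_imp_differentiable that by blast
  ultimately show ?case by simp
qed

lemma smooth_on_cong:
  assumes "open S" "smooth_on S f" "\<And>y. y \<in> S \<Longrightarrow> f y = g y"
  shows "smooth_on S g"
  using assms smooth_n_cong unfolding smooth_on_iff_smooth_n by metis

lemma smooth_on_Un:
  "smooth_on S f \<Longrightarrow> smooth_on R f \<Longrightarrow> smooth_on (S \<union> R) f"
  unfolding smooth_on_def by auto

lemma dd_const [simp]: "dd v (\<lambda>x. c) = (\<lambda>x. 0)"
  by (rule ext) (rule dd_eq[OF has_derivative_const])

lemma smooth_n_const: "smooth_n n S (\<lambda>x. c)"
  by (induction n arbitrary: c) auto

lemma smooth_on_const: "smooth_on S (\<lambda>x. c)"
  by (simp add: smooth_on_iff_smooth_n smooth_n_const)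

lemma smooth_on_bounded_linear:
  assumes "bounded_linear f" shows "smooth_on S f"
proof -
  have [simp]: "dd v f = (\<lambda>x. f v)" for v
    by (rule ext) (rule dd_eq[OF bounded_linear_imp_has_derivative[OF assms]])
  have "smooth_n n S f" for n
    using bounded_linear_imp_differentiable[OF assms] by (cases n) (auto simp: smooth_n_const)
  then show ?thesis by (simp add: smooth_on_iff_smooth_n)
qed

lemma dd_bounded_linear:
  assumes "bounded_linear h" "f differentiable at x"
  shows "dd v (\<lambda>x. h (f x)) x = h (dd v f x)"
  by (rule dd_eq[OF bounded_linear.has_derivative[OF assms(1) has_derivative_dd[OF assms(2)]]])

lemma smooth_n_bounded_linear_comp:
  assumes "bounded_linear h" "open S"
  shows "smooth_n n S f \<Longrightarrow> smooth_n n S (\<lambda>x. h (f x))"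
proof (induction n arbitrary: f)
  case 0
  then show ?case
    using assms by (auto intro: differentiable_compose[of h, simplified] bounded_linear_imp_differentiable)
next
  case (Suc n)
  have "smooth_n n S (dd v (\<lambda>x. h (f x)))" for v
    by (rule smooth_n_cong[OF assms(2) Suc.IH[of "dd v f"]])
      (use Suc.prems in \<open>auto simp: dd_bounded_linear[OF assms(1)]\<close>)
  moreover have "(\<lambda>x. h (f x)) differentiable at x" if "x \<in> S" for x
    using Suc.prems that assms
    by (auto intro: differentiable_compose[of h, simplified] bounded_linear_imp_differentiable)
  ultimately show ?case by simp
qed

lemma smooth_on_bounded_linear_comp:
  "bounded_linear h \<Longrightarrow> open S \<Longrightarrow> smooth_on S f \<Longrightarrow> smooth_on S (\<lambda>x. h (f x))"
  using smooth_n_bounded_linear_comp unfolding smooth_on_iff_smooth_n by blast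

lemma dd_add:
  assumes "f differentiable at x" "g differentiable at x"
  shows "dd v (\<lambda>x. f x + g x) x = dd v f x + dd v g x"
  by (rule dd_eq[OF has_derivative_add[OF assms[THEN has_derivative_dd]]])

lemma smooth_n_add:
  assumes "open S"
  shows "smooth_n n S f \<Longrightarrow> smooth_n n S g \<Longrightarrow> smooth_n n S (\<lambda>x. f x + g x)"
proof (induction n arbitrary: f g)
  case (Suc n)
  have "smooth_n n S (dd v (\<lambda>x. f x + g x))" for v
    by (rule smooth_n_cong[OF assms Suc.IH[of "dd v f" "dd v g"]])
      (use Suc.prems in \<open>auto simp: dd_add\<close>)
  then show ?case using Suc.prems by auto
qed auto

lemma dd_mult:
  fixes f g :: "'a::real_normed_vector \<Rightarrow> 'b::real_normed_algebra"
  assumes "f differentiable at x" "g differentiable at x"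
  shows "dd v (\<lambda>x. f x * g x) x = f x * dd v g x + dd v f x * g x"
  by (rule dd_eq[OF has_derivative_mult[OF assms[THEN has_derivative_dd]]])

lemma smooth_n_mult:
  fixes f g :: "'a::real_normed_vector \<Rightarrow> 'b::real_normed_algebra"
  assumes "open S"
  shows "smooth_n n S f \<Longrightarrow> smooth_n n S g \<Longrightarrow> smooth_n n S (\<lambda>x. f x * g x)"
proof (induction n arbitrary: f g)
  case (Suc n)
  have fg: "smooth_n n S f" "smooth_n n S g"
    using Suc.prems smooth_n_mono by (meson le_SucI order_refl)+
  have "smooth_n n S (\<lambda>x. f x * dd v g x + dd v f x * g x)" for v
    by (rule smooth_n_add[OF assms Suc.IH Suc.IH]) (use Suc.prems fg in auto)
  then have "smooth_n n S (dd v (\<lambda>x. f x * g x))" for v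
    by (rule smooth_n_cong[OF assms]) (use Suc.prems dd_mult in fastforce)
  then show ?case using Suc.prems by auto
qed auto

lemma smooth_on_add: "open S \<Longrightarrow> smooth_on S f \<Longrightarrow> smooth_on S g \<Longrightarrow> smooth_on S (\<lambda>x. f x + g x)"
  by (simp add: smooth_on_iff_smooth_n smooth_n_add)

lemma smooth_on_mult:
  fixes f g :: "'a::real_normed_vector \<Rightarrow> 'b::real_normed_algebra"
  shows "open S \<Longrightarrow> smooth_on S f \<Longrightarrow> smooth_on S g \<Longrightarrow> smooth_on S (\<lambda>x. f x * g x)"
  by (simp add: smooth_on_iff_smooth_n smooth_n_mult)

lemma smooth_on_cmult:
  fixes f :: "'a::real_normed_vector \<Rightarrow> 'b::real_normed_algebra"
  shows "open S \<Longrightarrow> smooth_on S f \<Longrightarrow> smooth_on S (\<lambda>x. c * f x)"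
  by (rule smooth_on_bounded_linear_comp[OF bounded_linear_mult_right])

lemma smooth_on_diff:
  assumes "open S" "smooth_on S f" "smooth_on S g"
  shows "smooth_on S (\<lambda>x. f x - g x)"
  using smooth_on_add[OF assms(1,2)
      smooth_on_bounded_linear_comp[OF bounded_linear_minus[OF bounded_linear_ident] assms(1,3)]]
  by simp

lemma smooth_on_sum:
  assumes "open S" "\<And>i. i \<in> A \<Longrightarrow> smooth_on S (f i)"
  shows "smooth_on S (\<lambda>x. \<Sum>i\<in>A. f i x)"
  using assms(2)
  by (induction A rule: infinite_finite_induct) (auto intro: smooth_on_const smooth_on_add assms(1))

lemma smooth_on_of_real:
  "open S \<Longrightarrow> smooth_on S f \<Longrightarrow> smooth_on S (\<lambda>x. of_real (f x) :: complex)"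
  by (rule smooth_on_bounded_linear_comp[OF bounded_linear_of_real])

lemma dd_real_chain:
  fixes f :: "'a::real_normed_vector \<Rightarrow> real"
  assumes "f differentiable at x" "(h has_real_derivative h') (at (f x))"
  shows "dd v (\<lambda>x. h (f x)) x = h' * dd v f x"
  using dd_eq[OF has_derivative_compose[OF has_derivative_dd[OF assms(1)]
        assms(2)[unfolded has_field_derivative_def]]] .

text \<open>\<open>h\<close> is a whole tower of successive derivatives: differentiating
  \<open>h k\<close> after \<open>f\<close> produces \<open>h (Suc k)\<close> after \<open>f\<close>
  times \<open>dd v f\<close>, so the induction treats all \<open>k\<close> at once.\<close>

lemma smooth_n_real_chain:
  fixes f :: "'a::real_normed_vector \<Rightarrow> real"
  assumes "open S" and f: "smooth_on S f"
    and h: "\<And>k x. x \<in> S \<Longrightarrow> (h k has_real_derivative h (Suc k) (f x)) (at (f x))"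
  shows "smooth_n n S (\<lambda>x. h k (f x))"
proof (induction n arbitrary: k)
  have d: "(\<lambda>x. h k (f x)) differentiable at x" if "x \<in> S" for x k
    using has_derivative_compose[OF has_derivative_dd[OF smooth_on_imp_differentiable[OF f that]]
        h[OF that, unfolded has_field_derivative_def]] by (auto simp: differentiable_def)
  case 0
  then show ?case using d by simp
  case (Suc n)
  have "smooth_n n S (\<lambda>x. h (Suc k) (f x) * dd v f x)" for v
    using Suc.IH smooth_on_dd[OF f] by (intro smooth_n_mult assms(1)) (auto simp: smooth_on_iff_smooth_n)
  then have "smooth_n n S (dd v (\<lambda>x. h k (f x)))" for v
    using smooth_n_cong[OF assms(1), of n "\<lambda>x. h (Suc k) (f x) * dd v f x" "dd v (\<lambda>x. h k (f x))"]
    by (simp add: dd_real_chain[OF smooth_on_imp_differentiable[OF f] h])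
  then show ?case using d by simp
qed

lemma smooth_on_real_chain:
  fixes f :: "'a::real_normed_vector \<Rightarrow> real"
  assumes "open S" "smooth_on S f"
    and "\<And>k x. x \<in> S \<Longrightarrow> (h k has_real_derivative h (Suc k) (f x)) (at (f x))"
  shows "smooth_on S (\<lambda>x. h 0 (f x))"
  using smooth_n_real_chain[of S f h] assms by (simp add: smooth_on_iff_smooth_n)

lemma smooth_on_powr:
  fixes f :: "'a::real_normed_vector \<Rightarrow> real"
  assumes "open S" "smooth_on S f" "\<And>x. x \<in> S \<Longrightarrow> 0 < f x"
  shows "smooth_on S (\<lambda>x. f x powr s)"
proof -
  define h where "h k t = (\<Prod>i<k. s - real i) * t powr (s - real k)" for k t
  have "(h k has_real_derivative h (Suc k) t) (at t)" if "0 < t" for k t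
  proof -
    have "((\<lambda>t. t powr (s - real k)) has_real_derivative (s - real k) * t powr (s - real k - 1)) (at t)"
      using that by (rule has_real_derivative_powr)
    from DERIV_cmult[OF this, of "\<Prod>i<k. s - real i"] show ?thesis
      unfolding h_def by (simp add: algebra_simps)
  qed
  from smooth_on_real_chain[of S f h, OF assms(1,2) this] assms(3) show ?thesis
    by (simp add: h_def)
qed

lemma has_real_derivative_along_line:
  fixes u :: "'a::real_normed_vector \<Rightarrow> real"
  assumes "u differentiable at (y + s *\<^sub>R d)"
  shows "((\<lambda>s. u (y + s *\<^sub>R d)) has_real_derivative dd d u (y + s *\<^sub>R d)) (at s)"
proof -
  have "((\<lambda>s. y + s *\<^sub>R d) has_derivative (\<lambda>h. h *\<^sub>R d)) (at s)"
    by (auto intro!: derivative_eq_intros)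
  from has_derivative_compose[OF this has_derivative_dd[OF assms]]
  have "((\<lambda>s. u (y + s *\<^sub>R d)) has_derivative (\<lambda>h. dd (h *\<^sub>R d) u (y + s *\<^sub>R d))) (at s)" .
  moreover have "dd (h *\<^sub>R d) u (y + s *\<^sub>R d) = dd d u (y + s *\<^sub>R d) * h" for h
    using linear_scale[OF linear_dd[OF assms]] by simp
  ultimately show ?thesis by (simp add: has_field_derivative_def)
qed

text \<open>Clairaut: both mixed derivatives equal the limit of the second difference
  of \<open>f\<close> along \<open>v\<close> and \<open>w\<close>.\<close>

lemma second_difference:
  fixes f :: "'a::real_normed_vector \<Rightarrow> real"
  assumes f: "smooth_on S f" and "0 < t"
    and S: "\<And>a b. 0 \<le> a \<Longrightarrow> a \<le> t \<Longrightarrow> 0 \<le> b \<Longrightarrow> b \<le> t \<Longrightarrow> x + a *\<^sub>R v + b *\<^sub>R w \<in> S"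
  shows "\<exists>a b. 0 \<le> a \<and> a \<le> t \<and> 0 \<le> b \<and> b \<le> t \<and>
    f (x + t *\<^sub>R v + t *\<^sub>R w) - f (x + t *\<^sub>R v) - f (x + t *\<^sub>R w) + f x
      = t^2 * dd w (dd v f) (x + a *\<^sub>R v + b *\<^sub>R w)"
proof -
  note line = has_real_derivative_along_line[OF smooth_on_imp_differentiable]
  define p where "p s = f (x + t *\<^sub>R w + s *\<^sub>R v) - f (x + s *\<^sub>R v)" for s
  have "\<exists>a>0. a < t \<and> p t - p 0 = (t - 0) * (dd v f (x + t *\<^sub>R w + a *\<^sub>R v) - dd v f (x + a *\<^sub>R v))"
    unfolding p_def
  proof (rule MVT2[OF \<open>0 < t\<close>])
    fix s assume s: "0 \<le> s" "s \<le> t"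
    have "x + t *\<^sub>R w + s *\<^sub>R v \<in> S" "x + s *\<^sub>R v \<in> S"
      using S[of s t] S[of s 0] s \<open>0 < t\<close> by (simp_all add: ac_simps)
    then show "((\<lambda>s. f (x + t *\<^sub>R w + s *\<^sub>R v) - f (x + s *\<^sub>R v)) has_real_derivative
        dd v f (x + t *\<^sub>R w + s *\<^sub>R v) - dd v f (x + s *\<^sub>R v)) (at s)"
      by (intro DERIV_diff line[OF f])
  qed
  then obtain a where a: "0 < a" "a < t"
    and pa: "p t - p 0 = t * (dd v f (x + t *\<^sub>R w + a *\<^sub>R v) - dd v f (x + a *\<^sub>R v))" by auto
  have "\<exists>b>0. b < t \<and> dd v f (x + a *\<^sub>R v + t *\<^sub>R w) - dd v f (x + a *\<^sub>R v + 0 *\<^sub>R w)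
     = (t - 0) * dd w (dd v f) (x + a *\<^sub>R v + b *\<^sub>R w)"
  proof (rule MVT2[OF \<open>0 < t\<close>])
    fix s assume "0 \<le> s" "s \<le> t"
    then show "((\<lambda>s. dd v f (x + a *\<^sub>R v + s *\<^sub>R w)) has_real_derivative
        dd w (dd v f) (x + a *\<^sub>R v + s *\<^sub>R w)) (at s)"
      using S a by (intro line[OF smooth_on_dd[OF f]]) simp
  qed
  then obtain b where b: "0 < b" "b < t" and "dd v f (x + a *\<^sub>R v + t *\<^sub>R w) - dd v f (x + a *\<^sub>R v)
     = t * dd w (dd v f) (x + a *\<^sub>R v + b *\<^sub>R w)" by auto
  with pa have "p t - p 0 = t^2 * dd w (dd v f) (x + a *\<^sub>R v + b *\<^sub>R w)"
    by (simp add: power2_eq_square add.commute add.left_commute)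
  moreover have "f (x + t *\<^sub>R v + t *\<^sub>R w) - f (x + t *\<^sub>R v) - f (x + t *\<^sub>R w) + f x = p t - p 0"
    unfolding p_def by (simp add: algebra_simps)
  ultimately show ?thesis using a b by (intro exI[of _ a] exI[of _ b]) auto
qed

lemma dd_commute_real:
  fixes f :: "'a::real_normed_vector \<Rightarrow> real"
  assumes S: "open S" and f: "smooth_on S f" and x: "x \<in> S"
  shows "dd v (dd w f) x = dd w (dd v f) x"
proof (rule ccontr)
  assume ne: "dd v (dd w f) x \<noteq> dd w (dd v f) x"
  \<comment> \<open>Half the gap. At the points produced by the mean value argument the two mixed
    derivatives are equal, and each is less than \<open>e\<close> away from its value at
    \<open>x\<close>, which contradicts a gap of \<open>e + e\<close>.\<close>
  define e where "e = \<bar>dd v (dd w f) x - dd w (dd v f) x\<bar> / 2"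
  have e: "e > 0" using ne by (simp add: e_def)
  have c: "isCont (dd a (dd b f)) x" for a b
    using smooth_on_imp_differentiable[OF smooth_on_dd[OF smooth_on_dd[OF f]] x]
    by (rule differentiable_imp_continuous_within)
  obtain d1 where d1: "d1 > 0" "\<And>y. dist y x < d1 \<Longrightarrow> \<bar>dd v (dd w f) y - dd v (dd w f) x\<bar> < e"
    using c[of v w] e unfolding continuous_at_eps_delta dist_real_def by metis
  obtain d2 where d2: "d2 > 0" "\<And>y. dist y x < d2 \<Longrightarrow> \<bar>dd w (dd v f) y - dd w (dd v f) x\<bar> < e"
    using c[of w v] e unfolding continuous_at_eps_delta dist_real_def by metis
  obtain d3 where d3: "d3 > 0" "ball x d3 \<subseteq> S" using S x open_contains_ball by blast
  define d where "d = min d1 (min d2 d3)"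
  have d: "d > 0" using d1 d2 d3 by (simp add: d_def)
  define t where "t = d / (2 * (norm v + norm w + 1))"
  have t: "t > 0" unfolding t_def using d by (simp add: add_nonneg_pos)
  have near: "dist (x + a *\<^sub>R v + b *\<^sub>R w) x < d" if "0 \<le> a" "a \<le> t" "0 \<le> b" "b \<le> t" for a b
  proof -
    have "dist (x + a *\<^sub>R v + b *\<^sub>R w) x \<le> a * norm v + b * norm w"
      using norm_triangle_ineq[of "a *\<^sub>R v" "b *\<^sub>R w"] that by (simp add: dist_norm algebra_simps)
    also have "\<dots> \<le> t * norm v + t * norm w"
      using that by (intro add_mono mult_right_mono) auto
    also have "\<dots> \<le> t * (norm v + norm w + 1)" using t by (simp add: algebra_simps)
    also have "\<dots> = d / 2" unfolding t_def
      using add_nonneg_pos[of "norm v + norm w" 1] by (simp add: field_simps)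
    also have "\<dots> < d" using d by simp
    finally show ?thesis .
  qed
  have inS: "x + a *\<^sub>R v + b *\<^sub>R w \<in> S" if "0 \<le> a" "a \<le> t" "0 \<le> b" "b \<le> t" for a b
    using near[OF that] d3 by (auto simp: d_def dist_commute subset_eq)
  have inS': "x + a *\<^sub>R w + b *\<^sub>R v \<in> S" if "0 \<le> a" "a \<le> t" "0 \<le> b" "b \<le> t" for a b
    using inS[of b a] that by (simp add: algebra_simps)
  obtain a b where ab: "0 \<le> a" "a \<le> t" "0 \<le> b" "b \<le> t"
    "f (x + t *\<^sub>R v + t *\<^sub>R w) - f (x + t *\<^sub>R v) - f (x + t *\<^sub>R w) + f x
      = t^2 * dd w (dd v f) (x + a *\<^sub>R v + b *\<^sub>R w)"
    using second_difference[OF f t inS] by auto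
  obtain a' b' where ab': "0 \<le> a'" "a' \<le> t" "0 \<le> b'" "b' \<le> t"
    "f (x + t *\<^sub>R w + t *\<^sub>R v) - f (x + t *\<^sub>R w) - f (x + t *\<^sub>R v) + f x
      = t^2 * dd v (dd w f) (x + a' *\<^sub>R w + b' *\<^sub>R v)"
    using second_difference[OF f t inS'] by auto
  have "t^2 * dd w (dd v f) (x + a *\<^sub>R v + b *\<^sub>R w) = t^2 * dd v (dd w f) (x + b' *\<^sub>R v + a' *\<^sub>R w)"
    using ab(5) ab'(5) by (simp add: algebra_simps)
  then have "dd w (dd v f) (x + a *\<^sub>R v + b *\<^sub>R w) = dd v (dd w f) (x + b' *\<^sub>R v + a' *\<^sub>R w)"
    using t by simp
  moreover have "\<bar>dd w (dd v f) (x + a *\<^sub>R v + b *\<^sub>R w) - dd w (dd v f) x\<bar> < e"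
    using near[OF ab(1-4)] by (intro d2) (simp add: d_def)
  moreover have "\<bar>dd v (dd w f) (x + b' *\<^sub>R v + a' *\<^sub>R w) - dd v (dd w f) x\<bar> < e"
    using near[of b' a'] ab' by (intro d1) (simp add: d_def)
  moreover have "\<bar>dd v (dd w f) x - dd w (dd v f) x\<bar> = e + e" by (simp add: e_def)
  ultimately show False by linarith
qed

lemma dd_commute:
  fixes f :: "'a::real_normed_vector \<Rightarrow> complex"
  assumes S: "open S" and f: "smooth_on S f" and x: "x \<in> S"
  shows "dd v (dd w f) x = dd w (dd v f) x"
proof -
  have *: "h (dd v (dd w f) x) = h (dd w (dd v f) x)" if h: "bounded_linear h" for h :: "complex \<Rightarrow> real"
  proof -
    have 1: "dd w (\<lambda>x. h (f x)) y = h (dd w f y)" if "y \<in> S" for w y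
      using dd_bounded_linear[OF h smooth_on_imp_differentiable[OF f that]] .
    have 2: "dd v (dd w (\<lambda>x. h (f x))) x = h (dd v (dd w f) x)" for v w
      using dd_cong_open[OF S x, of "dd w (\<lambda>x. h (f x))" "\<lambda>x. h (dd w f x)" v] 1
        dd_bounded_linear[OF h smooth_on_imp_differentiable[OF smooth_on_dd[OF f] x]] by simp
    show ?thesis
      using dd_commute_real[OF S smooth_on_bounded_linear_comp[OF h S f] x] unfolding 2 .
  qed
  show ?thesis using *[OF bounded_linear_Re] *[OF bounded_linear_Im] by (simp add: complex_eq_iff)
qed

section \<open>Smooth cutoff functions\<close>

text \<open>The derivative of P(1/t) exp(-1/t) is (1/t)^2 (P - P')(1/t) exp(-1/t); the recursion
  records the polynomials obtained in this way from the constant 1.\<close>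

fun flat_poly :: "nat \<Rightarrow> real poly" where
  "flat_poly 0 = 1"
| "flat_poly (Suc k) = [:0, 0, 1:] * (flat_poly k - pderiv (flat_poly k))"

text \<open>\<open>flat_exp k\<close> is the \<open>k\<close>-th derivative of the function equal to \<open>exp (- 1 / t)\<close> for \<open>t > 0\<close>
  and to \<open>0\<close> for \<open>t \<le> 0\<close>.\<close>

definition flat_exp :: "nat \<Rightarrow> real \<Rightarrow> real" where
  "flat_exp k t = (if t \<le> 0 then 0 else poly (flat_poly k) (1 / t) * exp (- (1 / t)))"

lemma poly_times_exp_minus_tendsto_0:
  "((\<lambda>x::real. poly p x * exp (- x)) \<longlongrightarrow> 0) at_top"
proof -
  have "((\<lambda>x::real. coeff p i * (x ^ i / exp x)) \<longlongrightarrow> 0) at_top" for i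
    using tendsto_mult_left[OF tendsto_power_div_exp_0[of i], of "coeff p i"] by simp
  then have "((\<lambda>x::real. \<Sum>i\<le>degree p. coeff p i * (x ^ i / exp x)) \<longlongrightarrow> 0) at_top"
    by (intro tendsto_null_sum) auto
  then show ?thesis
    by (simp add: poly_altdef sum_distrib_right exp_minus divide_inverse mult.assoc)
qed

lemma flat_exp_deriv: "(flat_exp k has_real_derivative flat_exp (Suc k) t) (at t)"
proof -
  consider "t < 0" | "t > 0" | "t = 0" by linarith
  then show ?thesis
  proof cases
    case 1
    have "((\<lambda>t. 0) has_real_derivative 0) (at t)" by simp
    then have "(flat_exp k has_real_derivative 0) (at t)"
      by (rule has_field_derivative_transform_within_open[of _ _ _ "{..<0}"])
        (use 1 in \<open>auto simp: flat_exp_def\<close>)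
    then show ?thesis using 1 by (simp add: flat_exp_def)
  next
    case 2
    have "((\<lambda>t. poly (flat_poly k) (1 / t) * exp (- (1 / t))) has_real_derivative
        (poly (flat_poly k) (1 / t) - poly (pderiv (flat_poly k)) (1 / t)) * (1 / t)^2 * exp (- (1 / t))) (at t)"
      by (rule derivative_eq_intros DERIV_chain2[OF poly_DERIV] refl | use 2 in force)+
        (use 2 in \<open>simp add: field_simps power2_eq_square\<close>)
    then have "(flat_exp k has_real_derivative
        (poly (flat_poly k) (1 / t) - poly (pderiv (flat_poly k)) (1 / t)) * (1 / t)^2 * exp (- (1 / t))) (at t)"
      by (rule has_field_derivative_transform_within_open[of _ _ _ "{0<..}"])
        (use 2 in \<open>auto simp: flat_exp_def\<close>)
    moreover have "flat_exp (Suc k) t =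
        (poly (flat_poly k) (1 / t) - poly (pderiv (flat_poly k)) (1 / t)) * (1 / t)^2 * exp (- (1 / t))"
      using 2 by (simp add: flat_exp_def power2_eq_square algebra_simps)
    ultimately show ?thesis by simp
  next
    case 3
    have left: "((\<lambda>s. (flat_exp k s - flat_exp k 0) / (s - 0)) \<longlongrightarrow> 0) (at_left 0)"
      by (rule Lim_transform_eventually[OF tendsto_const])
        (auto simp: flat_exp_def eventually_at_filter)
    \<comment> \<open>At 0 from the right the difference quotient is x P(x) exp(-x) with x = 1/s
      tending to infinity; this is the origin of the extra factor \<open>[:0, 1:]\<close>.\<close>
    have "((\<lambda>s. poly ([:0, 1:] * flat_poly k) (inverse s) * exp (- inverse s)) \<longlongrightarrow> 0) (at_right 0)"
      by (rule filterlim_compose[OF poly_times_exp_minus_tendsto_0 filterlim_inverse_at_top_right])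
    then have right: "((\<lambda>s. (flat_exp k s - flat_exp k 0) / (s - 0)) \<longlongrightarrow> 0) (at_right 0)"
      by (rule Lim_transform_eventually)
        (auto simp: flat_exp_def eventually_at_filter field_simps)
    show ?thesis
      using filterlim_split_at[OF left right] 3
      by (simp add: has_field_derivative_iff flat_exp_def)
  qed
qed

lemma flat_exp_0_pos: "0 < flat_exp 0 t \<longleftrightarrow> 0 < t"
  and flat_exp_0_nonneg: "0 \<le> flat_exp 0 t"
  and flat_exp_0_eq_0: "t \<le> 0 \<Longrightarrow> flat_exp 0 t = 0"
  by (auto simp: flat_exp_def)

lemma smooth_on_flat_exp: "open S \<Longrightarrow> smooth_on S f \<Longrightarrow> smooth_on S (\<lambda>x. flat_exp 0 (f x))"
  using smooth_on_real_chain[of S f flat_exp] flat_exp_deriv by blast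

lemma smooth_on_norm_square: "smooth_on UNIV (\<lambda>x::'a::euclidean_space. (norm (x - a))\<^sup>2)"
proof -
  have "(norm (x - a))\<^sup>2 = (\<Sum>b\<in>Basis. (x \<bullet> b - a \<bullet> b) * (x \<bullet> b - a \<bullet> b))" for x
    unfolding power2_norm_eq_inner by (subst euclidean_inner) (simp only: inner_diff_left)
  moreover have "smooth_on UNIV (\<lambda>x::'a. x \<bullet> b - a \<bullet> b)" for b
    by (intro smooth_on_diff smooth_on_const smooth_on_bounded_linear bounded_linear_inner_left open_UNIV)
  then have "smooth_on UNIV (\<lambda>x::'a. \<Sum>b\<in>Basis. (x \<bullet> b - a \<bullet> b) * (x \<bullet> b - a \<bullet> b))"
    by (intro smooth_on_sum smooth_on_mult open_UNIV) auto
  ultimately show ?thesis by simp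
qed

text \<open>Two sets accompany the cutoff: on the open set \<open>V\<close> its derivatives vanish,
  and the compact set \<open>L\<close> carries its support. The later estimates treat
  \<open>V\<close> and its complement differently.\<close>

lemma smooth_cutoff:
  fixes K :: "'a::euclidean_space set"
  assumes "compact K" "open U" "K \<subseteq> U"
  obtains \<eta> :: "'a \<Rightarrow> real" and V L where "smooth_on UNIV \<eta>" "\<And>x. 0 \<le> \<eta> x" "\<And>x. \<eta> x \<le> 1"
    "open V" "K \<subseteq> V" "\<And>x. x \<in> V \<Longrightarrow> \<eta> x = 1" "compact L" "L \<subseteq> U" "V \<subseteq> L" "\<And>x. x \<notin> L \<Longrightarrow> \<eta> x = 0"
proof -
  have "\<forall>a\<in>K. \<exists>r>0. cball a r \<subseteq> U" using assms open_contains_cball by blast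
  then obtain r where r: "\<And>a. a \<in> K \<Longrightarrow> r a > 0 \<and> cball a (r a) \<subseteq> U" by metis
  have cov: "K \<subseteq> (\<Union>a\<in>K. ball a (r a))" using r by fastforce
  obtain A where A: "A \<subseteq> K" "finite A" "K \<subseteq> (\<Union>a\<in>A. ball a (r a))"
    by (rule compactE_image[OF assms(1) _ cov]) auto
  define s where "s x = (\<Sum>a\<in>A. flat_exp 0 ((r a)\<^sup>2 - (norm (x - a))\<^sup>2))" for x
  have s_smooth: "smooth_on UNIV s"
    unfolding s_def
    by (intro smooth_on_sum smooth_on_flat_exp smooth_on_diff smooth_on_const smooth_on_norm_square open_UNIV)
  have s0: "0 \<le> s x" for x unfolding s_def by (intro sum_nonneg) (simp add: flat_exp_0_nonneg)
  have spos: "0 < s x" if x: "x \<in> K" for x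
  proof -
    obtain a where a: "a \<in> A" "dist a x < r a" using A(3) x by auto
    then have "(norm (x - a))\<^sup>2 < (r a)\<^sup>2"
      by (intro power_strict_mono) (auto simp: dist_norm norm_minus_commute)
    then show ?thesis unfolding s_def
      by (intro sum_pos2[OF \<open>finite A\<close> a(1)]) (auto simp: flat_exp_0_nonneg flat_exp_0_pos)
  qed
  obtain c where c: "c > 0" "\<And>x. x \<in> K \<Longrightarrow> c \<le> s x"
  proof (cases "K = {}")
    case True then show ?thesis using that[of 1] by simp
  next
    case False
    have "continuous_on K s" using smooth_on_imp_continuous_on[OF s_smooth] continuous_on_subset by blast
    from continuous_attains_inf[OF assms(1) False this] obtain m where "m \<in> K" "\<And>x. x \<in> K \<Longrightarrow> s m \<le> s x"
      by blast
    then show ?thesis using that[of "s m"] spos by auto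
  qed
  \<comment> \<open>One of \<open>s x > 0\<close> and \<open>s x < c / 2\<close> always holds, so
    the denominator is positive; where \<open>s x > c / 2\<close> its second summand is zero and the
    quotient is 1. The reciprocal is written as a power so that \<open>smooth_on_powr\<close>
    applies.\<close>
  define \<eta> where "\<eta> x = flat_exp 0 (s x) * (flat_exp 0 (s x) + flat_exp 0 (c / 2 - s x)) powr (-1)" for x
  define L where "L = (\<Union>a\<in>A. cball a (r a))"
  have den: "0 < flat_exp 0 (s x) + flat_exp 0 (c / 2 - s x)" for x
    using c(1) flat_exp_0_pos[of "s x"] flat_exp_0_pos[of "c / 2 - s x"]
      flat_exp_0_nonneg[of "s x"] flat_exp_0_nonneg[of "c / 2 - s x"] by linarith
  have \<eta>: "\<eta> x = flat_exp 0 (s x) / (flat_exp 0 (s x) + flat_exp 0 (c / 2 - s x))" for x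
    unfolding \<eta>_def using den[of x] by (simp add: powr_minus_divide)
  have 1: "smooth_on UNIV (\<lambda>x. flat_exp 0 (s x))"
    by (rule smooth_on_flat_exp[OF open_UNIV s_smooth])
  have 2: "smooth_on UNIV (\<lambda>x. flat_exp 0 (c / 2 - s x))"
    by (rule smooth_on_flat_exp[OF open_UNIV smooth_on_diff[OF open_UNIV smooth_on_const s_smooth]])
  show ?thesis
  proof
    show "smooth_on UNIV \<eta>" unfolding \<eta>_def
      by (rule smooth_on_mult[OF open_UNIV 1 smooth_on_powr[OF open_UNIV smooth_on_add[OF open_UNIV 1 2] den]])
    show "0 \<le> \<eta> x" "\<eta> x \<le> 1" for x
      unfolding \<eta> using den[of x] flat_exp_0_nonneg by (auto simp: divide_le_eq)
    show "open {x. c / 2 < s x}"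
      using smooth_on_imp_continuous_on[OF s_smooth] by (intro open_Collect_less) auto
    show "K \<subseteq> {x. c / 2 < s x}"
    proof
      fix x assume "x \<in> K"
      then show "x \<in> {x. c / 2 < s x}" using c(1) c(2)[of x] by simp
    qed
    show "\<eta> x = 1" if "x \<in> {x. c / 2 < s x}" for x
      unfolding \<eta> using that den[of x] flat_exp_0_eq_0[of "c / 2 - s x"] by auto
    show "compact L" unfolding L_def using A by (intro compact_UN) auto
    show "L \<subseteq> U" unfolding L_def using A r by blast
    have sL: "s x = 0" if "x \<notin> L" for x
      unfolding s_def
    proof (intro sum.neutral ballI flat_exp_0_eq_0)
      fix a assume "a \<in> A"
      then have "r a \<le> norm (x - a)" "0 \<le> r a"
        using that A r[of a] by (auto simp: L_def dist_norm norm_minus_commute)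
      then show "(r a)\<^sup>2 - (norm (x - a))\<^sup>2 \<le> 0" by (simp add: power_mono)
    qed
    show "{x. c / 2 < s x} \<subseteq> L"
    proof
      fix x assume "x \<in> {x. c / 2 < s x}"
      then show "x \<in> L" using c(1) sL[of x] by (cases "x \<in> L") auto
    qed
    show "\<eta> x = 0" if "x \<notin> L" for x
      unfolding \<eta> using sL[OF that] by (simp add: flat_exp_0_eq_0)
  qed
qed

section \<open>Exterior multiplication by (1,1)-forms\<close>

type_synonym 'n cform = "'n set \<Rightarrow> 'n set \<Rightarrow> complex"

text \<open>Coefficients of \<open>(\<Sum>j k. M j k dz_j \<and> dzbar_k) \<and> \<psi>\<close> for a \<open>(q,q)\<close>-form \<open>\<psi>\<close>, with the sign
  convention of \<^const>\<open>ddbar_form\<close>.\<close>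

definition wedge11 :: "nat \<Rightarrow> ('n::{finite,linorder} \<Rightarrow> 'n \<Rightarrow> complex) \<Rightarrow> 'n cform \<Rightarrow> 'n cform" where
  "wedge11 q M \<psi> = (\<lambda>I J. if card I = Suc q \<and> card J = Suc q then
     (\<Sum>j\<in>I. \<Sum>k\<in>J. (-1) ^ q * sgn_ins j (I - {j}) * sgn_ins k (J - {k}) * (M j k * \<psi> (I - {j}) (J - {k})))
     else 0)"

definition sgn2 :: "'n::linorder set \<Rightarrow> 'n \<Rightarrow> 'n \<Rightarrow> complex" where
  "sgn2 I j a = sgn_ins j (I - {j}) * sgn_ins a (I - {j} - {a})"

text \<open>Wedge with a (2,2)-form having coefficient \<open>X j k a b\<close> on dz_j, dzbar_k,
  dz_a, dzbar_b. A general \<open>X\<close> is used because second derivatives of a matrix field are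
  not products of two matrices. The minus sign is (-1)^(q+1) (-1)^q, coming from two applications of
  \<open>wedge11\<close>.\<close>

definition wedge22 :: "nat \<Rightarrow> ('n::{finite,linorder} \<Rightarrow> 'n \<Rightarrow> 'n \<Rightarrow> 'n \<Rightarrow> complex) \<Rightarrow> 'n cform \<Rightarrow> 'n cform" where
  "wedge22 q X \<psi> = (\<lambda>I J. if card I = Suc (Suc q) \<and> card J = Suc (Suc q) then
     (\<Sum>j\<in>I. \<Sum>a\<in>I - {j}. \<Sum>k\<in>J. \<Sum>b\<in>J - {k}.
        - (sgn2 I j a * sgn2 J k b * (X j k a b * \<psi> (I - {j} - {a}) (J - {k} - {b}))))
     else 0)"

lemma wedge11_add_left:
  "wedge11 q (\<lambda>j k. M j k + N j k) \<psi> I J = wedge11 q M \<psi> I J + wedge11 q N \<psi> I J"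
  by (simp add: wedge11_def algebra_simps sum.distrib)

lemma wedge11_cmult_left: "wedge11 q (\<lambda>j k. c * M j k) \<psi> I J = c * wedge11 q M \<psi> I J"
  by (simp add: wedge11_def sum_distrib_left algebra_simps)

lemma wedge11_add_right:
  "wedge11 q M (\<lambda>I J. \<psi> I J + \<phi> I J) I J = wedge11 q M \<psi> I J + wedge11 q M \<phi> I J"
  by (simp add: wedge11_def algebra_simps sum.distrib)

lemma wedge11_cmult_right: "wedge11 q M (\<lambda>I J. c * \<psi> I J) I J = c * wedge11 q M \<psi> I J"
  by (simp add: wedge11_def sum_distrib_left algebra_simps)

lemma wedge11_zero_left [simp]: "wedge11 q (\<lambda>j k. 0) \<psi> = (\<lambda>I J. 0)"
  by (intro ext) (simp add: wedge11_def)

lemma wedge11_zero_right [simp]: "wedge11 q M (\<lambda>I J. 0) = (\<lambda>I J. 0)"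
  by (intro ext) (simp add: wedge11_def)

lemma wedge11_eq_0: "\<not> (card I = Suc q \<and> card J = Suc q) \<Longrightarrow> wedge11 q M \<psi> I J = 0"
  by (auto simp: wedge11_def)

lemma wedge11_wedge11:
  "wedge11 (Suc q) M (wedge11 q N \<psi>) = wedge22 q (\<lambda>j k a b. M j k * N a b) \<psi>"
proof (intro ext)
  fix I J :: "'a set"
  have fin: "finite I" "finite J" by simp_all
  show "wedge11 (Suc q) M (wedge11 q N \<psi>) I J = wedge22 q (\<lambda>j k a b. M j k * N a b) \<psi> I J"
  proof (cases "card I = Suc (Suc q) \<and> card J = Suc (Suc q)")
    case True
    then have c: "card (I - {j}) = Suc q" "card (J - {k}) = Suc q" if "j \<in> I" "k \<in> J" for j k
      using that fin by (auto simp: card_Diff_singleton)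
    have sq: "(-1) ^ q * ((-1) ^ q * z) = (z::complex)" for z
      by (simp add: mult.assoc[symmetric] power_add[symmetric] mult_2[symmetric])
    have "wedge11 (Suc q) M (wedge11 q N \<psi>) I J = (\<Sum>j\<in>I. \<Sum>k\<in>J. \<Sum>a\<in>I - {j}. \<Sum>b\<in>J - {k}.
        - (sgn2 I j a * sgn2 J k b * (M j k * N a b * \<psi> (I - {j} - {a}) (J - {k} - {b}))))"
      using True unfolding wedge11_def[of "Suc q"]
      by (auto simp: c wedge11_def sum_distrib_left sum_negf[symmetric] sgn2_def sq
          mult.assoc mult.left_commute intro!: sum.cong)
    also have "\<dots> = (\<Sum>j\<in>I. \<Sum>a\<in>I - {j}. \<Sum>k\<in>J. \<Sum>b\<in>J - {k}.
        - (sgn2 I j a * sgn2 J k b * (M j k * N a b * \<psi> (I - {j} - {a}) (J - {k} - {b}))))"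
      by (rule sum.cong[OF refl]) (rule sum.swap)
    finally show ?thesis using True by (simp add: wedge22_def)
  qed (auto simp: wedge11_def wedge22_def)
qed

lemma sgn2_swap:
  assumes "j \<in> I" "a \<in> I" "j \<noteq> a" "finite I"
  shows "sgn2 I a j = - sgn2 I j a"
proof -
  have *: "sgn2 I a j = - sgn2 I j a" if "j < a" "j \<in> I" "a \<in> I" for j a
  proof -
    have "{m \<in> I - {a}. m < a} = insert j {m \<in> I - {j} - {a}. m < a}"
      using that by auto
    moreover have "{m \<in> I - {j}. m < j} = {m \<in> I - {a} - {j}. m < j}" using that by auto
    moreover have "I - {a} - {j} = I - {j} - {a}" by auto
    ultimately show ?thesis
      using assms(4) by (simp add: sgn2_def sgn_ins_def card_insert_if)
  qed
  show ?thesis using *[of j a] *[of a j] assms by (cases "j < a") auto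
qed

lemma sum_swap_distinct_pairs:
  assumes "finite I"
  shows "(\<Sum>j\<in>I. \<Sum>a\<in>I - {j}. F j a) = (\<Sum>j\<in>I. \<Sum>a\<in>I - {j}. F a j)"
proof -
  have "(\<Sum>j\<in>I. \<Sum>a\<in>I - {j}. F j a) = (\<Sum>j\<in>I. \<Sum>a\<in>I. if a = j then 0 else F j a)" for F :: "'a \<Rightarrow> 'a \<Rightarrow> 'b"
    using assms by (intro sum.cong refl sum.mono_neutral_cong_left) auto
  then show ?thesis
    using sum.swap[of "\<lambda>j a. if j = a then 0 else F a j" I I] by (simp add: eq_commute)
qed

lemma sum_antisym_eq_0:
  fixes F :: "'a \<Rightarrow> 'a \<Rightarrow> complex"
  assumes "finite I" "\<And>j a. j \<in> I \<Longrightarrow> a \<in> I \<Longrightarrow> j \<noteq> a \<Longrightarrow> F a j = - F j a"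
  shows "(\<Sum>j\<in>I. \<Sum>a\<in>I - {j}. F j a) = 0"
proof -
  have "(\<Sum>j\<in>I. \<Sum>a\<in>I - {j}. F a j) = (\<Sum>j\<in>I. \<Sum>a\<in>I - {j}. - F j a)"
    using assms by (intro sum.cong refl) auto
  then have "(\<Sum>j\<in>I. \<Sum>a\<in>I - {j}. F j a) = - (\<Sum>j\<in>I. \<Sum>a\<in>I - {j}. F j a)"
    using sum_swap_distinct_pairs[OF assms(1), of F] by (simp add: sum_negf)
  then show ?thesis by simp
qed

text \<open>Exchanging the two (1,1)-factors transposes both the holomorphic and the antiholomorphic
  pair, and the two sign changes of \<open>sgn2\<close> cancel.\<close>

lemma wedge22_swap: "wedge22 q X \<psi> = wedge22 q (\<lambda>j k a b. X a b j k) \<psi>"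
proof (intro ext)
  fix I J :: "'a set"
  have fin: "finite I" "finite J" by simp_all
  define G where "G j a k b = - (sgn2 I j a * sgn2 J k b * (X j k a b * \<psi> (I - {j} - {a}) (J - {k} - {b})))" for j a k b
  have "(\<Sum>j\<in>I. \<Sum>a\<in>I - {j}. \<Sum>k\<in>J. \<Sum>b\<in>J - {k}. G j a k b) = (\<Sum>j\<in>I. \<Sum>a\<in>I - {j}. \<Sum>k\<in>J. \<Sum>b\<in>J - {k}. G a j k b)"
    by (rule sum_swap_distinct_pairs[OF fin(1)])
  also have "\<dots> = (\<Sum>j\<in>I. \<Sum>a\<in>I - {j}. \<Sum>k\<in>J. \<Sum>b\<in>J - {k}. G a j b k)"
    by (intro sum.cong refl sum_swap_distinct_pairs[OF fin(2)])
  also have "\<dots> = (\<Sum>j\<in>I. \<Sum>a\<in>I - {j}. \<Sum>k\<in>J. \<Sum>b\<in>J - {k}.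
      - (sgn2 I j a * sgn2 J k b * (X a b j k * \<psi> (I - {j} - {a}) (J - {k} - {b}))))"
  proof (intro sum.cong refl)
    fix j a k b assume "j \<in> I" "a \<in> I - {j}" "k \<in> J" "b \<in> J - {k}"
    then have "sgn2 I a j = - sgn2 I j a" "sgn2 J b k = - sgn2 J k b"
      by (auto intro!: sgn2_swap)
    then show "G a j b k = - (sgn2 I j a * sgn2 J k b * (X a b j k * \<psi> (I - {j} - {a}) (J - {k} - {b})))"
      unfolding G_def by (simp add: insert_commute Diff_insert[symmetric])
  qed
  finally show "wedge22 q X \<psi> I J = wedge22 q (\<lambda>j k a b. X a b j k) \<psi> I J"
    unfolding wedge22_def G_def by simp
qed

text \<open>The sign \<open>sgn2\<close> is antisymmetric in the two holomorphic indices, so a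
  symmetric \<open>X\<close> cancels in pairs. Combined with equality of mixed derivatives, this
  expresses in coefficients that a Levi form is closed.\<close>

lemma wedge22_eq_0_left:
  assumes "\<And>j k a b. X a k j b = X j k a b"
  shows "wedge22 q X \<psi> = (\<lambda>I J. 0)"
proof (intro ext)
  fix I J :: "'a set"
  have fin: "finite I" "finite J" by simp_all
  have "(\<Sum>j\<in>I. \<Sum>a\<in>I - {j}. \<Sum>k\<in>J. \<Sum>b\<in>J - {k}.
        - (sgn2 I j a * sgn2 J k b * (X j k a b * \<psi> (I - {j} - {a}) (J - {k} - {b})))) = 0"
  proof (rule sum_antisym_eq_0[OF fin(1)])
    fix j a assume "j \<in> I" "a \<in> I" "j \<noteq> a"
    then have s: "sgn2 I a j = - sgn2 I j a" using fin by (intro sgn2_swap)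
    have e: "I - {a} - {j} = I - {j} - {a}" by auto
    have x: "X a k j b = X j k a b" for k b by (rule assms)
    show "(\<Sum>k\<in>J. \<Sum>b\<in>J - {k}. - (sgn2 I a j * sgn2 J k b * (X a k j b * \<psi> (I - {a} - {j}) (J - {k} - {b}))))
      = - (\<Sum>k\<in>J. \<Sum>b\<in>J - {k}. - (sgn2 I j a * sgn2 J k b * (X j k a b * \<psi> (I - {j} - {a}) (J - {k} - {b}))))"
      unfolding s e x by (simp add: sum_negf)
  qed
  then show "wedge22 q X \<psi> I J = 0" by (simp add: wedge22_def)
qed

lemma wedge22_eq_0_right:
  assumes "\<And>j k a b. X j b a k = X j k a b"
  shows "wedge22 q X \<psi> = (\<lambda>I J. 0)"
proof (intro ext)
  fix I J :: "'a set"
  have fin: "finite I" "finite J" by simp_all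
  have "(\<Sum>k\<in>J. \<Sum>b\<in>J - {k}.
        - (sgn2 I j a * sgn2 J k b * (X j k a b * \<psi> (I - {j} - {a}) (J - {k} - {b})))) = 0" for j a
  proof (rule sum_antisym_eq_0[OF fin(2)])
    fix k b assume "k \<in> J" "b \<in> J" "k \<noteq> b"
    then have s: "sgn2 J b k = - sgn2 J k b" using fin by (intro sgn2_swap)
    have e: "J - {b} - {k} = J - {k} - {b}" by auto
    have x: "X j b a k = X j k a b" by (rule assms)
    show "- (sgn2 I j a * sgn2 J b k * (X j b a k * \<psi> (I - {j} - {a}) (J - {b} - {k})))
      = - (- (sgn2 I j a * sgn2 J k b * (X j k a b * \<psi> (I - {j} - {a}) (J - {k} - {b}))))"
      unfolding s e x by simp
  qed
  then show "wedge22 q X \<psi> I J = 0" by (simp add: wedge22_def)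
qed

lemma wedge22_add:
  "wedge22 q (\<lambda>j k a b. X j k a b + Y j k a b) \<psi> I J = wedge22 q X \<psi> I J + wedge22 q Y \<psi> I J"
  by (simp add: wedge22_def algebra_simps sum.distrib sum_negf sum_subtractf)

lemma wedge11_commute: "wedge11 (Suc q) M (wedge11 q N \<psi>) = wedge11 (Suc q) N (wedge11 q M \<psi>)"
  unfolding wedge11_wedge11 by (subst wedge22_swap) (simp add: mult.commute)

section \<open>Strongly positive forms\<close>

lemma minor_det_eq_det:
  "minor_det p A I = Determinant.det (Matrix.mat p p (\<lambda>(k, l). A k (sorted_list_of_set I ! l)))"
proof -
  have "(\<Prod>i = 0..<p. Matrix.mat p p (\<lambda>(k, l). A k (sorted_list_of_set I ! l)) $$ (i, \<pi> i))
      = (\<Prod>k<p. A k (sorted_list_of_set I ! \<pi> k))" if "\<pi> permutes {0..<p}" for \<pi>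
    using permutes_in_image[OF that] unfolding atLeast0LessThan by (intro prod.cong refl) auto
  then show ?thesis
    unfolding minor_det_def Let_def by (subst det_def'[of _ p]) (auto simp: atLeast0LessThan)
qed

lemma sorted_list_of_set_remove_nth:
  fixes I :: "'n::linorder set"
  assumes "finite I" "l < card I"
  shows "sorted_list_of_set (I - {sorted_list_of_set I ! l})
    = take l (sorted_list_of_set I) @ drop (Suc l) (sorted_list_of_set I)"
proof -
  let ?e = "sorted_list_of_set I"
  have len: "length ?e = card I" by simp
  have e: "?e = take l ?e @ ?e ! l # drop (Suc l) ?e" using assms len by (metis id_take_nth_drop)
  have d: "distinct ?e" by simp
  have "?e ! l \<notin> set (take l ?e)" using d e by (metis Un_iff disjoint_insert(1) distinct_append list.set(2))
  then have "remove1 (?e ! l) ?e = take l ?e @ drop (Suc l) ?e"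
    by (subst e) (simp add: remove1_append)
  then show ?thesis using sorted_list_of_set_remove[OF assms(1), of "?e ! l"] by simp
qed

lemma card_less_sorted_nth:
  fixes I :: "'n::linorder set"
  assumes "finite I" "l < card I"
  shows "card {m \<in> I - {sorted_list_of_set I ! l}. m < sorted_list_of_set I ! l} = l"
proof -
  let ?e = "sorted_list_of_set I"
  have len: "length ?e = card I" by simp
  have s: "sorted_wrt (<) ?e" by (simp add: strict_sorted_iff)
  have "{m \<in> I - {?e ! l}. m < ?e ! l} = (!) ?e ` {..<l}"
  proof (intro equalityI subsetI)
    fix m assume m: "m \<in> {m \<in> I - {?e ! l}. m < ?e ! l}"
    then obtain i where i: "i < card I" "m = ?e ! i"
      using assms(1) len by (metis (no_types, lifting) DiffD1 in_set_conv_nth mem_Collect_eq set_sorted_list_of_set)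
    have "i < l"
    proof (rule ccontr)
      assume "\<not> i < l"
      then have "?e ! l \<le> ?e ! i" using s i len by (simp add: sorted_nth_mono)
      then show False using m i leD by blast
    qed
    then show "m \<in> (!) ?e ` {..<l}" using i by auto
  next
    fix m assume "m \<in> (!) ?e ` {..<l}"
    then obtain i where i: "i < l" "m = ?e ! i" by auto
    then have "?e ! i < ?e ! l" using s assms len by (simp add: sorted_wrt_iff_nth_less)
    moreover have "?e ! i \<in> I" using i assms len by (metis less_trans nth_mem set_sorted_list_of_set)
    ultimately show "m \<in> {m \<in> I - {?e ! l}. m < ?e ! l}" using i by auto
  qed
  moreover have "inj_on ((!) ?e) {..<l}"
    by (rule inj_on_nth) (use assms len in auto)
  ultimately show ?thesis by (simp add: card_image)
qed

text \<open>Laplace expansion along the first row. The cofactor sign of column \<open>l\<close> is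
  (-1)^l, and \<open>l\<close> is the number of elements of \<open>I\<close> below the
  \<open>l\<close>-th one, which is the exponent in \<open>sgn_ins\<close>.\<close>

lemma minor_det_Suc:
  fixes I :: "'n::linorder set"
  assumes "finite I" "card I = Suc q"
  shows "minor_det (Suc q) A I
    = (\<Sum>j\<in>I. sgn_ins j (I - {j}) * (A 0 j * minor_det q (\<lambda>k. A (Suc k)) (I - {j})))"
proof -
  let ?e = "sorted_list_of_set I"
  let ?M = "Matrix.mat (Suc q) (Suc q) (\<lambda>(k, l). A k (?e ! l))"
  have len: "length ?e = Suc q" using assms by simp
  have del: "mat_delete ?M 0 l = Matrix.mat q q (\<lambda>(k, i). A (Suc k) (sorted_list_of_set (I - {?e ! l}) ! i))"
    if "l < Suc q" for l
  proof (rule eq_matI)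
    fix k i assume ki: "k < dim_row (Matrix.mat q q (\<lambda>(k, i). A (Suc k) (sorted_list_of_set (I - {?e ! l}) ! i)))"
      "i < dim_col (Matrix.mat q q (\<lambda>(k, i). A (Suc k) (sorted_list_of_set (I - {?e ! l}) ! i)))"
    then have "(take l ?e @ drop (Suc l) ?e) ! i = ?e ! (if i < l then i else Suc i)"
      using len that by (simp add: nth_append)
    then show "mat_delete ?M 0 l $$ (k, i)
        = Matrix.mat q q (\<lambda>(k, i). A (Suc k) (sorted_list_of_set (I - {?e ! l}) ! i)) $$ (k, i)"
      using ki that sorted_list_of_set_remove_nth[of I l] assms by (simp add: mat_delete_def)
  qed (simp_all add: mat_delete_def)
  have "minor_det (Suc q) A I = (\<Sum>l<Suc q. ?M $$ (0, l) * cofactor ?M 0 l)"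
    unfolding minor_det_eq_det by (rule laplace_expansion_row) auto
  also have "\<dots> = (\<Sum>l<Suc q. (\<lambda>j. sgn_ins j (I - {j}) * (A 0 j * minor_det q (\<lambda>k. A (Suc k)) (I - {j}))) (?e ! l))"
    using assms card_less_sorted_nth[OF assms(1)]
    by (intro sum.cong refl) (simp add: cofactor_def del sgn_ins_def minor_det_eq_det)
  also have "\<dots> = (\<Sum>j\<in>I. sgn_ins j (I - {j}) * (A 0 j * minor_det q (\<lambda>k. A (Suc k)) (I - {j})))"
  proof (rule sum.reindex_bij_betw)
    have "bij_betw ((!) ?e) {..<length ?e} (set ?e)" by (rule bij_betw_nth) auto
    then show "bij_betw ((!) ?e) {..<Suc q} I" using assms len by simp
  qed
  finally show ?thesis .
qed

text \<open>Passing from q to q + 1 raises the exponent q (q - 1) / 2 by q, which is the factor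
  (-1)^q built into \<open>wedge11\<close>. It makes induction on the degree of strongly positive
  forms possible.\<close>

lemma spos_form_Suc:
  "spos_form (Suc q) A = (\<lambda>I J. \<i> * wedge11 q (\<lambda>j k. A 0 j * cnj (A 0 k)) (spos_form q (\<lambda>k. A (Suc k))) I J)"
proof (intro ext)
  fix I J :: "'a set"
  have fin: "finite I" "finite J" by simp_all
  show "spos_form (Suc q) A I J
      = \<i> * wedge11 q (\<lambda>j k. A 0 j * cnj (A 0 k)) (spos_form q (\<lambda>k. A (Suc k))) I J"
  proof (cases "card I = Suc q \<and> card J = Suc q")
    case True
    then have c: "card (I - {j}) = q" "card (J - {k}) = q" if "j \<in> I" "k \<in> J" for j k
      using that fin by (auto simp: card_Diff_singleton)
    let ?m = "minor_det q (\<lambda>k. A (Suc k))"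
    have cs: "cnj (sgn_ins k K) = sgn_ins k K" for k :: 'a and K by (simp add: sgn_ins_def)
    have e: "Suc q * (Suc q - 1) div 2 = q + q * (q - 1) div 2"
      by (cases q) (simp_all add: algebra_simps)
    have "spos_form (Suc q) A I J = \<i> ^ Suc q * (-1) ^ (q + q * (q - 1) div 2) *
        ((\<Sum>j\<in>I. sgn_ins j (I - {j}) * (A 0 j * ?m (I - {j})))
        * (\<Sum>k\<in>J. sgn_ins k (J - {k}) * (cnj (A 0 k) * cnj (?m (J - {k})))))"
      using True unfolding spos_form_def minor_det_Suc[OF fin(1) conjunct1[OF True]]
        minor_det_Suc[OF fin(2) conjunct2[OF True]] e by (simp add: cs)
    also have "\<dots> = (\<Sum>j\<in>I. \<Sum>k\<in>J. \<i> ^ Suc q * (-1) ^ (q + q * (q - 1) div 2) *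
        ((sgn_ins j (I - {j}) * (A 0 j * ?m (I - {j}))) * (sgn_ins k (J - {k}) * (cnj (A 0 k) * cnj (?m (J - {k}))))))"
      by (subst sum_product) (simp only: sum_distrib_left)
    also have "\<dots> = \<i> * wedge11 q (\<lambda>j k. A 0 j * cnj (A 0 k)) (spos_form q (\<lambda>k. A (Suc k))) I J"
      using True by (auto simp: wedge11_def sum_distrib_left spos_form_def c power_add mult_ac intro!: sum.cong)
    finally show ?thesis .
  qed (auto simp: wedge11_def spos_form_def)
qed

lemma wedge11_diff_left:
  "wedge11 q (\<lambda>j k. M j k - N j k) \<psi> I J = wedge11 q M \<psi> I J - wedge11 q N \<psi> I J"
  by (simp add: wedge11_def algebra_simps sum_subtractf)

lemma wedge11_diff_right:
  "wedge11 q M (\<lambda>I J. \<psi> I J - \<phi> I J) I J = wedge11 q M \<psi> I J - wedge11 q M \<phi> I J"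
  by (simp add: wedge11_def algebra_simps sum_subtractf)

section \<open>Positive semidefinite Hermitian matrices\<close>

definition herm_form :: "('n::finite \<Rightarrow> 'n \<Rightarrow> complex) \<Rightarrow> ('n \<Rightarrow> complex) \<Rightarrow> complex" where
  "herm_form M x = (\<Sum>j\<in>UNIV. \<Sum>k\<in>UNIV. M j k * (x j * cnj (x k)))"

definition psd :: "('n::finite \<Rightarrow> 'n \<Rightarrow> complex) \<Rightarrow> bool" where
  "psd M \<longleftrightarrow> (\<forall>x. herm_form M x \<in> \<real> \<and> 0 \<le> Re (herm_form M x))"

lemma psdD: "psd M \<Longrightarrow> herm_form M x \<in> \<real>" "psd M \<Longrightarrow> 0 \<le> Re (herm_form M x)"
  by (auto simp: psd_def)

lemma herm_form_add: "herm_form (\<lambda>j k. M j k + N j k) x = herm_form M x + herm_form N x"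
  by (simp add: herm_form_def algebra_simps sum.distrib)

lemma herm_form_cmult: "herm_form (\<lambda>j k. c * M j k) x = c * herm_form M x"
  by (simp add: herm_form_def sum_distrib_left algebra_simps)

lemma herm_form_diff: "herm_form (\<lambda>j k. M j k - N j k) x = herm_form M x - herm_form N x"
  by (simp add: herm_form_def algebra_simps sum_subtractf)

lemma herm_form_outer:
  "herm_form (\<lambda>j k. a j * cnj (b k)) x = (\<Sum>j\<in>UNIV. a j * x j) * cnj (\<Sum>k\<in>UNIV. b k * x k)"
  by (simp add: herm_form_def sum_product mult_ac)

lemma herm_form_rank1: "herm_form (\<lambda>j k. a j * cnj (a k)) x = of_real ((cmod (\<Sum>j\<in>UNIV. a j * x j))\<^sup>2)"
  unfolding herm_form_outer complex_norm_square ..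

definition id_mat :: "'n \<Rightarrow> 'n \<Rightarrow> complex" where "id_mat j k = (if j = k then 1 else 0)"

lemma herm_form_id: "herm_form id_mat x = of_real (\<Sum>j\<in>UNIV. (cmod (x j))\<^sup>2)"
  by (simp add: herm_form_def id_mat_def if_distrib[where f = "\<lambda>c. c * _"] complex_norm_square[symmetric] cong: if_cong)

lemma psd_id: "psd id_mat"
  unfolding psd_def herm_form_id by (auto intro: sum_nonneg)

lemma herm_form_shift:
  fixes M :: "'n::finite \<Rightarrow> 'n \<Rightarrow> complex"
  shows "herm_form M (\<lambda>j. x j + (if j = i then t else 0)) = herm_form M x
     + t * (\<Sum>k\<in>UNIV. M i k * cnj (x k)) + cnj t * (\<Sum>j\<in>UNIV. M j i * x j) + t * cnj t * M i i"
proof -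
  have "herm_form M (\<lambda>j. x j + (if j = i then t else 0)) = (\<Sum>j\<in>UNIV. \<Sum>k\<in>UNIV. M j k * (x j * cnj (x k)))
      + (\<Sum>j\<in>UNIV. \<Sum>k\<in>UNIV. if j = i then t * (M j k * cnj (x k)) else 0)
      + (\<Sum>j\<in>UNIV. \<Sum>k\<in>UNIV. if k = i then cnj t * (M j k * x j) else 0)
      + (\<Sum>j\<in>UNIV. \<Sum>k\<in>UNIV. if j = i then if k = i then t * cnj t * M j k else 0 else 0)"
    unfolding herm_form_def sum.distrib[symmetric]
    by (intro sum.cong refl) (auto simp: algebra_simps)
  also have "(\<Sum>j\<in>UNIV. \<Sum>k\<in>UNIV. if j = i then t * (M j k * cnj (x k)) else 0)
      = t * (\<Sum>k\<in>UNIV. M i k * cnj (x k))"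
    by (subst sum.swap) (simp add: sum_distrib_left)
  also have "(\<Sum>j\<in>UNIV. \<Sum>k\<in>UNIV. if k = i then cnj t * (M j k * x j) else 0)
      = cnj t * (\<Sum>j\<in>UNIV. M j i * x j)"
    by (simp add: sum_distrib_left)
  also have "(\<Sum>j\<in>UNIV. \<Sum>k\<in>UNIV. if j = i then if k = i then t * cnj t * M j k else 0 else 0) = t * cnj t * M i i"
    by (subst sum.swap) simp
  finally show ?thesis by (simp add: herm_form_def)
qed

lemma herm_form_unit: "herm_form M (\<lambda>j. if j = i then t else 0) = t * cnj t * M i i"
  using herm_form_shift[of M "\<lambda>_. 0" i t] by (simp add: herm_form_def)

lemma psd_diag: assumes "psd M" shows "M i i \<in> \<real>" "0 \<le> Re (M i i)"
  using psdD[OF assms, of "\<lambda>j. if j = i then 1 else 0"] by (simp_all add: herm_form_unit)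

text \<open>Polarization: reality of the form at e_k + s e_j makes s M_jk + conj(s) M_kj real.
  Taking s = 1 gives opposite imaginary parts, s = i equal real parts.\<close>

lemma psd_hermitian:
  assumes "psd M" shows "M k j = cnj (M j k)"
proof (cases "j = k")
  case True then show ?thesis using psd_diag(1)[OF assms, of j] Reals_cnj_iff by auto
next
  case False
  have "s * M j k + cnj s * M k j \<in> \<real>" for s
  proof -
    let ?x = "\<lambda>l. (if l = k then 1 else 0) + (if l = j then s else 0)"
    have "herm_form M ?x = M k k + s * M j k + cnj s * M k j + s * cnj s * M j j"
      by (simp add: herm_form_shift herm_form_unit if_distrib[where f = "\<lambda>c. _ * c"] if_distrib[where f = cnj] cong: if_cong)
    moreover have "s * cnj s * M j j \<in> \<real>"
      using psd_diag(1)[OF assms, of j] by (simp add: complex_norm_square[symmetric])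
    ultimately have e: "herm_form M ?x - M k k - s * cnj s * M j j = s * M j k + cnj s * M k j" by simp
    show ?thesis
      using Reals_diff[OF Reals_diff[OF psdD(1)[OF assms, of ?x] psd_diag(1)[OF assms, of k]]
          \<open>s * cnj s * M j j \<in> \<real>\<close>] unfolding e .
  qed
  from this[of 1] this[of "\<i>"] show ?thesis by (simp add: complex_is_Real_iff complex_eq_iff)
qed

text \<open>With \<open>M i i = 0\<close> the form is affine in r along e_k + t e_i, t = - r
  conj(M_ik), with slope - 2 |M_ik|^2. It would become negative for large r if the entry were not
  zero.\<close>

lemma psd_zero_diag:
  assumes "psd M" "M i i = 0" shows "M i k = 0"
proof (rule ccontr)
  assume ne: "M i k \<noteq> 0"
  then have ik: "i \<noteq> k" using assms by auto
  define c where "c = (cmod (M i k))\<^sup>2"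
  have c: "c > 0" using ne by (simp add: c_def)
  have *: "0 \<le> Re (M k k) - 2 * r * c" for r :: real
  proof -
    define t where "t = - of_real r * cnj (M i k)"
    let ?x = "\<lambda>l. (if l = k then 1 else 0) + (if l = i then t else 0)"
    have "herm_form M ?x = M k k + t * M i k + cnj t * cnj (M i k)"
      using assms(2) psd_hermitian[OF assms(1), of k i]
      by (simp add: herm_form_shift herm_form_unit if_distrib[where f = "\<lambda>c. _ * c"] if_distrib[where f = cnj] cong: if_cong)
    also have "\<dots> = M k k - 2 * (of_real r * (M i k * cnj (M i k)))"
      by (simp add: t_def mult_ac)
    also have "\<dots> = M k k - 2 * of_real (r * c)"
      unfolding complex_norm_square[symmetric] by (simp add: c_def)
    finally have "Re (herm_form M ?x) = Re (M k k) - 2 * r * c" by simp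
    then show ?thesis using psdD(2)[OF assms(1), of ?x] by linarith
  qed
  have "2 * ((Re (M k k) + 1) / (2 * c)) * c = Re (M k k) + 1" using c by simp
  with *[of "(Re (M k k) + 1) / (2 * c)"] show False by linarith
qed

text \<open>Cholesky decomposition: one elimination step per index in the support.\<close>

lemma psd_sum_rank1:
  fixes M :: "'n::finite \<Rightarrow> 'n \<Rightarrow> complex"
  assumes "psd M"
  shows "\<exists>as. M = (\<lambda>j k. \<Sum>a\<leftarrow>as. a j * cnj (a k))"
proof -
  have "\<exists>as. M = (\<lambda>j k. \<Sum>a\<leftarrow>as. a j * cnj (a k))"
    if "finite S" "psd M" "\<And>j k. j \<notin> S \<Longrightarrow> M j k = 0" for S and M :: "'n \<Rightarrow> 'n \<Rightarrow> complex"
    using that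
  proof (induction S arbitrary: M rule: finite_induct)
    case empty
    then show ?case by (intro exI[of _ "[]"]) auto
  next
    case (insert i S)
    note herm = psd_hermitian[OF insert.prems(1)]
    show ?case
    proof (cases "M i i = 0")
      case True
      then have "M j k = 0" if "j \<notin> S" for j k
        using psd_zero_diag[OF insert.prems(1)] insert.prems(2)[of j] that by (cases "j = i") auto
      then show ?thesis using insert.IH insert.prems(1) by blast
    next
      case False
      define d where "d = Re (M i i)"
      have Mii: "M i i = of_real d"
        using psd_diag(1)[OF insert.prems(1), of i] by (simp add: d_def)
      have "0 \<le> d" using psd_diag(2)[OF insert.prems(1), of i] by (simp add: d_def)
      moreover have "d \<noteq> 0" using False Mii by auto
      ultimately have d: "d > 0" by simp
      define a where "a j = M j i / of_real (sqrt d)" for j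
      have aa: "a j * cnj (a k) = M j i * M i k / of_real d" for j k
        using herm[of i k] d by (simp add: a_def of_real_mult[symmetric] del: of_real_mult)
      define N where "N j k = M j k - a j * cnj (a k)" for j k
      \<comment> \<open>Schur complement: the value of \<open>N\<close> at \<open>x\<close> is the
        value of \<open>M\<close> at \<open>x\<close> with the \<open>i\<close>-th coordinate
        shifted by \<open>- s / of_real d\<close>, the shift that minimizes the form of
        \<open>M\<close>.\<close>
      have "psd N"
        unfolding psd_def
      proof
        fix x :: "'n \<Rightarrow> complex"
        define s where "s = (\<Sum>j\<in>UNIV. M j i * x j)"
        have cs: "(\<Sum>k\<in>UNIV. M i k * cnj (x k)) = cnj s"
          unfolding s_def cnj_sum complex_cnj_mult by (intro sum.cong refl) (simp only: herm[of i])
        have "herm_form M (\<lambda>j. x j + (if j = i then - s / of_real d else 0)) = herm_form M x - s * cnj s / of_real d"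
          unfolding herm_form_shift cs s_def[symmetric] Mii using d by (simp add: field_simps)
        moreover have "herm_form (\<lambda>j k. a j * cnj (a k)) x = s * cnj s / of_real d"
        proof -
          have "(\<Sum>j\<in>UNIV. a j * x j) = s / of_real (sqrt d)" by (simp add: a_def s_def sum_divide_distrib)
          then show ?thesis
            unfolding herm_form_outer using d by (simp add: of_real_mult[symmetric] del: of_real_mult)
        qed
        ultimately have "herm_form N x = herm_form M (\<lambda>j. x j + (if j = i then - s / of_real d else 0))"
          unfolding N_def herm_form_diff by simp
        then show "herm_form N x \<in> \<real> \<and> 0 \<le> Re (herm_form N x)"
          using psdD[OF insert.prems(1)] by simp
      qed
      moreover have "N j k = 0" if "j \<notin> S" for j k
      proof (cases "j = i")
        case True then show ?thesis using d unfolding N_def aa Mii True by simp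
      next
        case False then show ?thesis using insert.prems(2)[of j] that unfolding N_def aa by simp
      qed
      ultimately obtain as where as: "N = (\<lambda>j k. \<Sum>a\<leftarrow>as. a j * cnj (a k))" using insert.IH by blast
      have "M j k = N j k + a j * cnj (a k)" for j k by (simp add: N_def)
      then have "M = (\<lambda>j k. \<Sum>a\<leftarrow>a # as. a j * cnj (a k))" unfolding as by (intro ext) simp
      then show ?thesis by blast
    qed
  qed
  from this[of UNIV M] assms show ?thesis by simp
qed

section \<open>The convex cone of strongly positive constant forms\<close>

inductive pos_cone :: "nat \<Rightarrow> 'n::{finite,linorder} cform \<Rightarrow> bool" for q where
  zero: "pos_cone q (\<lambda>I J. 0)"
| add: "pos_cone q \<Psi> \<Longrightarrow> 0 \<le> c \<Longrightarrow> pos_cone q (\<lambda>I J. of_real c * spos_form q A I J + \<Psi> I J)"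

lemma pos_cone_spos: "pos_cone q (spos_form q A)"
  using pos_cone.add[OF pos_cone.zero, of 1 q A] by simp

lemma pos_cone_add: "pos_cone q \<Phi> \<Longrightarrow> pos_cone q \<Psi> \<Longrightarrow> pos_cone q (\<lambda>I J. \<Phi> I J + \<Psi> I J)"
proof (induction rule: pos_cone.induct)
  case (add \<Phi> c A)
  from pos_cone.add[OF add.IH[OF add.prems] add.hyps(2), of A] show ?case by (simp add: add.assoc)
qed simp

lemma pos_cone_scale:
  assumes "pos_cone q \<Phi>" "0 \<le> r" shows "pos_cone q (\<lambda>I J. of_real r * \<Phi> I J)"
  using assms(1)
proof (induction rule: pos_cone.induct)
  case zero then show ?case using pos_cone.zero by simp
next
  case (add \<Phi> c A)
  from pos_cone.add[OF add.IH, of "r * c" A] add.hyps assms(2) show ?case by (simp add: algebra_simps)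
qed

lemma pos_cone_wedge11_rank1:
  assumes "pos_cone q \<Phi>" shows "pos_cone (Suc q) (\<lambda>I J. \<i> * wedge11 q (\<lambda>j k. a j * cnj (a k)) \<Phi> I J)"
  using assms
proof (induction rule: pos_cone.induct)
  case zero then show ?case using pos_cone.zero by simp
next
  case (add \<Phi> c A)
  \<comment> \<open>\<open>case_nat a A\<close> puts \<open>a\<close> in front of the linear forms
    in \<open>A\<close>, so the product is again a single strongly positive form.\<close>
  have "spos_form (Suc q) (case_nat a A) = (\<lambda>I J. \<i> * wedge11 q (\<lambda>j k. a j * cnj (a k)) (spos_form q A) I J)"
    by (simp add: spos_form_Suc)
  from pos_cone.add[OF add.IH add.hyps(2), of "case_nat a A", unfolded this] show ?case
    by (simp add: wedge11_add_right wedge11_cmult_right algebra_simps)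
qed

lemma pos_cone_wedge11:
  fixes M :: "'n::{finite,linorder} \<Rightarrow> 'n \<Rightarrow> complex"
  assumes "pos_cone q \<Phi>" "psd M" shows "pos_cone (Suc q) (\<lambda>I J. \<i> * wedge11 q M \<Phi> I J)"
proof -
  obtain as where M: "M = (\<lambda>j k. \<Sum>a\<leftarrow>as. a j * cnj (a k))" using psd_sum_rank1[OF assms(2)] by blast
  show ?thesis unfolding M
  proof (induction as)
    case Nil then show ?case using pos_cone.zero by simp
  next
    case (Cons a as)
    from pos_cone_add[OF pos_cone_wedge11_rank1[OF assms(1), of a] Cons.IH] show ?case
      by (simp add: wedge11_add_left algebra_simps)
  qed
qed

text \<open>\<open>base_form q\<close> is the \<open>q\<close>-th power of the Kaehler form \<open>i (\<Sum>j. dz_j \<and> dzbar_j)\<close>.\<close>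

fun base_form :: "nat \<Rightarrow> 'n::{finite,linorder} cform" where
  "base_form 0 = spos_form 0 (\<lambda>_ _. 0)"
| "base_form (Suc q) = (\<lambda>I J. \<i> * wedge11 q id_mat (base_form q) I J)"

lemma pos_cone_base: "pos_cone q (base_form q)"
  by (induction q) (auto intro: pos_cone_spos pos_cone_wedge11 psd_id simp del: spos_form_def)

text \<open>The order meant is that of the cone: \<open>\<Psi>\<close> lies between 0 and a multiple
  of the \<open>q\<close>-th power of the Kaehler form. This is what allows the mass of a current to
  control its values on \<open>\<Psi>\<close>.\<close>

definition dominated :: "nat \<Rightarrow> 'n::{finite,linorder} cform \<Rightarrow> bool" where
  "dominated q \<Psi> \<longleftrightarrow> pos_cone q \<Psi> \<and> (\<exists>C\<ge>0. pos_cone q (\<lambda>I J. of_real C * base_form q I J - \<Psi> I J))"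

text \<open>This is the Cauchy-Schwarz inequality, read as an inequality between Hermitian
  matrices.\<close>

lemma psd_id_minus_rank1:
  "psd (\<lambda>j k. of_real (\<Sum>l\<in>UNIV. (cmod (a l))\<^sup>2) * id_mat j k - a j * cnj (a k))"
proof -
  have "(cmod (\<Sum>j\<in>UNIV. a j * x j))\<^sup>2 \<le> (\<Sum>l\<in>UNIV. (cmod (a l))\<^sup>2) * (\<Sum>l\<in>UNIV. (cmod (x l))\<^sup>2)" for x :: "'a \<Rightarrow> complex"
  proof -
    have "cmod (\<Sum>j\<in>UNIV. a j * x j) \<le> (\<Sum>j\<in>UNIV. \<bar>cmod (a j)\<bar> * \<bar>cmod (x j)\<bar>)"
      by (rule order_trans[OF norm_sum]) (simp add: norm_mult)
    also have "\<dots> \<le> L2_set (\<lambda>j. cmod (a j)) UNIV * L2_set (\<lambda>j. cmod (x j)) UNIV"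
      by (rule L2_set_mult_ineq)
    finally have "(cmod (\<Sum>j\<in>UNIV. a j * x j))\<^sup>2 \<le> (L2_set (\<lambda>j. cmod (a j)) UNIV * L2_set (\<lambda>j. cmod (x j)) UNIV)\<^sup>2"
      by (intro power_mono) auto
    then show ?thesis by (simp add: power_mult_distrib L2_set_def sum_nonneg)
  qed
  then show ?thesis
    unfolding psd_def herm_form_diff herm_form_cmult herm_form_rank1 herm_form_id
    by (auto simp: of_real_mult[symmetric] of_real_diff[symmetric] simp del: of_real_mult of_real_diff of_real_sum)
qed

text \<open>With \<alpha> the rank-one form of \<open>a\<close>, one has D C \<beta>^(q+1) -
  \<alpha> \<Psi> = D \<beta> (C \<beta>^q - \<Psi>) + (D \<beta> - \<alpha>) \<Psi>. Both products
  lie in the cone when D is the squared norm of \<open>a\<close>.\<close>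

lemma dominated_wedge11:
  assumes "dominated q \<Psi>" shows "dominated (Suc q) (\<lambda>I J. \<i> * wedge11 q (\<lambda>j k. a j * cnj (a k)) \<Psi> I J)"
proof -
  obtain C where C: "0 \<le> C" "pos_cone q (\<lambda>I J. of_real C * base_form q I J - \<Psi> I J)" and \<Psi>: "pos_cone q \<Psi>"
    using assms by (auto simp: dominated_def)
  define D where "D = (\<Sum>l\<in>UNIV. (cmod (a l))\<^sup>2)"
  have D: "0 \<le> D" by (simp add: D_def sum_nonneg)
  have 1: "pos_cone (Suc q) (\<lambda>I J. of_real D * (\<i> * wedge11 q id_mat (\<lambda>I J. of_real C * base_form q I J - \<Psi> I J) I J))"
    by (rule pos_cone_scale[OF pos_cone_wedge11[OF C(2) psd_id] D])
  have 2: "pos_cone (Suc q) (\<lambda>I J. \<i> * wedge11 q (\<lambda>j k. of_real D * id_mat j k - a j * cnj (a k)) \<Psi> I J)"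
    by (rule pos_cone_wedge11[OF \<Psi>]) (unfold D_def, rule psd_id_minus_rank1)
  have "of_real D * (\<i> * wedge11 q id_mat (\<lambda>I J. of_real C * base_form q I J - \<Psi> I J) I J)
      + \<i> * wedge11 q (\<lambda>j k. of_real D * id_mat j k - a j * cnj (a k)) \<Psi> I J
    = of_real (D * C) * base_form (Suc q) I J - \<i> * wedge11 q (\<lambda>j k. a j * cnj (a k)) \<Psi> I J" for I J
    by (simp add: wedge11_diff_left wedge11_diff_right wedge11_cmult_left wedge11_cmult_right)
      (simp add: algebra_simps)
  with pos_cone_add[OF 1 2]
  have "pos_cone (Suc q) (\<lambda>I J. of_real (D * C) * base_form (Suc q) I J - \<i> * wedge11 q (\<lambda>j k. a j * cnj (a k)) \<Psi> I J)"
    by (simp only:)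
  moreover have "0 \<le> D * C" using C D by simp
  ultimately show ?thesis
    unfolding dominated_def using pos_cone_wedge11_rank1[OF \<Psi>] by blast
qed

inductive dom_span :: "nat \<Rightarrow> 'n::{finite,linorder} cform \<Rightarrow> bool" for q where
  zero: "dom_span q (\<lambda>I J. 0)"
| add: "dom_span q \<Phi> \<Longrightarrow> dominated q \<Psi> \<Longrightarrow> dom_span q (\<lambda>I J. c * \<Psi> I J + \<Phi> I J)"

lemma dom_span_add: "dom_span q \<Phi> \<Longrightarrow> dom_span q \<Psi> \<Longrightarrow> dom_span q (\<lambda>I J. \<Phi> I J + \<Psi> I J)"
proof (induction rule: dom_span.induct)
  case (add \<Phi> \<Xi> c)
  from dom_span.add[OF add.IH[OF add.prems] add.hyps(2), of c] show ?case by (simp add: add.assoc)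
qed simp

lemma dom_span_scale:
  "dom_span q \<Phi> \<Longrightarrow> dom_span q (\<lambda>I J. r * \<Phi> I J)"
proof (induction rule: dom_span.induct)
  case zero then show ?case using dom_span.zero by simp
next
  case (add \<Phi> \<Xi> c)
  from dom_span.add[OF add.IH add.hyps(2), of "r * c"] show ?case by (simp add: algebra_simps)
qed

lemma dom_span_wedge11_rank1:
  "dom_span q \<Phi> \<Longrightarrow> dom_span (Suc q) (\<lambda>I J. wedge11 q (\<lambda>j k. a j * cnj (a k)) \<Phi> I J)"
proof (induction rule: dom_span.induct)
  case zero then show ?case using dom_span.zero by simp
next
  case (add \<Phi> \<Xi> c)
  have "- \<i> * c * (\<i> * x) = c * x" for x by (simp add: algebra_simps)
  with dom_span.add[OF add.IH dominated_wedge11[OF add.hyps(2), of a], of "- \<i> * c"] show ?case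
    by (simp only: wedge11_add_right wedge11_cmult_right)
qed

text \<open>Polarization with the fourth roots of unity w: weighting the rank-one matrix of e_j + w
  e_k by w / 4 and summing keeps only the term in which w meets its conjugate, all other powers of w
  adding up to zero.\<close>

lemma elementary_matrix_polarization:
  fixes j k :: 'n
  defines "v \<equiv> \<lambda>w l. (if l = j then 1 else 0) + (if l = k then w else (0::complex))"
  shows "(if a = j \<and> b = k then 1 else 0) = (1/4) * (v 1 a * cnj (v 1 b)) + ((1/4) * \<i> * (v \<i> a * cnj (v \<i> b))
     + ((-1/4) * (v (-1) a * cnj (v (-1) b)) + ((-1/4) * \<i> * (v (-\<i>) a * cnj (v (-\<i>) b)))))"
  unfolding v_def by (auto simp: field_simps)

lemma dom_span_wedge11_elementary:
  assumes "dom_span q \<Phi>"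
  shows "dom_span (Suc q) (\<lambda>I J. wedge11 q (\<lambda>a b. if a = j \<and> b = k then 1 else 0) \<Phi> I J)"
  unfolding elementary_matrix_polarization wedge11_add_left wedge11_cmult_left
  by (intro dom_span_add dom_span_scale dom_span_wedge11_rank1 assms)

text \<open>Polarization allows one pair dz_j, dzbar_k to be split off without leaving the span of
  the dominated forms, and induction on the degree does the rest. The sign produced by the splitting
  squares to 1.\<close>

lemma dom_span_basis:
  fixes I J :: "'n::{finite,linorder} set"
  assumes "card I = q" "card J = q"
  shows "dom_span q (\<lambda>I' J'. if I' = I \<and> J' = J then 1 else 0)"
  using assms
proof (induction q arbitrary: I J)
  case 0
  have b: "(base_form 0 :: 'n cform) = (\<lambda>I' J'. if I' = I \<and> J' = J then 1 else 0)"
    using 0 by (intro ext) (auto simp: spos_form_def minor_det_def)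
  have "dominated 0 (base_form 0 :: 'n cform)"
    unfolding dominated_def using pos_cone_base pos_cone.zero
    by (intro conjI exI[of _ 1]) (simp_all del: base_form.simps)
  from dom_span.add[OF dom_span.zero this, of 1] show ?case unfolding b by simp
next
  case (Suc q)
  then obtain j k where jk: "j \<in> I" "k \<in> J" by (metis card.empty equals0I nat.distinct(1))
  define s where "s = (-1) ^ q * sgn_ins j (I - {j}) * sgn_ins k (J - {k})"
  have s: "s * s = 1" by (simp add: s_def sgn_ins_def power2_eq_square[symmetric] power_mult_distrib power_mult[symmetric])
  let ?e = "\<lambda>I' J'. if I' = I - {j} \<and> J' = J - {k} then 1 else (0::complex)"
  have "dom_span q ?e" using Suc jk by (intro Suc.IH) (auto simp: card_Diff_singleton)
  then have 1: "dom_span (Suc q) (\<lambda>I' J'. s * wedge11 q (\<lambda>a b. if a = j \<and> b = k then 1 else 0) ?e I' J')"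
    by (intro dom_span_scale dom_span_wedge11_elementary)
  have "s * wedge11 q (\<lambda>a b. if a = j \<and> b = k then 1 else 0) ?e I' J' = (if I' = I \<and> J' = J then 1 else 0)" for I' J'
  proof (cases "I' = I \<and> J' = J")
    case True
    have "wedge11 q (\<lambda>a b. if a = j \<and> b = k then 1 else 0) ?e I J
       = (\<Sum>a\<in>I. \<Sum>b\<in>J. if a = j then if b = k then s else 0 else 0)"
      using Suc.prems by (auto simp: wedge11_def s_def intro!: sum.cong)
    also have "\<dots> = (\<Sum>a\<in>I. if a = j then s else 0)"
      using jk by (intro sum.cong) auto
    also have "\<dots> = s" using jk by simp
    finally show ?thesis using True s by simp
  next
    case False
    have "(if a = j \<and> b = k then 1 else 0) * ?e (I' - {a}) (J' - {b}) = 0" if "a \<in> I'" "b \<in> J'" for a b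
      using False that jk by auto
    then have "wedge11 q (\<lambda>a b. if a = j \<and> b = k then 1 else 0) ?e I' J' = 0"
      by (auto simp: wedge11_def intro!: sum.neutral simp del: mult_eq_0_iff)
    then show ?thesis using False by simp
  qed
  with 1 show ?case by simp
qed

section \<open>Positive currents\<close>

definition cc_fun :: "'a::euclidean_space set \<Rightarrow> ('a \<Rightarrow> 'b::real_normed_vector) \<Rightarrow> bool" where
  "cc_fun \<Omega> f \<longleftrightarrow> continuous_on UNIV f \<and> (\<exists>K. compact K \<and> K \<subseteq> \<Omega> \<and> (\<forall>z. z \<notin> K \<longrightarrow> f z = 0))"

lemma cc_fun_zero: "cc_fun \<Omega> (\<lambda>z. 0)"
  unfolding cc_fun_def by (auto intro: exI[of _ "{}"])

lemma cc_fun_mono: "cc_fun \<Omega> f \<Longrightarrow> \<Omega> \<subseteq> \<Omega>' \<Longrightarrow> cc_fun \<Omega>' f"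
  unfolding cc_fun_def by blast

lemma cc_fun_eq_0: "cc_fun \<Omega> f \<Longrightarrow> z \<notin> \<Omega> \<Longrightarrow> f z = 0"
  unfolding cc_fun_def by blast

lemma cc_fun_comp:
  assumes "cc_fun \<Omega> f" "continuous_on UNIV h" "h 0 = 0"
  shows "cc_fun \<Omega> (\<lambda>z. h (f z))"
proof -
  have "continuous_on UNIV (\<lambda>z. h (f z))"
    using assms by (intro continuous_on_compose2[OF assms(2)]) (auto simp: cc_fun_def)
  then show ?thesis using assms unfolding cc_fun_def by metis
qed

lemma cc_fun_add:
  assumes "cc_fun \<Omega> f" "cc_fun \<Omega> g" shows "cc_fun \<Omega> (\<lambda>z. f z + g z)"
proof -
  obtain K K' where "compact K" "K \<subseteq> \<Omega>" "\<And>z. z \<notin> K \<Longrightarrow> f z = 0"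
    "compact K'" "K' \<subseteq> \<Omega>" "\<And>z. z \<notin> K' \<Longrightarrow> g z = 0" using assms unfolding cc_fun_def by metis
  then have "compact (K \<union> K') \<and> K \<union> K' \<subseteq> \<Omega> \<and> (\<forall>z. z \<notin> K \<union> K' \<longrightarrow> f z + g z = 0)" by auto
  moreover have "continuous_on UNIV (\<lambda>z. f z + g z)"
    using assms by (intro continuous_on_add) (auto simp: cc_fun_def)
  ultimately show ?thesis unfolding cc_fun_def by blast
qed

lemma cc_fun_sum: "(\<And>i. i \<in> A \<Longrightarrow> cc_fun \<Omega> (f i)) \<Longrightarrow> cc_fun \<Omega> (\<lambda>z. \<Sum>i\<in>A. f i z)"
  by (induction A rule: infinite_finite_induct) (auto intro: cc_fun_zero cc_fun_add)

text \<open>\<open>h\<close> is uncontrolled outside \<open>\<Omega>\<close>. Continuity on the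
  whole space is glued from \<open>\<Omega>\<close> and the complement of the compact set carrying
  \<open>f\<close>, where the product is zero.\<close>

lemma cc_fun_mult_continuous:
  fixes f h :: "'a::euclidean_space \<Rightarrow> 'b::real_normed_algebra"
  assumes "open \<Omega>" "cc_fun \<Omega> f" "continuous_on \<Omega> h"
  shows "cc_fun \<Omega> (\<lambda>z. f z * h z)"
proof -
  obtain K where K: "compact K" "K \<subseteq> \<Omega>" "\<And>z. z \<notin> K \<Longrightarrow> f z = 0" using assms unfolding cc_fun_def by metis
  have "continuous_on \<Omega> (\<lambda>z. f z * h z)"
    using assms by (intro continuous_on_mult) (auto simp: cc_fun_def intro: continuous_on_subset)
  moreover have "continuous_on (- K) (\<lambda>z. f z * h z)"
    using K by (intro continuous_on_cong[THEN iffD1, OF refl _ continuous_on_const[of _ 0]]) auto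
  ultimately have "continuous_on (\<Omega> \<union> - K) (\<lambda>z. f z * h z)"
    using assms K by (intro continuous_on_open_Un) (auto intro: compact_imp_closed)
  moreover have "\<Omega> \<union> - K = UNIV" using K by auto
  ultimately show ?thesis using K unfolding cc_fun_def by auto
qed

lemma cc_fun_cmult:
  fixes f :: "'a::euclidean_space \<Rightarrow> 'b::real_normed_algebra"
  shows "cc_fun \<Omega> f \<Longrightarrow> cc_fun \<Omega> (\<lambda>z. c * f z)"
  by (rule cc_fun_comp[where h = "\<lambda>x. c * x"]) (auto intro: continuous_intros)

lemma cc_fun_diff:
  fixes f :: "'a::euclidean_space \<Rightarrow> 'b::real_normed_algebra_1"
  assumes "cc_fun \<Omega> f" "cc_fun \<Omega> g" shows "cc_fun \<Omega> (\<lambda>z. f z - g z)"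
  using cc_fun_add[OF assms(1) cc_fun_cmult[OF assms(2), of "-1"]] by simp

lemma cc_fun_of_real: "cc_fun \<Omega> f \<Longrightarrow> cc_fun \<Omega> (\<lambda>z. of_real (f z) :: complex)"
  by (rule cc_fun_comp[where h = of_real]) (auto intro: continuous_intros)

lemma cc_fun_Re: "cc_fun \<Omega> f \<Longrightarrow> cc_fun \<Omega> (\<lambda>z. Re (f z))"
  by (rule cc_fun_comp[where h = Re]) (auto intro: continuous_intros)

lemma cc_fun_Im: "cc_fun \<Omega> f \<Longrightarrow> cc_fun \<Omega> (\<lambda>z. Im (f z))"
  by (rule cc_fun_comp[where h = Im]) (auto intro: continuous_intros)

lemma cc_formI:
  fixes \<phi> :: "'n::finite form"
  assumes "\<And>I J. cc_fun \<Omega> (\<phi> I J)" "\<And>I J z. \<not> (card I = p \<and> card J = p) \<Longrightarrow> \<phi> I J z = 0"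
  shows "cc_form p \<Omega> \<phi>"
proof -
  have "\<forall>I J. \<exists>K. compact K \<and> K \<subseteq> \<Omega> \<and> (\<forall>z. z \<notin> K \<longrightarrow> \<phi> I J z = 0)"
    using assms(1) by (auto simp: cc_fun_def)
  then obtain K where K: "\<And>I J. compact (K I J)" "\<And>I J. K I J \<subseteq> \<Omega>" "\<And>I J z. z \<notin> K I J \<Longrightarrow> \<phi> I J z = 0"
    by metis
  have "compact (\<Union>I. \<Union>J. K I J)" using K(1) by (intro compact_UN) auto
  moreover have "(\<Union>I. \<Union>J. K I J) \<subseteq> \<Omega>" using K(2) by blast
  moreover have "\<forall>I J z. z \<notin> (\<Union>I. \<Union>J. K I J) \<longrightarrow> \<phi> I J z = 0" using K(3) by blast
  ultimately have "\<exists>K. compact K \<and> K \<subseteq> \<Omega> \<and> (\<forall>I J z. z \<notin> K \<longrightarrow> \<phi> I J z = 0)"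
    by (intro exI[of _ "\<Union>I. \<Union>J. K I J"] conjI)
  moreover have "\<forall>I J. \<not> (card I = p \<and> card J = p) \<longrightarrow> \<phi> I J = (\<lambda>_. 0)"
    using assms(2) by (intro allI impI ext)
  moreover have "\<forall>I J. continuous_on UNIV (\<phi> I J)" using assms(1) by (simp add: cc_fun_def)
  ultimately show ?thesis unfolding cc_form_def form_support_ok_def by (intro conjI)
qed

lemma cc_formD: "cc_form p \<Omega> \<phi> \<Longrightarrow> cc_fun \<Omega> (\<phi> I J)"
  "cc_form p \<Omega> \<phi> \<Longrightarrow> \<not> (card I = p \<and> card J = p) \<Longrightarrow> \<phi> I J z = 0"
  unfolding cc_form_def form_support_ok_def cc_fun_def by metis+

lemma pos_cone_degree: "pos_cone q \<Psi> \<Longrightarrow> \<not> (card I = q \<and> card J = q) \<Longrightarrow> \<Psi> I J = 0"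
  by (induction rule: pos_cone.induct) (auto simp: spos_form_def)

locale positive_current_on =
  fixes p :: nat and \<Omega> :: "(complex^('n::{finite,linorder})) set" and T :: "'n form \<Rightarrow> complex"
  assumes open_domain: "open \<Omega>" and positive: "positive_current p \<Omega> T"
begin

lemma T_linear: "cc_form p \<Omega> \<phi> \<Longrightarrow> cc_form p \<Omega> \<psi> \<Longrightarrow>
    T (\<lambda>I J z. a * \<phi> I J z + b * \<psi> I J z) = a * T \<phi> + b * T \<psi>"
  using positive unfolding positive_current_def order0_current_def by blast

lemma T_add: "cc_form p \<Omega> \<phi> \<Longrightarrow> cc_form p \<Omega> \<psi> \<Longrightarrow> T (\<lambda>I J z. \<phi> I J z + \<psi> I J z) = T \<phi> + T \<psi>"
  using T_linear[of \<phi> \<psi> 1 1] by simp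

lemma T_diff: "cc_form p \<Omega> \<phi> \<Longrightarrow> cc_form p \<Omega> \<psi> \<Longrightarrow> T (\<lambda>I J z. \<phi> I J z - \<psi> I J z) = T \<phi> - T \<psi>"
  using T_linear[of \<phi> \<psi> 1 "-1"] by simp

lemma T_cmult: "cc_form p \<Omega> \<phi> \<Longrightarrow> T (\<lambda>I J z. c * \<phi> I J z) = c * T \<phi>"
  using T_linear[of \<phi> \<phi> c 0] by simp

lemma cc_form_zero: "cc_form p \<Omega> (\<lambda>I J z. 0)"
  by (rule cc_formI) (auto intro: cc_fun_zero)

lemma T_zero: "T (\<lambda>I J z. 0) = 0"
  using T_cmult[OF cc_form_zero, of 0] by simp

lemma T_sum:
  "(\<And>i. i \<in> A \<Longrightarrow> cc_form p \<Omega> (\<phi> i)) \<Longrightarrow> T (\<lambda>I J z. \<Sum>i\<in>A. \<phi> i I J z) = (\<Sum>i\<in>A. T (\<phi> i))"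
proof (induction A rule: infinite_finite_induct)
  case (insert i A)
  have "cc_form p \<Omega> (\<lambda>I J z. \<Sum>i\<in>A. \<phi> i I J z)"
    using insert.prems by (intro cc_formI cc_fun_sum sum.neutral) (auto intro: cc_formD)
  then show ?case using insert by (simp add: T_add)
qed (auto simp: T_zero)

lemma cc_form_fun_mult:
  assumes "cc_fun \<Omega> h" "\<And>I J. \<not> (card I = p \<and> card J = p) \<Longrightarrow> \<Psi> I J = 0"
  shows "cc_form p \<Omega> (\<lambda>I J z. h z * \<Psi> I J)"
proof (rule cc_formI)
  show "cc_fun \<Omega> (\<lambda>z. h z * \<Psi> I J)" for I J
    using cc_fun_cmult[OF assms(1), of "\<Psi> I J"] by (simp only: mult.commute)
qed (use assms(2) in auto)

lemma cc_form_cone: "cc_fun \<Omega> h \<Longrightarrow> pos_cone p \<Psi> \<Longrightarrow> cc_form p \<Omega> (\<lambda>I J z. h z * \<Psi> I J)"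
  by (rule cc_form_fun_mult) (auto dest: pos_cone_degree)

lemma T_pos_cone:
  assumes "pos_cone p \<Psi>" "cc_fun \<Omega> f" "\<And>z. 0 \<le> f z"
  shows "T (\<lambda>I J z. of_real (f z) * \<Psi> I J) \<in> \<real> \<and> 0 \<le> Re (T (\<lambda>I J z. of_real (f z) * \<Psi> I J))"
  using assms(1)
proof (induction rule: pos_cone.induct)
  case zero then show ?case by (simp add: T_zero)
next
  case (add \<Psi> c A)
  have cc: "cc_form p \<Omega> (\<lambda>I J z. of_real (f z) * \<Psi> I J)" "cc_form p \<Omega> (\<lambda>I J z. of_real (f z) * spos_form p A I J)"
    by (rule cc_form_cone[OF cc_fun_of_real[OF assms(2)] add.hyps(1)])
      (rule cc_form_cone[OF cc_fun_of_real[OF assms(2)] pos_cone_spos])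
  have "T (\<lambda>I J z. of_real (f z) * (of_real c * spos_form p A I J + \<Psi> I J))
      = of_real c * T (\<lambda>I J z. of_real (f z) * spos_form p A I J) + T (\<lambda>I J z. of_real (f z) * \<Psi> I J)"
    using T_linear[OF cc(2,1), of "of_real c" 1] by (simp add: algebra_simps)
  moreover have "T (\<lambda>I J z. of_real (f z) * spos_form p A I J) \<in> \<real> \<and> 0 \<le> Re (T (\<lambda>I J z. of_real (f z) * spos_form p A I J))"
    using positive assms(2,3) unfolding positive_current_def cc_fun_def by blast
  ultimately show ?case using add by simp
qed

text \<open>The integral of \<open>w\<close> against the trace measure of \<open>T\<close>, up to
  normalization.\<close>

definition mass :: "(complex^('n::{finite,linorder}) \<Rightarrow> real) \<Rightarrow> real" where
  "mass w = Re (T (\<lambda>I J z. of_real (w z) * base_form p I J))"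

lemma mass_nonneg: "cc_fun \<Omega> w \<Longrightarrow> (\<And>z. 0 \<le> w z) \<Longrightarrow> 0 \<le> mass w"
  unfolding mass_def using T_pos_cone[OF pos_cone_base] by blast

lemma mass_cmult:
  assumes "cc_fun \<Omega> w" shows "mass (\<lambda>z. c * w z) = c * mass w"
proof -
  have "cc_form p \<Omega> (\<lambda>I J z. of_real (w z) * base_form p I J)"
    by (rule cc_form_cone[OF cc_fun_of_real[OF assms] pos_cone_base])
  from T_cmult[OF this, of "of_real c"] show ?thesis by (simp add: mass_def mult.assoc)
qed

text \<open>For real \<open>h\<close> both \<open>w - h\<close> and \<open>w + h\<close> are
  nonnegative, so the value on \<open>h\<close> lies between plus and minus the value on
  \<open>w\<close>, which domination bounds by \<open>C * mass w\<close>. Real and imaginary parts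
  cost a factor 2. The constant depends on \<open>\<Psi>\<close> only.\<close>

lemma T_dominated:
  assumes "dominated p \<Psi>"
  shows "\<exists>C\<ge>0. \<forall>h w. cc_fun \<Omega> h \<longrightarrow> cc_fun \<Omega> w \<longrightarrow> (\<forall>z. cmod (h z) \<le> w z) \<longrightarrow>
    cmod (T (\<lambda>I J z. h z * \<Psi> I J)) \<le> C * mass w"
proof -
  obtain C where C: "0 \<le> C" "pos_cone p (\<lambda>I J. of_real C * base_form p I J - \<Psi> I J)" and \<Psi>: "pos_cone p \<Psi>"
    using assms by (auto simp: dominated_def)
  note cc = cc_form_cone[OF _ \<Psi>]
  have real: "cmod (T (\<lambda>I J z. of_real (h z) * \<Psi> I J)) \<le> C * mass w"
    if h: "cc_fun \<Omega> h" and w: "cc_fun \<Omega> w" and hw: "\<And>z. \<bar>h z\<bar> \<le> w z" for h w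
  proof -
    have w0: "0 \<le> w z" for z using hw[of z] by linarith
    let ?Th = "T (\<lambda>I J z. of_real (h z) * \<Psi> I J)" and ?Tw = "T (\<lambda>I J z. of_real (w z) * \<Psi> I J)"
    have "T (\<lambda>I J z. of_real (w z - h z) * \<Psi> I J) = ?Tw - ?Th"
      using T_diff[OF cc[OF cc_fun_of_real[OF w]] cc[OF cc_fun_of_real[OF h]]] by (simp add: algebra_simps)
    then have m: "?Tw - ?Th \<in> \<real>" "0 \<le> Re (?Tw - ?Th)"
      using T_pos_cone[OF \<Psi> cc_fun_diff[OF w h]] hw by (auto simp: abs_le_iff)
    have "T (\<lambda>I J z. of_real (w z + h z) * \<Psi> I J) = ?Tw + ?Th"
      using T_add[OF cc[OF cc_fun_of_real[OF w]] cc[OF cc_fun_of_real[OF h]]] by (simp add: algebra_simps)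
    then have a: "0 \<le> Re (?Tw + ?Th)"
      using T_pos_cone[OF \<Psi> cc_fun_add[OF w h]] hw by (metis abs_le_D2 neg_le_iff_le add.commute diff_ge_0_iff_ge diff_minus_eq_add)
    have "?Tw \<in> \<real>" using T_pos_cone[OF \<Psi> w w0] by simp
    from Reals_diff[OF this m(1)] have "?Th \<in> \<real>" by simp
    then have "cmod ?Th = \<bar>Re ?Th\<bar>" by (rule in_Reals_norm)
    also have "\<dots> \<le> Re ?Tw" using m(2) a by auto
    also have "\<dots> \<le> C * mass w"
    proof -
      have "T (\<lambda>I J z. of_real (w z) * (of_real C * base_form p I J - \<Psi> I J))
         = of_real C * T (\<lambda>I J z. of_real (w z) * base_form p I J) - ?Tw"
        using T_linear[OF cc_form_cone[OF cc_fun_of_real[OF w] pos_cone_base]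
            cc[OF cc_fun_of_real[OF w]], of "of_real C" "-1"] by (simp add: algebra_simps)
      then show ?thesis using T_pos_cone[OF C(2) w w0] by (simp add: mass_def)
    qed
    finally show ?thesis .
  qed
  have "cmod (T (\<lambda>I J z. h z * \<Psi> I J)) \<le> 2 * C * mass w"
    if h: "cc_fun \<Omega> h" and w: "cc_fun \<Omega> w" and hw: "\<And>z. cmod (h z) \<le> w z" for h w
  proof -
    have e: "h z * x = 1 * (of_real (Re (h z)) * x) + \<i> * (of_real (Im (h z)) * x)" for z x
      using arg_cong[OF complex_eq[of "h z"], of "\<lambda>c. c * x"] by (simp add: algebra_simps)
    have "T (\<lambda>I J z. h z * \<Psi> I J) = T (\<lambda>I J z. 1 * (of_real (Re (h z)) * \<Psi> I J) + \<i> * (of_real (Im (h z)) * \<Psi> I J))"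
      by (simp only: e)
    also have "\<dots> = T (\<lambda>I J z. of_real (Re (h z)) * \<Psi> I J) + \<i> * T (\<lambda>I J z. of_real (Im (h z)) * \<Psi> I J)"
      using T_linear[OF cc[OF cc_fun_of_real[OF cc_fun_Re[OF h]]] cc[OF cc_fun_of_real[OF cc_fun_Im[OF h]]], of 1 \<i>] by simp
    also have "cmod \<dots> \<le> cmod (T (\<lambda>I J z. of_real (Re (h z)) * \<Psi> I J)) + cmod (T (\<lambda>I J z. of_real (Im (h z)) * \<Psi> I J))"
      by (rule norm_triangle_le) (simp add: norm_mult)
    also have "\<dots> \<le> C * mass w + C * mass w"
      using hw by (intro add_mono real cc_fun_Re cc_fun_Im h w) (meson abs_Re_le_cmod abs_Im_le_cmod order_trans)+
    finally show ?thesis by simp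
  qed
  then show ?thesis using C(1) by (intro exI[of _ "2 * C"]) auto
qed

lemma T_dom_span:
  assumes "dom_span p \<Psi>"
  shows "\<exists>C\<ge>0. \<forall>h w. cc_fun \<Omega> h \<longrightarrow> cc_fun \<Omega> w \<longrightarrow> (\<forall>z. cmod (h z) \<le> w z) \<longrightarrow>
    cmod (T (\<lambda>I J z. h z * \<Psi> I J)) \<le> C * mass w"
    and "\<And>I J. \<not> (card I = p \<and> card J = p) \<Longrightarrow> \<Psi> I J = 0"
  using assms
proof (induction rule: dom_span.induct)
  case zero
  { case 1 then show ?case by (intro exI[of _ 0]) (simp add: T_zero) }
  { case 2 then show ?case by simp }
next
  case (add \<Phi> \<Psi> c)
  have deg: "\<Psi> I J = 0" if "\<not> (card I = p \<and> card J = p)" for I J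
    using pos_cone_degree[OF _ that] add.hyps(2) by (auto simp: dominated_def)
  { case 1
    obtain C where C: "C \<ge> 0" "\<And>h w. cc_fun \<Omega> h \<Longrightarrow> cc_fun \<Omega> w \<Longrightarrow> (\<And>z. cmod (h z) \<le> w z) \<Longrightarrow>
      cmod (T (\<lambda>I J z. h z * \<Phi> I J)) \<le> C * mass w" using add.IH(1) by metis
    obtain D where D: "D \<ge> 0" "\<And>h w. cc_fun \<Omega> h \<Longrightarrow> cc_fun \<Omega> w \<Longrightarrow> (\<And>z. cmod (h z) \<le> w z) \<Longrightarrow>
      cmod (T (\<lambda>I J z. h z * \<Psi> I J)) \<le> D * mass w" using T_dominated[OF add.hyps(2)] by metis
    have "cmod (T (\<lambda>I J z. h z * (c * \<Psi> I J + \<Phi> I J))) \<le> (cmod c * D + C) * mass w"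
      if h: "cc_fun \<Omega> h" and w: "cc_fun \<Omega> w" and hw: "\<And>z. cmod (h z) \<le> w z" for h w
    proof -
      have ccs: "cc_form p \<Omega> (\<lambda>I J z. h z * \<Psi> I J)" "cc_form p \<Omega> (\<lambda>I J z. h z * \<Phi> I J)"
        using deg add.IH(2) by (auto intro!: cc_form_fun_mult h)
      have "T (\<lambda>I J z. h z * (c * \<Psi> I J + \<Phi> I J)) = c * T (\<lambda>I J z. h z * \<Psi> I J) + T (\<lambda>I J z. h z * \<Phi> I J)"
        using T_linear[OF ccs, of c 1]
        by (simp add: algebra_simps)
      also have "cmod \<dots> \<le> cmod c * (D * mass w) + C * mass w"
        using C(2)[OF h w hw] D(2)[OF h w hw] by (intro norm_triangle_le add_mono) (auto simp: norm_mult mult_left_mono)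
      finally show ?thesis by (simp add: algebra_simps)
    qed
    then show ?case using C(1) D(1) by (intro exI[of _ "cmod c * D + C"]) auto }
  { case 2 then show ?case using add.IH(2) deg by simp }
qed

text \<open>A positive current has order zero: every coefficient form of bidegree (p,p) is a
  combination of dominated ones. The constant does not depend on the support of the test form; only
  \<open>mass w\<close> does.\<close>

lemma T_bound:
  "\<exists>C\<ge>0. \<forall>\<phi> w. cc_form p \<Omega> \<phi> \<longrightarrow> cc_fun \<Omega> w \<longrightarrow> (\<forall>I J z. cmod (\<phi> I J z) \<le> w z) \<longrightarrow>
    cmod (T \<phi>) \<le> C * mass w"
proof -
  define S where "S = {(I :: 'n set, J :: 'n set). card I = p \<and> card J = p}"
  define e where "e K = (\<lambda>I' J'. if I' = fst K \<and> J' = snd K then 1 else (0::complex))" for K :: "'n set \<times> 'n set"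
  have fin: "finite S" by simp
  have span: "dom_span p (e K)" if "K \<in> S" for K
    using that dom_span_basis[of "fst K" p "snd K"] unfolding S_def e_def by auto
  have "\<forall>K\<in>S. \<exists>C\<ge>0. \<forall>h w. cc_fun \<Omega> h \<longrightarrow> cc_fun \<Omega> w \<longrightarrow> (\<forall>z. cmod (h z) \<le> w z) \<longrightarrow>
    cmod (T (\<lambda>I J z. h z * e K I J)) \<le> C * mass w"
    using T_dom_span(1)[OF span] by blast
  then obtain C where C: "\<And>K. K \<in> S \<Longrightarrow> 0 \<le> C K" "\<And>K h w. K \<in> S \<Longrightarrow> cc_fun \<Omega> h \<Longrightarrow> cc_fun \<Omega> w \<Longrightarrow>
    (\<And>z. cmod (h z) \<le> w z) \<Longrightarrow> cmod (T (\<lambda>I J z. h z * e K I J)) \<le> C K * mass w" by metis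
  have "cmod (T \<phi>) \<le> (\<Sum>K\<in>S. C K) * mass w"
    if \<phi>: "cc_form p \<Omega> \<phi>" and w: "cc_fun \<Omega> w" and \<phi>w: "\<And>I J z. cmod (\<phi> I J z) \<le> w z" for \<phi> w
  proof -
    have expand: "\<phi> I J z = (\<Sum>K\<in>S. \<phi> (fst K) (snd K) z * e K I J)" for I J z
    proof -
      have "(\<Sum>K\<in>S. \<phi> (fst K) (snd K) z * e K I J) = (\<Sum>K\<in>S. if K = (I, J) then \<phi> I J z else 0)"
        by (intro sum.cong) (auto simp: e_def prod_eq_iff)
      also have "\<dots> = (if (I, J) \<in> S then \<phi> I J z else 0)" using fin by simp
      also have "\<dots> = \<phi> I J z" using cc_formD(2)[OF \<phi>, of I J z] by (auto simp: S_def)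
      finally show ?thesis by simp
    qed
    have "T \<phi> = T (\<lambda>I J z. \<Sum>K\<in>S. \<phi> (fst K) (snd K) z * e K I J)"
      by (rule arg_cong[of _ _ T], intro ext, rule expand)
    also have "\<dots> = (\<Sum>K\<in>S. T (\<lambda>I J z. \<phi> (fst K) (snd K) z * e K I J))"
      by (intro T_sum cc_form_fun_mult cc_formD(1)[OF \<phi>]) (auto simp: e_def S_def)
    also have "cmod \<dots> \<le> (\<Sum>K\<in>S. C K * mass w)"
      by (intro order_trans[OF norm_sum] sum_mono C(2) cc_formD(1)[OF \<phi>] w \<phi>w)
    finally show ?thesis by (simp add: sum_distrib_right)
  qed
  then show ?thesis using C(1) by (intro exI[of _ "\<Sum>K\<in>S. C K"]) (auto intro: sum_nonneg)
qed

text \<open>A form with values in the cone is uniformly approximated, via a partition of unity,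
  by finite sums of functions times constant forms of the cone.\<close>

lemma T_pos:
  assumes \<Phi>: "cc_form p \<Omega> \<Phi>" and pos: "\<And>z. pos_cone p (\<lambda>I J. \<Phi> I J z)"
  shows "T \<Phi> \<in> \<real> \<and> 0 \<le> Re (T \<Phi>)"
proof -
  obtain K where K: "compact K" "K \<subseteq> \<Omega>" "\<And>I J z. z \<notin> K \<Longrightarrow> \<Phi> I J z = 0"
    using \<Phi> unfolding cc_form_def form_support_ok_def by metis
  obtain \<eta> :: "complex^('n::{finite,linorder}) \<Rightarrow> real" and V L where \<eta>: "smooth_on UNIV \<eta>" "\<And>x. 0 \<le> \<eta> x"
    "\<And>x. \<eta> x \<le> 1" "open V" "K \<subseteq> V" "\<And>x. x \<in> V \<Longrightarrow> \<eta> x = 1"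
    "compact L" "L \<subseteq> \<Omega>" "V \<subseteq> L" "\<And>x. x \<notin> L \<Longrightarrow> \<eta> x = 0"
    by (rule smooth_cutoff[OF K(1) open_domain K(2)]) (rule that)
  have cc\<eta>: "cc_fun U \<eta>" if "L \<subseteq> U" for U
    using \<eta> that smooth_on_imp_continuous_on[OF \<eta>(1)] unfolding cc_fun_def by blast
  obtain C where C: "0 \<le> C" "\<And>\<phi> w. cc_form p \<Omega> \<phi> \<Longrightarrow> cc_fun \<Omega> w \<Longrightarrow> (\<And>I J z. cmod (\<phi> I J z) \<le> w z) \<Longrightarrow>
    cmod (T \<phi>) \<le> C * mass w" using T_bound by metis
  have approx: "\<exists>t. t \<in> \<real> \<and> 0 \<le> Re t \<and> cmod (T \<Phi> - t) \<le> \<epsilon> * (C * mass \<eta>)" if \<epsilon>: "\<epsilon> > 0" for \<epsilon>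
  proof -
    have "\<exists>r>0. \<forall>z\<in>ball a r. \<forall>I J. cmod (\<Phi> I J z - \<Phi> I J a) < \<epsilon>" for a
    proof -
      have O: "open (\<Inter>I\<in>UNIV. \<Inter>J\<in>UNIV. {z. cmod (\<Phi> I J z - \<Phi> I J a) < \<epsilon>})"
        using \<Phi> unfolding cc_form_def
        by (intro open_INT ballI finite open_Collect_less continuous_intros) auto
      have "a \<in> (\<Inter>I\<in>UNIV. \<Inter>J\<in>UNIV. {z. cmod (\<Phi> I J z - \<Phi> I J a) < \<epsilon>})" using \<epsilon> by simp
      from openE[OF O this] obtain r where "r > 0"
        "ball a r \<subseteq> (\<Inter>I\<in>UNIV. \<Inter>J\<in>UNIV. {z. cmod (\<Phi> I J z - \<Phi> I J a) < \<epsilon>})" .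
      then show ?thesis by blast
    qed
    then have "\<forall>a. \<exists>r>0. \<forall>z\<in>ball a r. \<forall>I J. cmod (\<Phi> I J z - \<Phi> I J a) < \<epsilon>" by blast
    from choice[OF this] obtain r where "\<forall>a. r a > 0 \<and> (\<forall>z\<in>ball a (r a). \<forall>I J. cmod (\<Phi> I J z - \<Phi> I J a) < \<epsilon>)" ..
    then have r: "\<And>a. r a > 0" "\<And>a z I J. z \<in> ball a (r a) \<Longrightarrow> cmod (\<Phi> I J z - \<Phi> I J a) < \<epsilon>" by blast+
    have cov: "L \<subseteq> (\<Union>a\<in>L. ball a (r a))" using r(1) by fastforce
    obtain A where A: "A \<subseteq> L" "finite A" "L \<subseteq> (\<Union>a\<in>A. ball a (r a))"
      by (rule compactE_image[OF \<eta>(7) _ cov]) auto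
    define \<rho> where "\<rho> a z = max 0 (r a - dist a z)" for a z
    define s where "s z = (\<Sum>a\<in>A. \<rho> a z)" for z
    have \<rho>0: "0 \<le> \<rho> a z" for a z by (simp add: \<rho>_def)
    have \<rho>cont: "continuous_on UNIV (\<rho> a)" for a unfolding \<rho>_def by (intro continuous_intros)
    have scont: "continuous_on UNIV s" unfolding s_def by (intro continuous_on_sum \<rho>cont)
    have spos: "0 < s z" if z: "z \<in> L" for z
    proof -
      obtain a where a: "a \<in> A" "z \<in> ball a (r a)" using A(3) z by blast
      then show ?thesis unfolding s_def
        by (intro sum_pos2[OF A(2) a(1)]) (auto simp: \<rho>_def)
    qed
    \<comment> \<open>A partition of \<open>\<eta>\<close> rather than of 1. Outside
      \<open>L\<close>, where \<open>s z\<close> may be 0 and the quotient takes a default value,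
      the factor \<open>\<eta> z\<close> vanishes.\<close>
    define f where "f a z = \<eta> z * (\<rho> a z / s z)" for a z
    have ccf: "cc_fun \<Omega> (f a)" for a
    proof -
      let ?U = "\<Omega> \<inter> {z. 0 < s z}"
      have "open ?U" using open_domain scont by (intro open_Int open_Collect_less) auto
      moreover have "continuous_on ?U (\<lambda>z. \<rho> a z / s z)"
        by (intro continuous_on_divide continuous_on_subset[OF \<rho>cont] continuous_on_subset[OF scont]) auto
      ultimately have "cc_fun ?U (f a)"
        unfolding f_def using \<eta>(8) spos by (intro cc_fun_mult_continuous cc\<eta>) auto
      then show ?thesis by (rule cc_fun_mono) auto
    qed
    have f0: "0 \<le> f a z" for a z
      unfolding f_def s_def using \<eta>(2) \<rho>0 by (intro mult_nonneg_nonneg divide_nonneg_nonneg sum_nonneg) auto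
    have fsum: "(\<Sum>a\<in>A. f a z) = \<eta> z" for z
    proof (cases "z \<in> L")
      case True
      then show ?thesis using spos[OF True]
        by (simp add: f_def sum_distrib_left[symmetric] sum_divide_distrib[symmetric] s_def[symmetric])
    qed (simp add: f_def \<eta>(10))
    define \<Psi> where "\<Psi> a I J z = of_real (f a z) * \<Phi> I J a" for a I J z
    have cc\<Psi>: "cc_form p \<Omega> (\<Psi> a)" for a
      unfolding \<Psi>_def by (rule cc_form_cone[OF cc_fun_of_real[OF ccf] pos])
    have T\<Psi>: "T (\<Psi> a) \<in> \<real> \<and> 0 \<le> Re (T (\<Psi> a))" for a
      unfolding \<Psi>_def by (rule T_pos_cone[OF pos ccf f0])
    have ccs: "cc_form p \<Omega> (\<lambda>I J z. \<Sum>a\<in>A. \<Psi> a I J z)"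
      by (intro cc_formI cc_fun_sum sum.neutral) (auto intro: cc_formD[OF cc\<Psi>])
    have diff: "cmod (\<Phi> I J z - (\<Sum>a\<in>A. \<Psi> a I J z)) \<le> \<epsilon> * \<eta> z" for I J z
    proof -
      have "\<Phi> I J z = of_real (\<eta> z) * \<Phi> I J z" using \<eta>(5) \<eta>(6)[of z] K(3)[of z I J] by (cases "z \<in> K") auto
      also have "\<dots> - (\<Sum>a\<in>A. \<Psi> a I J z) = (\<Sum>a\<in>A. of_real (f a z) * (\<Phi> I J z - \<Phi> I J a))"
        unfolding fsum[symmetric]
        by (simp only: \<Psi>_def of_real_sum sum_distrib_right right_diff_distrib sum_subtractf)
      finally have "cmod (\<Phi> I J z - (\<Sum>a\<in>A. \<Psi> a I J z)) = cmod (\<Sum>a\<in>A. of_real (f a z) * (\<Phi> I J z - \<Phi> I J a))" by simp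
      also have "\<dots> \<le> (\<Sum>a\<in>A. f a z * \<epsilon>)"
      proof (rule order_trans[OF norm_sum sum_mono])
        fix a
        have "cmod (\<Phi> I J z - \<Phi> I J a) \<le> \<epsilon>" if "f a z \<noteq> 0"
        proof -
          have "z \<in> ball a (r a)" using that by (auto simp: f_def \<rho>_def max_def split: if_splits)
          from r(2)[OF this] show ?thesis by (simp add: less_imp_le)
        qed
        then show "cmod (of_real (f a z) * (\<Phi> I J z - \<Phi> I J a)) \<le> f a z * \<epsilon>"
          using f0[of a z] by (cases "f a z = 0") (auto simp: norm_mult intro: mult_left_mono)
      qed
      also have "\<dots> = \<epsilon> * \<eta> z" unfolding fsum[symmetric] by (simp add: sum_distrib_left mult.commute)
      finally show ?thesis .
    qed
    have "T \<Phi> - (\<Sum>a\<in>A. T (\<Psi> a)) = T (\<lambda>I J z. \<Phi> I J z - (\<Sum>a\<in>A. \<Psi> a I J z))"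
      using T_diff[OF \<Phi> ccs] T_sum[of A \<Psi>] cc\<Psi> by simp
    also have "cmod \<dots> \<le> C * mass (\<lambda>z. \<epsilon> * \<eta> z)"
    proof (rule C(2))
      show "cc_form p \<Omega> (\<lambda>I J z. \<Phi> I J z - (\<Sum>a\<in>A. \<Psi> a I J z))"
        using cc_formD[OF \<Phi>] cc_formD[OF ccs] by (intro cc_formI cc_fun_diff) auto
    qed (auto intro: cc_fun_cmult cc\<eta>[OF \<eta>(8)] diff)
    also have "\<dots> = \<epsilon> * (C * mass \<eta>)" by (simp add: mass_cmult[OF cc\<eta>[OF \<eta>(8)]])
    finally have "cmod (T \<Phi> - (\<Sum>a\<in>A. T (\<Psi> a))) \<le> \<epsilon> * (C * mass \<eta>)" .
    moreover have "(\<Sum>a\<in>A. T (\<Psi> a)) \<in> \<real>" "0 \<le> Re (\<Sum>a\<in>A. T (\<Psi> a))"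
      using T\<Psi> by (auto intro: sum_in_Reals sum_nonneg)
    ultimately show ?thesis by blast
  qed
  have B: "0 \<le> C * mass \<eta>" using C(1) mass_nonneg[OF cc\<eta>[OF \<eta>(8)] \<eta>(2)] by simp
  have close: "\<exists>t. t \<in> \<real> \<and> 0 \<le> Re t \<and> cmod (T \<Phi> - t) \<le> e" if "e > 0" for e
  proof -
    have "e / (C * mass \<eta> + 1) * (C * mass \<eta>) \<le> e"
      using B that by (simp add: field_simps)
    moreover have "e / (C * mass \<eta> + 1) > 0" using B that by simp
    ultimately show ?thesis using approx[of "e / (C * mass \<eta> + 1)"] by (blast intro: order_trans)
  qed
  have "\<bar>Im (T \<Phi>)\<bar> \<le> 0 + e \<and> - Re (T \<Phi>) \<le> 0 + e" if e: "e > 0" for e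
  proof -
    obtain t where t: "t \<in> \<real>" "0 \<le> Re t" "cmod (T \<Phi> - t) \<le> e" using close[OF e] by blast
    have "Im t = 0" using t(1) by (simp add: complex_is_Real_iff)
    then show ?thesis
      using abs_Im_le_cmod[of "T \<Phi> - t"] abs_Re_le_cmod[of "T \<Phi> - t"] t by auto
  qed
  then have "\<bar>Im (T \<Phi>)\<bar> \<le> 0" "- Re (T \<Phi>) \<le> 0" by (blast intro: field_le_epsilon)+
  then show ?thesis by (simp add: complex_is_Real_iff)
qed

end

section \<open>Wirtinger calculus\<close>

lemma smooth_on_mult_cutoff:
  fixes f h :: "'a::euclidean_space \<Rightarrow> 'b::real_normed_algebra"
  assumes "smooth_on UNIV f" "compact L" "L \<subseteq> S" "open S" "\<And>z. z \<notin> L \<Longrightarrow> f z = 0" "smooth_on S h"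
  shows "smooth_on UNIV (\<lambda>z. f z * h z)"
proof -
  have "smooth_on S (\<lambda>z. f z * h z)"
    using assms by (intro smooth_on_mult) (auto intro: smooth_on_subset)
  moreover have "smooth_on (- L) (\<lambda>z. f z * h z)"
    using assms by (intro smooth_on_cong[OF _ smooth_on_const[of _ 0]]) (auto simp: open_Compl compact_imp_closed)
  ultimately have "smooth_on (S \<union> - L) (\<lambda>z. f z * h z)" by (rule smooth_on_Un)
  moreover have "S \<union> - L = UNIV" using assms(3) by auto
  ultimately show ?thesis by simp
qed

lemma smooth_on_wirt_dz: "open S \<Longrightarrow> smooth_on S u \<Longrightarrow> smooth_on S (wirt_dz j u)"
  using smooth_on_cmult[of S "\<lambda>z. dd (axis j 1) u z - \<i> * dd (axis j \<i>) u z" "1/2"]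
  by (simp add: wirt_dz_def smooth_on_diff smooth_on_cmult smooth_on_dd)

lemma smooth_on_wirt_dzbar: "open S \<Longrightarrow> smooth_on S u \<Longrightarrow> smooth_on S (wirt_dzbar j u)"
  using smooth_on_cmult[of S "\<lambda>z. dd (axis j 1) u z + \<i> * dd (axis j \<i>) u z" "1/2"]
  by (simp add: wirt_dzbar_def smooth_on_add smooth_on_cmult smooth_on_dd)

lemma wirt_dz_cong: "open S \<Longrightarrow> z \<in> S \<Longrightarrow> (\<And>y. y \<in> S \<Longrightarrow> u y = v y) \<Longrightarrow> wirt_dz j u z = wirt_dz j v z"
  unfolding wirt_dz_def using dd_cong_open[of S z u v] by simp

lemma wirt_dzbar_cong: "open S \<Longrightarrow> z \<in> S \<Longrightarrow> (\<And>y. y \<in> S \<Longrightarrow> u y = v y) \<Longrightarrow> wirt_dzbar j u z = wirt_dzbar j v z"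
  unfolding wirt_dzbar_def using dd_cong_open[of S z u v] by simp

lemma wirt_const [simp]: "wirt_dz j (\<lambda>z. c) = (\<lambda>z. 0)" "wirt_dzbar j (\<lambda>z. c) = (\<lambda>z. 0)"
  by (simp_all add: wirt_dz_def wirt_dzbar_def)

lemma wirt_mult:
  assumes "u differentiable at z" "v differentiable at z"
  shows "wirt_dz j (\<lambda>z. u z * v z) z = wirt_dz j u z * v z + u z * wirt_dz j v z"
    "wirt_dzbar j (\<lambda>z. u z * v z) z = wirt_dzbar j u z * v z + u z * wirt_dzbar j v z"
  by (simp_all add: wirt_dz_def wirt_dzbar_def dd_mult[OF assms] field_simps)

lemma wirt_add:
  assumes "u differentiable at z" "v differentiable at z"
  shows "wirt_dz j (\<lambda>z. u z + v z) z = wirt_dz j u z + wirt_dz j v z"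
    "wirt_dzbar j (\<lambda>z. u z + v z) z = wirt_dzbar j u z + wirt_dzbar j v z"
  by (simp_all add: wirt_dz_def wirt_dzbar_def dd_add[OF assms] field_simps)

lemma wirt_cmult:
  assumes "u differentiable at z"
  shows "wirt_dz j (\<lambda>z. c * u z) z = c * wirt_dz j u z"
    "wirt_dzbar j (\<lambda>z. c * u z) z = c * wirt_dzbar j u z"
  using wirt_mult[OF _ assms, of "\<lambda>_. c"] by auto

lemma ddbar_cmult:
  assumes "smooth_on UNIV u"
  shows "wirt_dz j (wirt_dzbar k (\<lambda>z. c * u z)) z = c * wirt_dz j (wirt_dzbar k u) z"
proof -
  have "wirt_dzbar k (\<lambda>z. c * u z) = (\<lambda>z. c * wirt_dzbar k u z)"
    by (rule ext) (rule wirt_cmult[OF smooth_on_imp_differentiable[OF assms UNIV_I]])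
  then show ?thesis
    by (simp add: wirt_cmult[OF smooth_on_imp_differentiable[OF smooth_on_wirt_dzbar[OF open_UNIV assms] UNIV_I]])
qed

lemma ddbar_add:
  assumes u: "smooth_on UNIV u" and v: "smooth_on UNIV v"
  shows "wirt_dz j (wirt_dzbar k (\<lambda>z. u z + v z)) z = wirt_dz j (wirt_dzbar k u) z + wirt_dz j (wirt_dzbar k v) z"
proof -
  have "wirt_dzbar k (\<lambda>z. u z + v z) = (\<lambda>z. wirt_dzbar k u z + wirt_dzbar k v z)"
    by (rule ext) (rule wirt_add[OF smooth_on_imp_differentiable[OF u UNIV_I] smooth_on_imp_differentiable[OF v UNIV_I]])
  then show ?thesis
    by (simp add: wirt_add[OF smooth_on_imp_differentiable[OF smooth_on_wirt_dzbar[OF open_UNIV u] UNIV_I]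
        smooth_on_imp_differentiable[OF smooth_on_wirt_dzbar[OF open_UNIV v] UNIV_I]])
qed

lemma ddbar_sum:
  assumes "\<And>i. i \<in> A \<Longrightarrow> smooth_on UNIV (u i)"
  shows "wirt_dz j (wirt_dzbar k (\<lambda>z. \<Sum>i\<in>A. u i z)) z = (\<Sum>i\<in>A. wirt_dz j (wirt_dzbar k (u i)) z)"
  using assms
proof (induction A rule: infinite_finite_induct)
  case (insert i A)
  then show ?case by (simp add: ddbar_add smooth_on_sum)
qed auto

lemma dd_wirt:
  assumes "open S" "smooth_on S u" "z \<in> S"
  shows "dd v (wirt_dz j u) z = (dd v (dd (axis j 1) u) z - \<i> * dd v (dd (axis j \<i>) u) z) / 2"
    "dd v (wirt_dzbar j u) z = (dd v (dd (axis j 1) u) z + \<i> * dd v (dd (axis j \<i>) u) z) / 2"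
proof -
  note d = smooth_on_imp_differentiable[OF smooth_on_dd[OF assms(2)] assms(3), THEN has_derivative_dd]
  have "bounded_linear (\<lambda>x::complex. x / 2)" by (rule bounded_linear_divide)
  note h = bounded_linear.has_derivative[OF this]
  show "dd v (wirt_dz j u) z = (dd v (dd (axis j 1) u) z - \<i> * dd v (dd (axis j \<i>) u) z) / 2"
    unfolding wirt_dz_def by (rule dd_eq[OF h]) (intro has_derivative_diff has_derivative_mult_right d)
  show "dd v (wirt_dzbar j u) z = (dd v (dd (axis j 1) u) z + \<i> * dd v (dd (axis j \<i>) u) z) / 2"
    unfolding wirt_dzbar_def by (rule dd_eq[OF h]) (intro has_derivative_add has_derivative_mult_right d)
qed

lemma wirt_commute:
  assumes "open S" "smooth_on S u" "z \<in> S"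
  shows "wirt_dz j (wirt_dz k u) z = wirt_dz k (wirt_dz j u) z"
    "wirt_dzbar j (wirt_dzbar k u) z = wirt_dzbar k (wirt_dzbar j u) z"
    "wirt_dz j (wirt_dzbar k u) z = wirt_dzbar k (wirt_dz j u) z"
proof -
  note c = dd_commute[OF assms]
  note e = dd_wirt[OF assms] c[of "axis k 1" "axis j 1"] c[of "axis k \<i>" "axis j \<i>"]
    c[of "axis k 1" "axis j \<i>"] c[of "axis k \<i>" "axis j 1"]
  show "wirt_dz j (wirt_dz k u) z = wirt_dz k (wirt_dz j u) z"
    unfolding wirt_dz_def[of j "wirt_dz k u"] wirt_dz_def[of k "wirt_dz j u"] e by (simp add: field_simps)
  show "wirt_dzbar j (wirt_dzbar k u) z = wirt_dzbar k (wirt_dzbar j u) z"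
    unfolding wirt_dzbar_def[of j "wirt_dzbar k u"] wirt_dzbar_def[of k "wirt_dzbar j u"] e by (simp add: field_simps)
  show "wirt_dz j (wirt_dzbar k u) z = wirt_dzbar k (wirt_dz j u) z"
    unfolding wirt_dz_def[of j "wirt_dzbar k u"] wirt_dzbar_def[of k "wirt_dz j u"] e by (simp add: field_simps)
qed

section \<open>First derivatives and Levi forms of real functions\<close>

definition dz :: "(complex^'n \<Rightarrow> real) \<Rightarrow> complex^'n \<Rightarrow> 'n \<Rightarrow> complex" where
  "dz u z j = wirt_dz j (\<lambda>z. of_real (u z)) z"

definition levi :: "(complex^'n \<Rightarrow> real) \<Rightarrow> complex^'n \<Rightarrow> 'n \<Rightarrow> 'n \<Rightarrow> complex" where
  "levi u z j k = wirt_dz j (wirt_dzbar k (\<lambda>z. of_real (u z))) z"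

lemma dd_of_real: "u differentiable at z \<Longrightarrow> dd v (\<lambda>z. of_real (u z) :: complex) z = of_real (dd v u z)"
  by (rule dd_bounded_linear[OF bounded_linear_of_real])

lemma dz_eq: "u differentiable at z \<Longrightarrow> dz u z j = (of_real (dd (axis j 1) u z) - \<i> * of_real (dd (axis j \<i>) u z)) / 2"
  by (simp add: dz_def wirt_dz_def dd_of_real)

lemma wirt_dzbar_of_real:
  "u differentiable at z \<Longrightarrow> wirt_dzbar k (\<lambda>z. of_real (u z)) z = cnj (dz u z k)"
  by (simp add: dz_eq wirt_dzbar_def dd_of_real)

lemma levi_eq:
  assumes "open S" "smooth_on S u" "z \<in> S"
  shows "levi u z j k = (of_real (dd (axis j 1) (dd (axis k 1) u) z) + of_real (dd (axis j \<i>) (dd (axis k \<i>) u) z)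
    + \<i> * (of_real (dd (axis j 1) (dd (axis k \<i>) u) z) - of_real (dd (axis j \<i>) (dd (axis k 1) u) z))) / 4"
proof -
  have 1: "dd v (dd w (\<lambda>z. of_real (u z) :: complex)) z = of_real (dd v (dd w u) z)" for v w
    using dd_cong_open[OF assms(1,3), of "dd w (\<lambda>z. of_real (u z) :: complex)" "\<lambda>z. of_real (dd w u z)" v]
      dd_of_real[OF smooth_on_imp_differentiable[OF assms(2)]]
      dd_of_real[OF smooth_on_imp_differentiable[OF smooth_on_dd[OF assms(2)] assms(3)]] by simp
  show ?thesis
    unfolding levi_def wirt_dz_def[of j] dd_wirt[OF assms(1) smooth_on_of_real[OF assms(1,2)] assms(3)] 1
    by (simp add: field_simps)
qed

lemma levi_hermitian:
  assumes "open S" "smooth_on S u" "z \<in> S"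
  shows "levi u z k j = cnj (levi u z j k)"
  unfolding levi_eq[OF assms]
  by (simp add: dd_commute_real[OF assms, of "axis k _" "axis j _"] complex_eq_iff)

lemma smooth_on_levi: "open S \<Longrightarrow> smooth_on S u \<Longrightarrow> smooth_on S (\<lambda>z. levi u z j k)"
  unfolding levi_def by (intro smooth_on_wirt_dz smooth_on_wirt_dzbar smooth_on_of_real)

lemma smooth_on_dz: "open S \<Longrightarrow> smooth_on S u \<Longrightarrow> smooth_on S (\<lambda>z. dz u z j)"
  unfolding dz_def by (intro smooth_on_wirt_dz smooth_on_of_real)

lemma levi_cong: "open S \<Longrightarrow> z \<in> S \<Longrightarrow> (\<And>y. y \<in> S \<Longrightarrow> u y = v y) \<Longrightarrow> levi u z = levi v z"
  unfolding levi_def by (intro ext wirt_dz_cong[of S] wirt_dzbar_cong[of S]) auto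

lemma dz_cong: "open S \<Longrightarrow> z \<in> S \<Longrightarrow> (\<And>y. y \<in> S \<Longrightarrow> u y = v y) \<Longrightarrow> dz u z = dz v z"
  unfolding dz_def by (intro ext wirt_dz_cong[of S]) auto

lemma levi_const [simp]: "levi (\<lambda>z. c) z j k = 0" and dz_const [simp]: "dz (\<lambda>z. c) z j = 0"
  by (simp_all add: levi_def dz_def)

lemma levi_mult:
  assumes "open S" "smooth_on S u" "smooth_on S v" "z \<in> S"
  shows "levi (\<lambda>z. u z * v z) z j k = of_real (u z) * levi v z j k + of_real (v z) * levi u z j k
    + (dz u z j * cnj (dz v z k) + dz v z j * cnj (dz u z k))"
proof -
  let ?u = "\<lambda>z. of_real (u z) :: complex" and ?v = "\<lambda>z. of_real (v z) :: complex"
  have su: "smooth_on S ?u" and sv: "smooth_on S ?v" by (intro smooth_on_of_real assms)+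
  note d = smooth_on_imp_differentiable[OF _ assms(4)]
  have 1: "wirt_dzbar k (\<lambda>z. of_real (u z * v z)) y = wirt_dzbar k ?u y * ?v y + ?u y * wirt_dzbar k ?v y"
    if "y \<in> S" for y
    using wirt_mult(2)[OF smooth_on_imp_differentiable[OF su that] smooth_on_imp_differentiable[OF sv that]] by simp
  note sb = smooth_on_wirt_dzbar[OF assms(1) su] smooth_on_wirt_dzbar[OF assms(1) sv]
  have "levi (\<lambda>z. u z * v z) z j k = wirt_dz j (\<lambda>y. wirt_dzbar k ?u y * ?v y + ?u y * wirt_dzbar k ?v y) z"
    unfolding levi_def by (rule wirt_dz_cong[OF assms(1,4) 1])
  also have "\<dots> = wirt_dz j (wirt_dzbar k ?u) z * ?v z + wirt_dzbar k ?u z * wirt_dz j ?v z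
      + (wirt_dz j ?u z * wirt_dzbar k ?v z + ?u z * wirt_dz j (wirt_dzbar k ?v) z)"
    by (simp add: wirt_add[OF d[OF smooth_on_mult[OF assms(1) sb(1) sv]] d[OF smooth_on_mult[OF assms(1) su sb(2)]]]
        wirt_mult[OF d[OF sb(1)] d[OF sv]] wirt_mult[OF d[OF su] d[OF sb(2)]])
  finally show ?thesis
    by (simp add: levi_def dz_def[symmetric] wirt_dzbar_of_real[OF d[OF assms(2)]] wirt_dzbar_of_real[OF d[OF assms(3)]] algebra_simps)
qed

lemma levi_powr:
  assumes "open S" "smooth_on S G" "z \<in> S" "\<And>y. y \<in> S \<Longrightarrow> 0 < G y"
  shows "levi (\<lambda>z. G z powr s) z j k = of_real (s * G z powr (s - 1)) * levi G z j k
    + of_real (s * (s - 1) * G z powr (s - 2)) * (dz G z j * cnj (dz G z k))"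
    and "dz (\<lambda>z. G z powr s) z j = of_real (s * G z powr (s - 1)) * dz G z j"
proof -
  \<comment> \<open>The constant \<open>c\<close> is carried along because the rule is used twice,
    for \<open>G powr s\<close> and then for the factor \<open>s * G powr (s - 1)\<close> of its
    derivative.\<close>
  have chain: "dd v (\<lambda>z. c * G z powr r) y = c * r * G y powr (r - 1) * dd v G y" if "y \<in> S" for v y r c
  proof -
    have "((\<lambda>t. c * t powr r) has_real_derivative c * (r * G y powr (r - 1))) (at (G y))"
      using assms(4)[OF that] by (intro DERIV_cmult has_real_derivative_powr)
    from dd_real_chain[OF smooth_on_imp_differentiable[OF assms(2) that] this] show ?thesis by (simp add: mult.assoc)
  qed
  have sm: "smooth_on S (\<lambda>z. c * G z powr r)" for r c
    by (intro smooth_on_cmult smooth_on_powr assms)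
  note diff = smooth_on_imp_differentiable[OF sm] smooth_on_imp_differentiable[OF assms(2)]
  have dzp: "dz (\<lambda>z. c * G z powr r) y j = of_real (c * r * G y powr (r - 1)) * dz G y j" if "y \<in> S" for r y j c
    by (simp add: dz_eq[OF diff(1)[OF that]] dz_eq[OF diff(2)[OF that]] chain[OF that] field_simps)
  show "dz (\<lambda>z. G z powr s) z j = of_real (s * G z powr (s - 1)) * dz G z j"
    using dzp[OF assms(3), of 1 s] by simp
  let ?h = "\<lambda>z. of_real (s * G z powr (s - 1)) :: complex"
  have 1: "wirt_dzbar k (\<lambda>z. of_real (G z powr s)) y = ?h y * wirt_dzbar k (\<lambda>z. of_real (G z)) y"
    if "y \<in> S" for y
    using dzp[OF that, of 1 s k] smooth_on_imp_differentiable[OF sm[of 1 s] that]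
    by (simp add: wirt_dzbar_of_real diff(2)[OF that])
  have sh: "smooth_on S ?h" by (rule smooth_on_of_real[OF assms(1) sm])
  have sb: "smooth_on S (wirt_dzbar k (\<lambda>z. of_real (G z)))"
    by (intro smooth_on_wirt_dzbar smooth_on_of_real assms)
  have "levi (\<lambda>z. G z powr s) z j k = wirt_dz j (\<lambda>y. ?h y * wirt_dzbar k (\<lambda>z. of_real (G z)) y) z"
    unfolding levi_def by (rule wirt_dz_cong[OF assms(1,3) 1])
  also have "\<dots> = wirt_dz j ?h z * wirt_dzbar k (\<lambda>z. of_real (G z)) z + ?h z * levi G z j k"
    unfolding levi_def by (rule wirt_mult[OF smooth_on_imp_differentiable[OF sh assms(3)] smooth_on_imp_differentiable[OF sb assms(3)]])
  also have "wirt_dz j ?h z = of_real (s * (s - 1) * G z powr (s - 2)) * dz G z j"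
    using dzp[OF assms(3), of s "s - 1" j] by (simp add: dz_def)
  finally show "levi (\<lambda>z. G z powr s) z j k = of_real (s * G z powr (s - 1)) * levi G z j k
    + of_real (s * (s - 1) * G z powr (s - 2)) * (dz G z j * cnj (dz G z k))"
    by (simp add: wirt_dzbar_of_real[OF diff(2)[OF assms(3)]])
qed

lemma levi_mult_powr:
  assumes "open S" "smooth_on S F" "smooth_on S G" "z \<in> S" "\<And>y. y \<in> S \<Longrightarrow> 0 < G y"
  shows "levi (\<lambda>z. F z * G z powr s) z j k = of_real (G z powr s) * levi F z j k
    + of_real (F z * s * G z powr (s - 1)) * levi G z j k
    + of_real (F z * s * (s - 1) * G z powr (s - 2)) * (dz G z j * cnj (dz G z k))
    + of_real (s * G z powr (s - 1)) * (dz F z j * cnj (dz G z k) + dz G z j * cnj (dz F z k))"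
proof -
  have "smooth_on S (\<lambda>z. G z powr s)" by (rule smooth_on_powr[OF assms(1,3,5)])
  note 1 = levi_mult[OF assms(1,2) this assms(4), of j k]
  have 2: "levi (\<lambda>z. G z powr s) z j k = of_real (s * G z powr (s - 1)) * levi G z j k
    + of_real (s * (s - 1) * G z powr (s - 2)) * (dz G z j * cnj (dz G z k))"
    and 3: "dz (\<lambda>z. G z powr s) z j = of_real (s * G z powr (s - 1)) * dz G z j" for j k
    by (rule levi_powr[OF assms(1,3,4)], rule assms(5), assumption)+
  show ?thesis unfolding 1 2 3 by (simp add: algebra_simps)
qed

lemma dd_norm_square: "dd v (\<lambda>x::'a::euclidean_space. (norm x)\<^sup>2) x = 2 * (x \<bullet> v)"
proof (rule dd_eq)
  show "((\<lambda>x. (norm x)\<^sup>2) has_derivative (\<lambda>v. 2 * (x \<bullet> v))) (at x)"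
    unfolding power2_norm_eq_inner by (auto intro!: derivative_eq_intros simp: inner_commute)
qed

lemma norm_square_differentiable: "(\<lambda>x::'a::euclidean_space. (norm x)\<^sup>2) differentiable at x"
  using smooth_on_imp_differentiable[OF smooth_on_norm_square[of 0]] by simp

lemma dz_norm_square: "dz (\<lambda>z. (norm z)\<^sup>2) z j = cnj (z $ j)"
  by (simp add: dz_eq[OF norm_square_differentiable] dd_norm_square inner_axis complex_eq_iff)

lemma levi_norm_square: "levi (\<lambda>z. (norm z)\<^sup>2) z = id_mat"
proof (intro ext)
  fix j k :: 'a
  have 1: "wirt_dzbar k (\<lambda>z. of_real ((norm z)\<^sup>2)) = (\<lambda>z. z $ k)"
    by (rule ext) (simp add: wirt_dzbar_of_real[OF norm_square_differentiable] dz_norm_square del: of_real_power)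
  have 2: "dd v (\<lambda>z. z $ k :: complex) z = v $ k" for v z
    by (rule dd_eq[OF bounded_linear_imp_has_derivative[OF bounded_linear_vec_nth]])
  show "levi (\<lambda>z. (norm z)\<^sup>2) z j k = id_mat j k"
    unfolding levi_def 1 wirt_dz_def 2 by (simp add: axis_def id_mat_def)
qed

section \<open>Pluriharmonic currents against Levi forms\<close>

lemma wedge11_smooth:
  assumes "open S" "\<And>j k. smooth_on S (\<lambda>z. M z j k)"
  shows "smooth_on S (\<lambda>z. wedge11 q (M z) \<psi> I J)"
proof (cases "card I = Suc q \<and> card J = Suc q")
  case True
  have "smooth_on S (\<lambda>z. \<Sum>j\<in>I. \<Sum>k\<in>J. ((-1) ^ q * sgn_ins j (I - {j}) * sgn_ins k (J - {k}) * \<psi> (I - {j}) (J - {k})) * M z j k)"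
    by (intro smooth_on_sum smooth_on_cmult assms)
  then show ?thesis using True by (simp add: wedge11_def mult_ac)
next
  case False
  then show ?thesis by (simp add: wedge11_eq_0 smooth_on_const)
qed

text \<open>\<open>\<psi>\<close> has constant coefficients, so both derivatives fall on
  \<open>N\<close>; the removal of two indices from \<open>I\<close> and from \<open>J\<close>
  produces the signs \<open>sgn2\<close>.\<close>

lemma ddbar_form_wedge11:
  fixes N :: "complex^('n::{finite,linorder}) \<Rightarrow> 'n \<Rightarrow> 'n \<Rightarrow> complex"
  assumes "\<And>a b. smooth_on UNIV (\<lambda>z. N z a b)"
  shows "ddbar_form (Suc q) (\<lambda>I J z. wedge11 q (N z) \<psi> I J) I J z
    = wedge22 q (\<lambda>j k a b. wirt_dz j (wirt_dzbar k (\<lambda>z. N z a b)) z) \<psi> I J"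
proof (cases "card I = Suc (Suc q) \<and> card J = Suc (Suc q)")
  case True
  then have c: "card (I - {j}) = Suc q" "card (J - {k}) = Suc q" if "j \<in> I" "k \<in> J" for j k
    using that by (auto simp: card_Diff_singleton)
  have sq: "(-1) ^ q * ((-1) ^ q * z) = (z::complex)" for z
    by (simp add: mult.assoc[symmetric] power_add[symmetric] mult_2[symmetric])
  have 1: "wirt_dz j (wirt_dzbar k (\<lambda>z. wedge11 q (N z) \<psi> (I - {j}) (J - {k}))) z
      = (\<Sum>a\<in>I - {j}. \<Sum>b\<in>J - {k}. ((-1) ^ q * sgn_ins a (I - {j} - {a}) * sgn_ins b (J - {k} - {b}) * \<psi> (I - {j} - {a}) (J - {k} - {b}))
         * wirt_dz j (wirt_dzbar k (\<lambda>z. N z a b)) z)" if "j \<in> I" "k \<in> J" for j k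
  proof -
    have "(\<lambda>z. wedge11 q (N z) \<psi> (I - {j}) (J - {k})) = (\<lambda>z. \<Sum>a\<in>I - {j}. \<Sum>b\<in>J - {k}.
        ((-1) ^ q * sgn_ins a (I - {j} - {a}) * sgn_ins b (J - {k} - {b}) * \<psi> (I - {j} - {a}) (J - {k} - {b})) * N z a b)"
      using c[OF that] by (simp add: wedge11_def mult_ac)
    then show ?thesis
      by (simp add: ddbar_sum smooth_on_sum smooth_on_cmult assms ddbar_cmult)
  qed
  have "ddbar_form (Suc q) (\<lambda>I J z. wedge11 q (N z) \<psi> I J) I J z = (\<Sum>j\<in>I. \<Sum>k\<in>J. \<Sum>a\<in>I - {j}. \<Sum>b\<in>J - {k}.
        - (sgn2 I j a * sgn2 J k b * (wirt_dz j (wirt_dzbar k (\<lambda>z. N z a b)) z * \<psi> (I - {j} - {a}) (J - {k} - {b}))))"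
    using True unfolding ddbar_form_def
    by (auto simp: 1 sum_distrib_left sum_negf[symmetric] sgn2_def sq mult.assoc mult.left_commute
        mult.commute[of "wirt_dz _ _ _"] intro!: sum.cong)
  also have "\<dots> = (\<Sum>j\<in>I. \<Sum>a\<in>I - {j}. \<Sum>k\<in>J. \<Sum>b\<in>J - {k}.
        - (sgn2 I j a * sgn2 J k b * (wirt_dz j (wirt_dzbar k (\<lambda>z. N z a b)) z * \<psi> (I - {j} - {a}) (J - {k} - {b}))))"
    by (rule sum.cong[OF refl]) (rule sum.swap)
  finally show ?thesis using True by (simp add: wedge22_def)
next
  case False
  then show ?thesis by (auto simp: ddbar_form_def wedge22_def)
qed

text \<open>The terms of \<open>ddbar (u ddbar v)\<close> in which \<open>v\<close> is differentiated at least three times are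
  symmetric in a pair of holomorphic or antiholomorphic indices.\<close>

lemma wedge22_ddbar_levi:
  assumes S: "open S" and u: "smooth_on S u" and v: "smooth_on S v" and z: "z \<in> S"
  shows "wedge22 q (\<lambda>j k a b. wirt_dz j (wirt_dzbar k (\<lambda>z. of_real (u z) * levi v z a b)) z) \<psi>
    = wedge22 q (\<lambda>j k a b. levi u z j k * levi v z a b) \<psi>"
proof -
  let ?u = "\<lambda>z. of_real (u z) :: complex" and ?v = "\<lambda>z. of_real (v z) :: complex"
  have su: "smooth_on S ?u" and sv: "smooth_on S ?v" by (intro smooth_on_of_real S u v)+
  note smooth = smooth_on_wirt_dz[OF S] smooth_on_wirt_dzbar[OF S]
  note d = smooth_on_imp_differentiable
  define V where "V a b = wirt_dz a (wirt_dzbar b ?v)" for a b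
  have sV: "smooth_on S (V a b)" for a b unfolding V_def by (intro smooth sv)
  have 1: "wirt_dz j (wirt_dzbar k (\<lambda>z. ?u z * V a b z)) z
    = levi u z j k * V a b z + wirt_dzbar k ?u z * wirt_dz j (V a b) z
      + (wirt_dz j ?u z * wirt_dzbar k (V a b) z + ?u z * wirt_dz j (wirt_dzbar k (V a b)) z)" for j k a b
  proof -
    have "wirt_dz j (wirt_dzbar k (\<lambda>z. ?u z * V a b z)) z
        = wirt_dz j (\<lambda>z. wirt_dzbar k ?u z * V a b z + ?u z * wirt_dzbar k (V a b) z) z"
      by (rule wirt_dz_cong[OF S z]) (rule wirt_mult[OF d[OF su] d[OF sV]])
    also have "\<dots> = wirt_dz j (\<lambda>z. wirt_dzbar k ?u z * V a b z) z + wirt_dz j (\<lambda>z. ?u z * wirt_dzbar k (V a b) z) z"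
      by (rule wirt_add) (rule d[OF _ z], intro smooth_on_mult smooth su sV S)+
    also have "\<dots> = wirt_dz j (wirt_dzbar k ?u) z * V a b z + wirt_dzbar k ?u z * wirt_dz j (V a b) z
      + (wirt_dz j ?u z * wirt_dzbar k (V a b) z + ?u z * wirt_dz j (wirt_dzbar k (V a b)) z)"
      by (intro arg_cong2[where f = "(+)"] wirt_mult) (rule d[OF _ z], intro smooth su sV)+
    finally show ?thesis by (simp add: levi_def)
  qed
  have c1: "wirt_dz j (V a b) z = wirt_dz a (V j b) z" for j a b
    unfolding V_def by (rule wirt_commute[OF S smooth(2)[OF sv] z])
  have comm: "wirt_dzbar k (V a b) y = wirt_dz a (wirt_dzbar k (wirt_dzbar b ?v)) y" if "y \<in> S" for a b k y
    unfolding V_def by (rule wirt_commute(3)[OF S smooth(2)[OF sv] that, symmetric])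
  have c2: "wirt_dzbar k (V a b) z = wirt_dzbar b (V a k) z" for k a b
    unfolding comm[OF z] by (rule wirt_dz_cong[OF S z]) (rule wirt_commute[OF S sv])
  have c3: "wirt_dz j (wirt_dzbar k (V a b)) z = wirt_dz a (wirt_dzbar k (V j b)) z" for j k a b
  proof -
    have "wirt_dz j (wirt_dzbar k (V a b)) z = wirt_dz j (wirt_dz a (wirt_dzbar k (wirt_dzbar b ?v))) z" for j a
      by (rule wirt_dz_cong[OF S z]) (rule comm)
    then show ?thesis using wirt_commute(1)[OF S smooth(2)[OF smooth(2)[OF sv]] z] by simp
  qed
  have "wedge22 q (\<lambda>j k a b. wirt_dzbar k ?u z * wirt_dz j (V a b) z) \<psi> = (\<lambda>I J. 0)"
    by (rule wedge22_eq_0_left) (simp only: c1)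
  moreover have "wedge22 q (\<lambda>j k a b. wirt_dz j ?u z * wirt_dzbar k (V a b) z) \<psi> = (\<lambda>I J. 0)"
    by (rule wedge22_eq_0_right) (simp only: c2)
  moreover have "wedge22 q (\<lambda>j k a b. ?u z * wirt_dz j (wirt_dzbar k (V a b)) z) \<psi> = (\<lambda>I J. 0)"
    by (rule wedge22_eq_0_left) (simp only: c3)
  ultimately have "wedge22 q (\<lambda>j k a b. wirt_dz j (wirt_dzbar k (\<lambda>z. ?u z * V a b z)) z) \<psi>
      = wedge22 q (\<lambda>j k a b. levi u z j k * V a b z) \<psi>"
    unfolding 1 by (intro ext) (simp add: wedge22_add)
  then show ?thesis by (simp add: V_def levi_def)
qed

text \<open>\<open>q\<close> is p - 2, the power of the Kaehler form left over beside two Levi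
  forms.\<close>

locale pluriharmonic_current_on = positive_current_on p \<Omega> T
  for p and \<Omega> :: "(complex^('n::{finite,linorder})) set" and T :: "'n form \<Rightarrow> complex" +
  fixes q :: nat
  assumes p_eq: "p = Suc (Suc q)" and pluriharmonic: "pluriharmonic_current p \<Omega> T"
begin

text \<open>dd^c T = 0 is tested with u ddbar v wedge \<psi>. As ddbar v is closed and \<psi>
  constant, both derivatives end up on \<open>u\<close>. \<open>v\<close> is smooth on
  \<open>\<Omega>\<close> only, and the support of \<open>u\<close> lets the test form be extended
  by zero.\<close>

lemma T_levi_levi:
  assumes u: "smooth_on UNIV u" "compact L" "L \<subseteq> \<Omega>" "\<And>z. z \<notin> L \<Longrightarrow> u z = 0" and v: "smooth_on \<Omega> v"
  shows "T (\<lambda>I J z. wedge11 (Suc q) (levi u z) (wedge11 q (levi v z) \<psi>) I J) = 0"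
proof -
  define N where "N z a b = of_real (u z) * levi v z a b" for z a b
  have uc: "smooth_on UNIV (\<lambda>z. of_real (u z) :: complex)" by (rule smooth_on_of_real[OF open_UNIV u(1)])
  have N: "smooth_on UNIV (\<lambda>z. N z a b)" for a b
    unfolding N_def using u(4) smooth_on_levi[OF open_domain v]
    by (intro smooth_on_mult_cutoff[OF uc u(2,3) open_domain]) auto
  have N0: "N z = (\<lambda>a b. 0)" if "z \<notin> L" for z using u(4)[OF that] by (intro ext) (simp add: N_def)
  have "test_form (Suc q) \<Omega> (\<lambda>I J z. wedge11 q (N z) \<psi> I J)"
    unfolding test_form_def form_support_ok_def
    using wedge11_smooth[OF open_UNIV N] u(2,3) N0 by (auto simp: wedge11_eq_0 intro!: exI[of _ L])
  then have "T (ddbar_form (Suc q) (\<lambda>I J z. wedge11 q (N z) \<psi> I J)) = 0"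
    using pluriharmonic unfolding pluriharmonic_current_def p_eq by simp
  moreover have "ddbar_form (Suc q) (\<lambda>I J z. wedge11 q (N z) \<psi> I J)
      = (\<lambda>I J z. wedge11 (Suc q) (levi u z) (wedge11 q (levi v z) \<psi>) I J)"
  proof (intro ext)
    fix I J z
    show "ddbar_form (Suc q) (\<lambda>I J z. wedge11 q (N z) \<psi> I J) I J z
      = wedge11 (Suc q) (levi u z) (wedge11 q (levi v z) \<psi>) I J"
    proof (cases "z \<in> \<Omega>")
      case True
      then show ?thesis
        unfolding ddbar_form_wedge11[OF N] wedge11_wedge11 N_def
        using wedge22_ddbar_levi[OF open_domain smooth_on_subset[OF u(1)] v True] by simp
    next
      case False
      have o: "open (- L)" "z \<in> - L" using u False by (auto simp: compact_imp_closed)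
      have "wirt_dz j (wirt_dzbar k (\<lambda>z. N z a b)) z = wirt_dz j (wirt_dzbar k (\<lambda>z. 0)) z" for j k a b
        using N0 by (intro wirt_dz_cong[OF o] wirt_dzbar_cong[of "- L"]) (auto simp: o)
      moreover have "levi u z = levi (\<lambda>z. 0) z"
        using u(4) by (intro levi_cong[OF o]) auto
      then have "levi u z = (\<lambda>j k. 0)" by (intro ext) simp
      ultimately show ?thesis
        unfolding ddbar_form_wedge11[OF N] by (simp add: wedge22_def)
    qed
  qed
  ultimately show ?thesis by simp
qed

end

section \<open>The Levi form of a smooth plurisubharmonic function\<close>

lemma dd_lincomb:
  assumes "f differentiable at x"
  shows "dd (a *\<^sub>R v + b *\<^sub>R w) f x = a *\<^sub>R dd v f x + b *\<^sub>R dd w f x"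
  by (simp add: linear_add[OF linear_dd[OF assms]] linear_scale[OF linear_dd[OF assms]])

lemma vec_eq_sum_axis:
  fixes b :: "complex^'n"
  shows "b = (\<Sum>j\<in>UNIV. Re (b $ j) *\<^sub>R axis j 1 + Im (b $ j) *\<^sub>R axis j \<i>)"
proof -
  have "Re (b $ j) *\<^sub>R axis j 1 + Im (b $ j) *\<^sub>R axis j \<i> = axis j (b $ j)" for j
    by (simp add: Finite_Cartesian_Product.vec_eq_iff axis_def complex_eq_iff)
  moreover have "b = (\<Sum>j\<in>UNIV. axis j (b $ j))"
    by (simp add: Finite_Cartesian_Product.vec_eq_iff axis_def if_distrib cong: if_cong)
  ultimately show ?thesis by simp
qed

lemma dd_axis_expansion:
  fixes f :: "complex^'n \<Rightarrow> real"
  assumes "f differentiable at z"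
  shows "dd b f z = (\<Sum>j\<in>UNIV. Re (b $ j) * dd (axis j 1) f z + Im (b $ j) * dd (axis j \<i>) f z)"
proof -
  have "dd b f z = dd (\<Sum>j\<in>UNIV. Re (b $ j) *\<^sub>R axis j 1 + Im (b $ j) *\<^sub>R axis j \<i>) f z"
    using vec_eq_sum_axis[of b] by simp
  also have "\<dots> = (\<Sum>j\<in>UNIV. Re (b $ j) * dd (axis j 1) f z + Im (b $ j) * dd (axis j \<i>) f z)"
    by (simp add: linear_sum[OF linear_dd[OF assms]] dd_lincomb[OF assms])
  finally show ?thesis .
qed

lemma dd_dd_axis_expansion:
  fixes u :: "complex^'n \<Rightarrow> real"
  assumes S: "open S" "smooth_on S u" "z \<in> S"
  shows "dd b (dd b' u) z = (\<Sum>j\<in>UNIV. \<Sum>k\<in>UNIV.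
      Re (b $ j) * (Re (b' $ k) * dd (axis j 1) (dd (axis k 1) u) z + Im (b' $ k) * dd (axis j 1) (dd (axis k \<i>) u) z)
    + Im (b $ j) * (Re (b' $ k) * dd (axis j \<i>) (dd (axis k 1) u) z + Im (b' $ k) * dd (axis j \<i>) (dd (axis k \<i>) u) z))"
proof -
  note d = smooth_on_imp_differentiable[OF smooth_on_dd[OF S(2)] S(3)]
  have "dd v (dd b' u) z = (\<Sum>k\<in>UNIV. Re (b' $ k) * dd v (dd (axis k 1) u) z + Im (b' $ k) * dd v (dd (axis k \<i>) u) z)" for v
  proof -
    have "dd v (dd b' u) z = dd v (\<lambda>y. \<Sum>k\<in>UNIV. Re (b' $ k) * dd (axis k 1) u y + Im (b' $ k) * dd (axis k \<i>) u y) z"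
      by (rule dd_cong_open[OF S(1,3)]) (rule dd_axis_expansion[OF smooth_on_imp_differentiable[OF S(2)]])
    also have "\<dots> = (\<Sum>k\<in>UNIV. Re (b' $ k) * dd v (dd (axis k 1) u) z + Im (b' $ k) * dd v (dd (axis k \<i>) u) z)"
      by (rule dd_eq) (intro has_derivative_sum has_derivative_add has_derivative_mult_right has_derivative_dd d)
    finally show ?thesis .
  qed
  note inner = this
  have "dd b (dd b' u) z = (\<Sum>j\<in>UNIV. Re (b $ j) * dd (axis j 1) (dd b' u) z + Im (b $ j) * dd (axis j \<i>) (dd b' u) z)"
    by (rule dd_axis_expansion[OF d])
  also have "\<dots> = (\<Sum>j\<in>UNIV. \<Sum>k\<in>UNIV.
      Re (b $ j) * (Re (b' $ k) * dd (axis j 1) (dd (axis k 1) u) z + Im (b' $ k) * dd (axis j 1) (dd (axis k \<i>) u) z)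
    + Im (b $ j) * (Re (b' $ k) * dd (axis j \<i>) (dd (axis k 1) u) z + Im (b' $ k) * dd (axis j \<i>) (dd (axis k \<i>) u) z))"
    unfolding inner[of "axis _ _"]
    by (simp add: sum_distrib_left sum.distrib[symmetric] distrib_left del: sum.distrib)
  finally show ?thesis .
qed

text \<open>The Levi form in direction \<open>b\<close> is a quarter of the Laplacian of
  \<open>u\<close> along the complex line through \<open>z\<close> spanned by
  \<open>b\<close>.\<close>

lemma Re_herm_form_levi:
  fixes u :: "complex^'n \<Rightarrow> real"
  assumes "open S" "smooth_on S u" "z \<in> S"
  shows "4 * Re (herm_form (levi u z) (\<lambda>j. b $ j)) = dd b (dd b u) z + dd (\<i> *s b) (dd (\<i> *s b) u) z"
proof -
  have "4 * Re (levi u z j k * (b $ j * cnj (b $ k))) =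
      Re (b $ j) * (Re (b $ k) * dd (axis j 1) (dd (axis k 1) u) z + Im (b $ k) * dd (axis j 1) (dd (axis k \<i>) u) z)
    + Im (b $ j) * (Re (b $ k) * dd (axis j \<i>) (dd (axis k 1) u) z + Im (b $ k) * dd (axis j \<i>) (dd (axis k \<i>) u) z)
    + (Re ((\<i> *s b) $ j) * (Re ((\<i> *s b) $ k) * dd (axis j 1) (dd (axis k 1) u) z + Im ((\<i> *s b) $ k) * dd (axis j 1) (dd (axis k \<i>) u) z)
    + Im ((\<i> *s b) $ j) * (Re ((\<i> *s b) $ k) * dd (axis j \<i>) (dd (axis k 1) u) z + Im ((\<i> *s b) $ k) * dd (axis j \<i>) (dd (axis k \<i>) u) z))" for j k
    unfolding levi_eq[OF assms] by (simp add: field_simps)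
  then show ?thesis
    unfolding dd_dd_axis_expansion[OF assms, of b b] dd_dd_axis_expansion[OF assms, of "\<i> *s b" "\<i> *s b"]
      herm_form_def Re_sum sum_distrib_left sum.distrib[symmetric]
    by (intro sum.cong refl)
qed

lemma second_order_taylor:
  fixes u :: "'a::real_normed_vector \<Rightarrow> real"
  assumes u: "smooth_on S u" and r: "0 < r" and S: "\<And>t. 0 \<le> t \<Longrightarrow> t \<le> r \<Longrightarrow> z + t *\<^sub>R w \<in> S"
  shows "\<exists>t. 0 < t \<and> t < r \<and> u (z + r *\<^sub>R w) = u z + r * dd w u z + r\<^sup>2 / 2 * dd w (dd w u) (z + t *\<^sub>R w)"
proof -
  define D where "D m t = iter_dd (replicate m w) u (z + t *\<^sub>R w)" for m t
  have deriv: "(D m has_real_derivative D (Suc m) t) (at t)" if "0 \<le> t" "t \<le> r" for m t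
  proof -
    have "iter_dd (replicate m w) u differentiable at (z + t *\<^sub>R w)"
      using u S[OF that] by (auto simp: smooth_on_def)
    from has_real_derivative_along_line[OF this] show ?thesis by (simp add: D_def[abs_def])
  qed
  have "\<exists>t. 0 < t \<and> t < r \<and> D 0 r = (\<Sum>m<2. D m 0 / fact m * (r - 0) ^ m) + D 2 t / fact 2 * (r - 0) ^ 2"
    using deriv r by (intro Taylor_up) auto
  then show ?thesis by (simp add: D_def numeral_2_eq_2 mult_ac)
qed

lemma herm_form_levi_real:
  assumes "open S" "smooth_on S u" "z \<in> S"
  shows "herm_form (levi u z) x \<in> \<real>"
proof -
  have "cnj (herm_form (levi u z) x) = (\<Sum>j\<in>UNIV. \<Sum>k\<in>UNIV. levi u z k j * (x k * cnj (x j)))"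
    unfolding herm_form_def cnj_sum
    by (intro sum.cong refl) (simp add: levi_hermitian[OF assms, symmetric] mult.commute)
  also have "\<dots> = herm_form (levi u z) x" unfolding herm_form_def by (rule sum.swap)
  finally show ?thesis by (simp add: Reals_cnj_iff)
qed

text \<open>The second-order Taylor expansion is integrated over a small circle in the complex line
  of \<open>b\<close>. The linear terms integrate to zero, and the sub-mean-value inequality leaves
  a Laplacian that is nonnegative up to an arbitrarily small error.\<close>

lemma psd_levi:
  fixes u :: "complex^'n \<Rightarrow> real"
  assumes S: "open \<Omega>" "smooth_on \<Omega> u" "z \<in> \<Omega>" and psh: "psh_real \<Omega> u"
  shows "psd (levi u z)"
  unfolding psd_def
proof (intro allI conjI)
  fix x :: "'n \<Rightarrow> complex"
  show "herm_form (levi u z) x \<in> \<real>" by (rule herm_form_levi_real[OF S])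
  define b where "b = (\<chi> j. x j)"
  define c where "c = \<i> *s b"
  define w where "w \<theta> = cos \<theta> *\<^sub>R b + sin \<theta> *\<^sub>R c" for \<theta>
  have cis_w: "cis \<theta> *s (of_real r *s b) = r *\<^sub>R w \<theta>" for \<theta> r
    by (simp add: w_def c_def Finite_Cartesian_Product.vec_eq_iff complex_eq_iff algebra_simps)
  define D where "D v v' = dd v (dd v' u)" for v v'
  \<comment> \<open>The second derivative of \<open>u\<close> in direction
    \<open>w \<theta>\<close>, expanded in sines and cosines so that it can be integrated in
    \<open>\<theta>\<close> explicitly.\<close>
  define Q where "Q \<theta> y = cos \<theta> * cos \<theta> * D b b y + cos \<theta> * sin \<theta> * D b c y + (sin \<theta> * cos \<theta> * D c b y + sin \<theta> * sin \<theta> * D c c y)" for \<theta> y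
  have DQ: "dd (w \<theta>) (dd (w \<theta>) u) y = Q \<theta> y" if "y \<in> \<Omega>" for \<theta> y
  proof -
    note d = smooth_on_imp_differentiable[OF smooth_on_dd[OF S(2)] that]
    have "dd v (dd (w \<theta>) u) y = dd v (\<lambda>y. cos \<theta> * dd b u y + sin \<theta> * dd c u y) y" for v
      using dd_cong_open[OF S(1) that, of "dd (w \<theta>) u"] dd_lincomb[OF smooth_on_imp_differentiable[OF S(2)]]
      by (simp add: w_def)
    also have "\<dots> v = cos \<theta> * dd v (dd b u) y + sin \<theta> * dd v (dd c u) y" for v
      by (rule dd_eq) (intro has_derivative_add has_derivative_mult_right has_derivative_dd d)
    finally have "dd v (dd (w \<theta>) u) y = cos \<theta> * dd v (dd b u) y + sin \<theta> * dd v (dd c u) y" for v .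
    from this[of "w \<theta>"] show ?thesis
      by (simp add: w_def dd_lincomb[OF d] Q_def D_def algebra_simps)
  qed
  have main: "0 \<le> D b b z + D c c z + 8 * \<eta>" if \<eta>: "\<eta> > 0" for \<eta>
  proof -
    have ev: "eventually (\<lambda>y. \<bar>D v v' y - D v v' z\<bar> < \<eta>) (nhds z)" for v v'
    proof -
      have "isCont (D v v') z"
        unfolding D_def using smooth_on_imp_differentiable[OF smooth_on_dd[OF smooth_on_dd[OF S(2)]] S(3)]
        by (rule differentiable_imp_continuous_within)
      then obtain d where "d > 0" "\<And>y. dist y z < d \<Longrightarrow> dist (D v v' y) (D v v' z) < \<eta>"
        using \<eta> unfolding continuous_at_eps_delta by blast
      then show ?thesis unfolding eventually_nhds_metric dist_real_def by blast
    qed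
    have "eventually (\<lambda>y. y \<in> \<Omega>) (nhds z)" using S by (simp add: eventually_nhds_in_open)
    then have "eventually (\<lambda>y. y \<in> \<Omega> \<and> \<bar>D b b y - D b b z\<bar> < \<eta> \<and> \<bar>D b c y - D b c z\<bar> < \<eta>
        \<and> \<bar>D c b y - D c b z\<bar> < \<eta> \<and> \<bar>D c c y - D c c z\<bar> < \<eta>) (nhds z)"
      using ev[of b b] ev[of b c] ev[of c b] ev[of c c] by eventually_elim auto
    then obtain \<delta> where \<delta>: "\<delta> > 0" "\<And>y. dist y z < \<delta> \<Longrightarrow> y \<in> \<Omega> \<and> \<bar>D b b y - D b b z\<bar> < \<eta> \<and> \<bar>D b c y - D b c z\<bar> < \<eta>
        \<and> \<bar>D c b y - D c b z\<bar> < \<eta> \<and> \<bar>D c c y - D c c z\<bar> < \<eta>"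
      unfolding eventually_nhds_metric by blast
    define r where "r = \<delta> / (2 * (norm b + norm c + 1))"
    have r: "0 < r" using \<delta>(1) by (simp add: r_def add_nonneg_pos)
    have near: "dist (z + t *\<^sub>R w \<theta>) z < \<delta>" if "0 \<le> t" "t \<le> r" for t \<theta>
    proof -
      have "norm (w \<theta>) \<le> \<bar>cos \<theta>\<bar> * norm b + \<bar>sin \<theta>\<bar> * norm c"
        unfolding w_def by (rule norm_triangle_le) simp
      also have "\<dots> \<le> 1 * norm b + 1 * norm c" by (intro add_mono mult_right_mono) auto
      finally have "norm (w \<theta>) \<le> norm b + norm c + 1" by simp
      then have "dist (z + t *\<^sub>R w \<theta>) z \<le> r * (norm b + norm c + 1)"
        using that by (simp add: dist_norm mult_mono)
      also have "\<dots> = \<delta> / 2" using add_nonneg_pos[of "norm b + norm c" 1] by (simp add: r_def field_simps)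
      finally show ?thesis using \<delta>(1) by simp
    qed
    have upper: "u (z + r *\<^sub>R w \<theta>) \<le> u z + r * (cos \<theta> * dd b u z + sin \<theta> * dd c u z) + r\<^sup>2 / 2 * (Q \<theta> z + 4 * \<eta>)" for \<theta>
    proof -
      obtain t where t: "0 < t" "t < r" "u (z + r *\<^sub>R w \<theta>) = u z + r * dd (w \<theta>) u z + r\<^sup>2 / 2 * dd (w \<theta>) (dd (w \<theta>) u) (z + t *\<^sub>R w \<theta>)"
        using second_order_taylor[OF S(2) r, of z "w \<theta>"] near \<delta>(2) by blast
      define y where "y = z + t *\<^sub>R w \<theta>"
      have y: "y \<in> \<Omega>" "\<bar>D b b y - D b b z\<bar> < \<eta>" "\<bar>D b c y - D b c z\<bar> < \<eta>" "\<bar>D c b y - D c b z\<bar> < \<eta>" "\<bar>D c c y - D c c z\<bar> < \<eta>"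
        using \<delta>(2)[OF near[of t \<theta>]] t by (auto simp: y_def)
      have le: "a * (A - B) \<le> \<eta>" if "\<bar>a\<bar> \<le> 1" "\<bar>A - B\<bar> < \<eta>" for a A B
      proof -
        have "a * (A - B) \<le> \<bar>a\<bar> * \<bar>A - B\<bar>" using abs_ge_self[of "a * (A - B)"] by (simp add: abs_mult)
        also have "\<dots> \<le> 1 * \<eta>" using that by (intro mult_mono) auto
        finally show ?thesis by simp
      qed
      have c1: "\<bar>cos \<theta> * cos \<theta>\<bar> \<le> 1" "\<bar>cos \<theta> * sin \<theta>\<bar> \<le> 1" "\<bar>sin \<theta> * cos \<theta>\<bar> \<le> 1" "\<bar>sin \<theta> * sin \<theta>\<bar> \<le> 1"
        unfolding abs_mult by (intro mult_le_one abs_cos_le_one abs_sin_le_one abs_ge_zero)+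
      have "Q \<theta> y - Q \<theta> z \<le> 4 * \<eta>"
        using le[OF c1(1) y(2)] le[OF c1(2) y(3)] le[OF c1(3) y(4)] le[OF c1(4) y(5)]
        by (simp add: Q_def algebra_simps)
      then have "r\<^sup>2 / 2 * Q \<theta> y \<le> r\<^sup>2 / 2 * (Q \<theta> z + 4 * \<eta>)" by (intro mult_left_mono) auto
      moreover have "dd (w \<theta>) u z = cos \<theta> * dd b u z + sin \<theta> * dd c u z"
        using dd_lincomb[OF smooth_on_imp_differentiable[OF S(2,3)]] by (simp add: w_def)
      ultimately show ?thesis using t(3) DQ[OF y(1)] by (simp add: y_def)
    qed
    \<comment> \<open>A primitive in \<open>\<theta>\<close> of the upper bound. Over the circle it
      increases by 2 pi u(z) plus r^2 pi / 2 times \<open>D b b z + D c c z + 8 * \<eta>\<close>.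
      Four second derivatives, each off by less than \<open>\<eta>\<close>, give the
      \<open>4 * \<eta>\<close> in the integrand.\<close>
    define G where "G \<theta> = \<theta> * u z + r * (sin \<theta> * dd b u z - cos \<theta> * dd c u z) + r\<^sup>2 / 2 *
       ((\<theta> + sin \<theta> * cos \<theta>) / 2 * D b b z + (sin \<theta>)\<^sup>2 / 2 * (D b c z + D c b z) + (\<theta> - sin \<theta> * cos \<theta>) / 2 * D c c z + 4 * \<eta> * \<theta>)" for \<theta>
    have "(G has_real_derivative u z + r * (cos \<theta> * dd b u z + sin \<theta> * dd c u z) + r\<^sup>2 / 2 * (Q \<theta> z + 4 * \<eta>)) (at \<theta>)" for \<theta>
    proof -
      have e: "(sin \<theta>)\<^sup>2 = 1 - (cos \<theta>)\<^sup>2" by (simp add: sin_squared_eq)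
      show ?thesis unfolding G_def Q_def
        by (rule derivative_eq_intros refl | simp)+ (simp add: e algebra_simps power2_eq_square[symmetric], simp add: power2_eq_square e algebra_simps, simp add: field_simps)
    qed
    then have "((\<lambda>\<theta>. u z + r * (cos \<theta> * dd b u z + sin \<theta> * dd c u z) + r\<^sup>2 / 2 * (Q \<theta> z + 4 * \<eta>)) has_integral (G (2 * pi) - G 0)) {0..2*pi}"
      by (intro fundamental_theorem_of_calculus)
        (auto simp: has_real_derivative_iff_has_vector_derivative[symmetric] intro: has_field_derivative_at_within)
    moreover have "disc_in \<Omega> z (of_real r *s b)"
      unfolding disc_in_def
    proof (intro allI impI)
      fix \<zeta> :: complex assume z1: "cmod \<zeta> \<le> 1"
      have "\<zeta> *s (of_real r *s b) = cis (Arg \<zeta>) *s (of_real (r * cmod \<zeta>) *s b)"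
        using rcis_cmod_Arg[of \<zeta>] by (simp add: rcis_def Finite_Cartesian_Product.vec_eq_iff mult_ac)
      also have "\<dots> = (r * cmod \<zeta>) *\<^sub>R w (Arg \<zeta>)" by (rule cis_w)
      finally show "z + \<zeta> *s (of_real r *s b) \<in> \<Omega>"
        using \<delta>(2)[OF near[of "r * cmod \<zeta>" "Arg \<zeta>"]] r z1 by (simp add: mult_left_le)
    qed
    then have int: "(\<lambda>\<theta>. u (z + r *\<^sub>R w \<theta>)) integrable_on {0..2*pi}"
      "2 * pi * u z \<le> integral {0..2*pi} (\<lambda>\<theta>. u (z + r *\<^sub>R w \<theta>))"
      using psh unfolding psh_real_def cis_w[symmetric] by blast+
    ultimately have "integral {0..2*pi} (\<lambda>\<theta>. u (z + r *\<^sub>R w \<theta>)) \<le> G (2 * pi) - G 0"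
      using upper by (intro has_integral_le[OF integrable_integral]) auto
    then have "0 \<le> r\<^sup>2 / 2 * (pi * (D b b z + D c c z + 8 * \<eta>))"
      using int(2) by (simp add: G_def algebra_simps)
    then show ?thesis using r pi_gt_zero by (auto simp: zero_le_mult_iff)
  qed
  have "0 \<le> D b b z + D c c z + e" if "e > 0" for e using main[of "e / 8"] that by simp
  then have "0 \<le> D b b z + D c c z" by (rule field_le_epsilon)
  moreover have "(\<lambda>j. b $ j) = x" by (simp add: b_def)
  ultimately show "0 \<le> Re (herm_form (levi u z) x)"
    using Re_herm_form_levi[OF S, of b] by (simp add: D_def c_def)
qed

section \<open>The pairing of matrix fields\<close>

text \<open>Coefficients of the product of the (1,1)-forms \<open>i M\<close> and \<open>i N\<close> with the \<open>q\<close>-th power of the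
  Kaehler form.\<close>

definition dbl_wedge :: "nat \<Rightarrow> ('n::{finite,linorder} \<Rightarrow> 'n \<Rightarrow> complex) \<Rightarrow> ('n \<Rightarrow> 'n \<Rightarrow> complex) \<Rightarrow> 'n cform" where
  "dbl_wedge q M N = (\<lambda>I J. \<i> * wedge11 (Suc q) M (\<lambda>I J. \<i> * wedge11 q N (base_form q) I J) I J)"

lemma dbl_wedge_eq: "dbl_wedge q M N I J = - wedge11 (Suc q) M (wedge11 q N (base_form q)) I J"
  by (simp add: dbl_wedge_def wedge11_cmult_right)

lemma dbl_wedge_commute: "dbl_wedge q (\<lambda>j k. c * M j k) N = dbl_wedge q (\<lambda>j k. c * N j k) M"
  using wedge11_commute[of q M N "base_form q"] by (intro ext) (simp add: dbl_wedge_eq wedge11_cmult_left)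

lemma pos_cone_dbl_wedge: "psd M \<Longrightarrow> psd N \<Longrightarrow> pos_cone (Suc (Suc q)) (dbl_wedge q M N)"
  unfolding dbl_wedge_def by (intro pos_cone_wedge11 pos_cone_base)

lemma dbl_wedge_add_left:
  "dbl_wedge q (\<lambda>j k. M j k + M' j k) N I J = dbl_wedge q M N I J + dbl_wedge q M' N I J"
  by (simp add: dbl_wedge_eq wedge11_add_left)

lemma dbl_wedge_cmult_left: "dbl_wedge q (\<lambda>j k. c * M j k) N I J = c * dbl_wedge q M N I J"
  by (simp add: dbl_wedge_eq wedge11_cmult_left)

context pluriharmonic_current_on
begin

text \<open>The integral against \<open>T\<close> of iM wedge iN wedge the \<open>q\<close>-th power
  of the Kaehler form. In the rules below \<open>M\<close> carries the compact support, while
  \<open>N\<close> is continuous on \<open>\<Omega>\<close>.\<close>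

definition pairing :: "(complex^('n::{finite,linorder}) \<Rightarrow> 'n \<Rightarrow> 'n \<Rightarrow> complex) \<Rightarrow> (complex^('n::{finite,linorder}) \<Rightarrow> 'n \<Rightarrow> 'n \<Rightarrow> complex) \<Rightarrow> real" where
  "pairing M N = Re (T (\<lambda>I J z. dbl_wedge q (M z) (N z) I J))"

lemma cc_form_dbl_wedge:
  assumes "\<And>j k. cc_fun \<Omega> (\<lambda>z. M z j k)" "\<And>j k. continuous_on \<Omega> (\<lambda>z. N z j k)"
  shows "cc_form p \<Omega> (\<lambda>I J z. dbl_wedge q (M z) (N z) I J)"
proof (rule cc_formI)
  have N: "continuous_on \<Omega> (\<lambda>z. wedge11 q (N z) (base_form q) I J)" for I J
    unfolding wedge11_def
    by (cases "card I = Suc q \<and> card J = Suc q") (auto intro!: continuous_intros assms)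
  show "cc_fun \<Omega> (\<lambda>z. dbl_wedge q (M z) (N z) I J)" for I J
  proof (cases "card I = Suc (Suc q) \<and> card J = Suc (Suc q)")
    case True
    have "cc_fun \<Omega> (\<lambda>z. - 1 * (\<Sum>j\<in>I. \<Sum>k\<in>J. ((-1) ^ Suc q * sgn_ins j (I - {j}) * sgn_ins k (J - {k})) *
        (M z j k * wedge11 q (N z) (base_form q) (I - {j}) (J - {k}))))"
      by (intro cc_fun_cmult cc_fun_sum cc_fun_mult_continuous[OF open_domain] assms N)
    then show ?thesis using True by (simp add: dbl_wedge_eq wedge11_def[of "Suc q"])
  next
    case False
    then show ?thesis by (simp add: dbl_wedge_eq wedge11_eq_0 cc_fun_zero)
  qed
  show "dbl_wedge q (M z) (N z) I J = 0" if "\<not> (card I = p \<and> card J = p)" for I J z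
    using that by (simp add: dbl_wedge_eq wedge11_eq_0 p_eq)
qed

lemma pairing_add:
  assumes "\<And>j k. cc_fun \<Omega> (\<lambda>z. M z j k)" "\<And>j k. cc_fun \<Omega> (\<lambda>z. M' z j k)" "\<And>j k. continuous_on \<Omega> (\<lambda>z. N z j k)"
  shows "pairing (\<lambda>z j k. M z j k + M' z j k) N = pairing M N + pairing M' N"
  using T_add[OF cc_form_dbl_wedge[OF assms(1,3)] cc_form_dbl_wedge[OF assms(2,3)]]
  by (simp add: pairing_def dbl_wedge_add_left)

lemma pairing_cmult:
  assumes "\<And>j k. cc_fun \<Omega> (\<lambda>z. M z j k)" "\<And>j k. continuous_on \<Omega> (\<lambda>z. N z j k)"
  shows "pairing (\<lambda>z j k. of_real c * M z j k) N = c * pairing M N"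
  using T_cmult[OF cc_form_dbl_wedge[OF assms], of "of_real c"]
  by (simp add: pairing_def dbl_wedge_cmult_left)

lemma pairing_nonneg:
  assumes "\<And>j k. cc_fun \<Omega> (\<lambda>z. M z j k)" "\<And>j k. continuous_on \<Omega> (\<lambda>z. N z j k)"
    "\<And>z. z \<in> \<Omega> \<Longrightarrow> psd (M z)" "\<And>z. z \<in> \<Omega> \<Longrightarrow> psd (N z)"
  shows "0 \<le> pairing M N"
proof -
  have "pos_cone p (dbl_wedge q (M z) (N z))" for z
  proof (cases "z \<in> \<Omega>")
    case True then show ?thesis unfolding p_eq by (intro pos_cone_dbl_wedge assms(3,4))
  next
    case False
    then have "M z = (\<lambda>j k. 0)" using cc_fun_eq_0[OF assms(1)] by (intro ext) simp
    then have "dbl_wedge q (M z) (N z) = (\<lambda>I J. 0)" by (intro ext) (simp add: dbl_wedge_eq)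
    then show ?thesis using pos_cone.zero by simp
  qed
  then show ?thesis unfolding pairing_def using T_pos[OF cc_form_dbl_wedge[OF assms(1,2)]] by simp
qed

text \<open>(1,1)-forms commute, so a scalar weight moves from one factor to the other. This
  identifies the quantity bounded in one test with the one needed in the next.\<close>

lemma pairing_commute:
  "pairing (\<lambda>z j k. of_real (f z) * M z j k) N = pairing (\<lambda>z j k. of_real (f z) * N z j k) M"
  unfolding pairing_def by (subst dbl_wedge_commute) (rule refl)

lemma pairing_levi_levi:
  assumes "smooth_on UNIV u" "compact L" "L \<subseteq> \<Omega>" "\<And>z. z \<notin> L \<Longrightarrow> u z = 0" "smooth_on \<Omega> v"
  shows "pairing (levi u) (levi v) = 0"
proof -
  have "open (- L)" using assms(2) by (simp add: open_Compl compact_imp_closed)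
  then have "levi u z j k = 0" if "z \<notin> L" for z j k
    using levi_cong[of "- L" z u "\<lambda>_. 0"] assms(4) that by simp
  then have "cc_fun \<Omega> (\<lambda>z. levi u z j k)" for j k
    using assms(2,3) smooth_on_imp_continuous_on[OF smooth_on_levi[OF open_UNIV assms(1)]]
    unfolding cc_fun_def by blast
  then have "cc_form p \<Omega> (\<lambda>I J z. dbl_wedge q (levi u z) (levi v z) I J)"
    by (intro cc_form_dbl_wedge smooth_on_imp_continuous_on smooth_on_levi open_domain assms(5))
  from T_cmult[OF this, of "-1"] show ?thesis
    using T_levi_levi[OF assms, of "base_form q"] by (simp add: pairing_def dbl_wedge_eq)
qed

lemma mass_eq_pairing: "mass w = pairing (\<lambda>z j k. of_real (w z) * id_mat j k) (\<lambda>z. id_mat)"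
  unfolding mass_def pairing_def dbl_wedge_cmult_left by (simp add: dbl_wedge_def p_eq)

end

section \<open>The uniform estimate\<close>

text \<open>As \<open>s \<le> 2\<close> and \<open>1 \<le> G \<le> A\<close>, the three terms are at
  most 1, 2 and 4 times n B A^2 X. They stand for all terms in the Levi form of
  \<open>F * G powr s\<close> except the one containing the Levi form of \<open>G\<close>.\<close>

lemma boundary_scalar_bound:
  fixes G A s F l g2 c n B X :: real
  assumes G: "1 \<le> G" "G \<le> A" and s: "0 \<le> s" "s \<le> 2" and F: "\<bar>F\<bar> \<le> B" and X: "0 \<le> X" "0 \<le> n"
    and l: "\<bar>l\<bar> \<le> n * B * X" and g2: "0 \<le> g2" "g2 \<le> n * A\<^sup>2 * X" and c: "\<bar>c\<bar> \<le> n * A * B * X"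
  shows "\<bar>G powr s * l + F * s * (s - 1) * G powr (s - 2) * g2 + 2 * s * G powr (s - 1) * c\<bar> \<le> 7 * n * B * A\<^sup>2 * X"
proof -
  have B: "0 \<le> B" using F by linarith
  have A: "1 \<le> A" using G by linarith
  have p0: "G powr s \<le> A\<^sup>2"
  proof -
    have "G powr s \<le> G powr 2" using G s by (intro powr_mono) auto
    also have "\<dots> \<le> A\<^sup>2" using G by (simp add: powr_numeral power_mono)
    finally show ?thesis .
  qed
  have p1: "G powr (s - 1) \<le> A"
  proof -
    have "G powr (s - 1) \<le> G powr 1" using G s by (intro powr_mono) auto
    then show ?thesis using G by simp
  qed
  have p2: "G powr (s - 2) \<le> 1" using G s powr_mono[of "s - 2" 0 G] by simp
  have s1: "\<bar>s * (s - 1)\<bar> \<le> 2 * 1" unfolding abs_mult using s by (intro mult_mono) auto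
  have "\<bar>G powr s * l\<bar> \<le> A\<^sup>2 * (n * B * X)"
    unfolding abs_mult using p0 l by (intro mult_mono) auto
  moreover have "\<bar>F * s * (s - 1) * G powr (s - 2) * g2\<bar> \<le> B * 2 * 1 * (n * A\<^sup>2 * X)"
  proof -
    have "\<bar>F * s * (s - 1) * G powr (s - 2) * g2\<bar> = \<bar>F\<bar> * \<bar>s * (s - 1)\<bar> * G powr (s - 2) * g2"
      using g2 by (simp add: abs_mult)
    also have "\<dots> \<le> B * 2 * 1 * (n * A\<^sup>2 * X)"
      using F s1 p2 g2 B X by (intro mult_mono) auto
    finally show ?thesis .
  qed
  moreover have "\<bar>2 * s * G powr (s - 1) * c\<bar> \<le> 4 * A * (n * A * B * X)"
  proof -
    have "\<bar>2 * s * G powr (s - 1) * c\<bar> = (2 * s) * G powr (s - 1) * \<bar>c\<bar>" using s by (simp add: abs_mult)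
    also have "\<dots> \<le> 4 * A * (n * A * B * X)" using s p1 c A by (intro mult_mono) auto
    finally show ?thesis .
  qed
  ultimately have "\<bar>G powr s * l + F * s * (s - 1) * G powr (s - 2) * g2 + 2 * s * G powr (s - 1) * c\<bar>
      \<le> A\<^sup>2 * (n * B * X) + B * 2 * 1 * (n * A\<^sup>2 * X) + 4 * A * (n * A * B * X)" by linarith
  also have "\<dots> = 7 * n * B * A\<^sup>2 * X" by (simp add: algebra_simps power2_eq_square)
  finally show ?thesis .
qed

text \<open>Weighted arithmetic-geometric mean, from the square of G |h| - 2 R s |g|. The weight is
  chosen so that only half of \<open>G powr s * X\<close> is used up; the other half is the gain of
  the tests.\<close>

lemma absorb_cross_term:
  fixes G s R X :: real and h g :: complex
  assumes G: "0 < G" and s: "0 \<le> s" and R: "0 < R" and h: "(cmod h)\<^sup>2 \<le> R * X"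
  shows "\<bar>2 * s * G powr (s - 1) * Re (h * cnj g)\<bar> \<le> G powr s * X / 2 + 2 * R * s\<^sup>2 * G powr (s - 2) * (cmod g)\<^sup>2"
proof -
  have p: "G powr (s - 1) = G powr (s - 2) * G" "G powr s = G powr (s - 2) * G\<^sup>2"
    using G powr_add[of G "s - 2" 1] powr_add[of G "s - 2" 2] by (simp_all add: powr_numeral)
  have "0 \<le> (G * cmod h - 2 * R * s * cmod g)\<^sup>2" by simp
  then have "4 * R * s * G * cmod h * cmod g \<le> G\<^sup>2 * (cmod h)\<^sup>2 + 4 * R\<^sup>2 * s\<^sup>2 * (cmod g)\<^sup>2"
    by (simp add: power2_eq_square algebra_simps)
  also have "\<dots> \<le> G\<^sup>2 * (R * X) + 4 * R\<^sup>2 * s\<^sup>2 * (cmod g)\<^sup>2" using h by (intro add_right_mono mult_left_mono) auto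
  finally have "2 * R * (2 * s * G * cmod h * cmod g) \<le> 2 * R * (G\<^sup>2 * X / 2 + 2 * R * s\<^sup>2 * (cmod g)\<^sup>2)"
    by (simp add: power2_eq_square algebra_simps)
  then have 1: "2 * s * G * cmod h * cmod g \<le> G\<^sup>2 * X / 2 + 2 * R * s\<^sup>2 * (cmod g)\<^sup>2"
    using R by (subst (asm) mult_le_cancel_left_pos) auto
  have "\<bar>Re (h * cnj g)\<bar> \<le> cmod h * cmod g" using abs_Re_le_cmod[of "h * cnj g"] by (simp add: norm_mult)
  then have "\<bar>2 * s * G powr (s - 1) * Re (h * cnj g)\<bar> \<le> 2 * s * G powr (s - 1) * (cmod h * cmod g)"
    using s by (simp add: abs_mult mult_left_mono)
  also have "\<dots> = G powr (s - 2) * (2 * s * G * cmod h * cmod g)" unfolding p by (simp add: mult_ac)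
  also have "\<dots> \<le> G powr (s - 2) * (G\<^sup>2 * X / 2 + 2 * R * s\<^sup>2 * (cmod g)\<^sup>2)"
    using 1 by (intro mult_left_mono) auto
  finally show ?thesis unfolding p by (simp add: algebra_simps)
qed

lemma cmod_sum_mult_le:
  fixes a x :: "'n::finite \<Rightarrow> complex"
  shows "(cmod (\<Sum>j\<in>UNIV. a j * x j))\<^sup>2 \<le> (\<Sum>l\<in>UNIV. (cmod (a l))\<^sup>2) * (\<Sum>j\<in>UNIV. (cmod (x j))\<^sup>2)"
  using psdD(2)[OF psd_id_minus_rank1[of a], of x]
  unfolding herm_form_diff herm_form_cmult herm_form_rank1 herm_form_id by simp

lemma cmod_sum_mult_le_card:
  fixes a x :: "'n::finite \<Rightarrow> complex" and A :: real
  assumes "\<And>j. cmod (a j) \<le> A"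
  shows "(cmod (\<Sum>j\<in>UNIV. a j * x j))\<^sup>2 \<le> CARD('n) * A\<^sup>2 * (\<Sum>j\<in>UNIV. (cmod (x j))\<^sup>2)"
proof -
  have "(\<Sum>l\<in>UNIV. (cmod (a l))\<^sup>2) \<le> (\<Sum>l\<in>(UNIV::'n set). A\<^sup>2)"
    using assms by (intro sum_mono power_mono) auto
  then show ?thesis
    by (intro order_trans[OF cmod_sum_mult_le] mult_right_mono) (auto intro: sum_nonneg)
qed

lemma cmod_herm_form_le:
  fixes M :: "'n::finite \<Rightarrow> 'n \<Rightarrow> complex" and B :: real
  assumes "\<And>j k. cmod (M j k) \<le> B"
  shows "cmod (herm_form M x) \<le> CARD('n) * B * (\<Sum>j\<in>UNIV. (cmod (x j))\<^sup>2)"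
proof -
  have B: "0 \<le> B" using assms norm_ge_zero order_trans by blast
  have "cmod (herm_form M x) \<le> (\<Sum>j\<in>UNIV. \<Sum>k\<in>UNIV. cmod (M j k * (x j * cnj (x k))))"
    unfolding herm_form_def by (rule order_trans[OF norm_sum], rule sum_mono, rule norm_sum)
  also have "\<dots> \<le> (\<Sum>j\<in>UNIV. \<Sum>k\<in>(UNIV::'n set). B * (((cmod (x j))\<^sup>2 + (cmod (x k))\<^sup>2) / 2))"
  proof (intro sum_mono)
    fix j k
    have "cmod (x j) * cmod (x k) \<le> ((cmod (x j))\<^sup>2 + (cmod (x k))\<^sup>2) / 2"
      using sum_squares_bound[of "cmod (x j)" "cmod (x k)"] by simp
    then show "cmod (M j k * (x j * cnj (x k))) \<le> B * (((cmod (x j))\<^sup>2 + (cmod (x k))\<^sup>2) / 2)"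
      unfolding norm_mult complex_mod_cnj using assms B by (intro mult_mono) auto
  qed
  also have "\<dots> = CARD('n) * B * (\<Sum>j\<in>UNIV. (cmod (x j))\<^sup>2)"
    by (simp add: sum_distrib_left[symmetric] sum_divide_distrib[symmetric] sum.distrib field_simps)
  finally show ?thesis .
qed

lemma Re_herm_form_levi_mult_powr:
  assumes "open S" "smooth_on S F" "smooth_on S G" "z \<in> S" and "\<And>y. y \<in> S \<Longrightarrow> 0 < G y"
  shows "Re (herm_form (levi (\<lambda>z. F z * G z powr s) z) x) = G z powr s * Re (herm_form (levi F z) x)
    + F z * s * G z powr (s - 1) * Re (herm_form (levi G z) x)
    + F z * s * (s - 1) * G z powr (s - 2) * (cmod (\<Sum>j\<in>UNIV. dz G z j * x j))\<^sup>2
    + 2 * s * G z powr (s - 1) * Re ((\<Sum>j\<in>UNIV. dz F z j * x j) * cnj (\<Sum>j\<in>UNIV. dz G z j * x j))"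
proof -
  have "levi (\<lambda>z. F z * G z powr s) z = (\<lambda>j k. of_real (G z powr s) * levi F z j k
    + of_real (F z * s * G z powr (s - 1)) * levi G z j k
    + of_real (F z * s * (s - 1) * G z powr (s - 2)) * (dz G z j * cnj (dz G z k))
    + of_real (s * G z powr (s - 1)) * (dz F z j * cnj (dz G z k) + dz G z j * cnj (dz F z k)))"
    using assms by (intro ext levi_mult_powr)
  then have "herm_form (levi (\<lambda>z. F z * G z powr s) z) x = of_real (G z powr s) * herm_form (levi F z) x
    + of_real (F z * s * G z powr (s - 1)) * herm_form (levi G z) x
    + of_real (F z * s * (s - 1) * G z powr (s - 2)) * of_real ((cmod (\<Sum>j\<in>UNIV. dz G z j * x j))\<^sup>2)
    + of_real (s * G z powr (s - 1)) * ((\<Sum>j\<in>UNIV. dz F z j * x j) * cnj (\<Sum>j\<in>UNIV. dz G z j * x j)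
       + (\<Sum>j\<in>UNIV. dz G z j * x j) * cnj (\<Sum>j\<in>UNIV. dz F z j * x j))"
    by (simp only: herm_form_add herm_form_cmult herm_form_rank1 herm_form_outer)
  moreover have "Re (of_real a * M + of_real b * N + of_real c * of_real r + of_real d * (h * cnj g + g * cnj h))
    = a * Re M + b * Re N + c * r + 2 * d * Re (h * cnj g)" for a b c d r M N h g
    by (simp add: algebra_simps)
  ultimately show ?thesis by (simp only: mult.assoc)
qed

lemma levi_uminus: "open S \<Longrightarrow> smooth_on S u \<Longrightarrow> z \<in> S \<Longrightarrow> levi (\<lambda>z. - u z) z j k = - levi u z j k"
  using levi_mult[of S "\<lambda>_. -1" u z j k, OF _ smooth_on_const] by simp

lemma dz_uminus: "u differentiable at z \<Longrightarrow> dz (\<lambda>z. - u z) z j = - dz u z j"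
  using wirt_cmult(1)[of "\<lambda>z. of_real (u z)" z j "-1"] differentiable_compose[of of_real u z UNIV]
  by (simp add: dz_def bounded_linear_imp_differentiable bounded_linear_of_real)

lemma levi_add_const:
  assumes "open S" "smooth_on S u" "z \<in> S"
  shows "levi (\<lambda>z. u z + c) z = levi u z" "dz (\<lambda>z. u z + c) z = dz u z"
proof -
  have s: "smooth_on S (\<lambda>z. of_real (u z) :: complex)" by (rule smooth_on_of_real[OF assms(1,2)])
  note d = smooth_on_imp_differentiable[OF s]
  have "wirt_dzbar k (\<lambda>z. of_real (u z + c)) y = wirt_dzbar k (\<lambda>z. of_real (u z)) y" if "y \<in> S" for k y
    using wirt_add(2)[OF d[OF that] differentiable_const, of k "of_real c"] by simp
  then show "levi (\<lambda>z. u z + c) z = levi u z"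
    unfolding levi_def by (intro ext wirt_dz_cong[OF assms(1,3)])
  show "dz (\<lambda>z. u z + c) z = dz u z"
    using wirt_add(1)[OF d[OF assms(3)] differentiable_const, of _ "of_real c"] by (intro ext) (simp add: dz_def)
qed

lemma smooth_bounded_on_compact:
  assumes "smooth_on UNIV f" "compact K" shows "\<exists>B. \<forall>z\<in>K. norm (f z) \<le> B"
proof -
  have "compact (f ` K)"
    by (rule compact_continuous_image[OF continuous_on_subset[OF smooth_on_imp_continuous_on[OF assms(1)] subset_UNIV] assms(2)])
  from compact_imp_bounded[OF this] show ?thesis unfolding bounded_iff by blast
qed

lemma C2_bound_on_compact:
  fixes F :: "complex^'n \<Rightarrow> real"
  assumes "smooth_on UNIV F" "compact K"
  obtains B where "0 \<le> B" "\<And>z. z \<in> K \<Longrightarrow> \<bar>F z\<bar> \<le> B" "\<And>z j. z \<in> K \<Longrightarrow> cmod (dz F z j) \<le> B"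
    "\<And>z j k. z \<in> K \<Longrightarrow> cmod (levi F z j k) \<le> B"
proof -
  note ex = smooth_bounded_on_compact[OF _ assms(2)]
  obtain B0 where B0: "\<forall>z\<in>K. norm (F z) \<le> B0" using ex[OF assms(1)] ..
  have "\<forall>j. \<exists>B. \<forall>z\<in>K. cmod (dz F z j) \<le> B"
    by (intro allI ex smooth_on_dz[OF open_UNIV assms(1)])
  then obtain B1 where B1: "\<And>j z. z \<in> K \<Longrightarrow> cmod (dz F z j) \<le> B1 j" by metis
  have "\<forall>j k. \<exists>B. \<forall>z\<in>K. cmod (levi F z j k) \<le> B"
    by (intro allI ex smooth_on_levi[OF open_UNIV assms(1)])
  then obtain B2 where B2: "\<And>j k z. z \<in> K \<Longrightarrow> cmod (levi F z j k) \<le> B2 j k" by metis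
  define B where "B = \<bar>B0\<bar> + (\<Sum>j\<in>UNIV. \<bar>B1 j\<bar>) + (\<Sum>j\<in>UNIV. \<Sum>k\<in>UNIV. \<bar>B2 j k\<bar>)"
  have nn: "0 \<le> (\<Sum>j\<in>UNIV. \<bar>B1 j\<bar>)" "0 \<le> (\<Sum>j\<in>UNIV. \<Sum>k\<in>UNIV. \<bar>B2 j k\<bar>)" by (intro sum_nonneg abs_ge_zero)+
  have m1: "\<bar>B1 j\<bar> \<le> (\<Sum>j\<in>UNIV. \<bar>B1 j\<bar>)" for j by (intro member_le_sum) auto
  have m2: "\<bar>B2 j k\<bar> \<le> (\<Sum>j\<in>UNIV. \<Sum>k\<in>UNIV. \<bar>B2 j k\<bar>)" for j k
  proof -
    have "\<bar>B2 j k\<bar> \<le> (\<Sum>k\<in>UNIV. \<bar>B2 j k\<bar>)" by (intro member_le_sum) auto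
    also have "\<dots> \<le> (\<Sum>j\<in>UNIV. \<Sum>k\<in>UNIV. \<bar>B2 j k\<bar>)" by (intro member_le_sum) (auto intro: sum_nonneg)
    finally show ?thesis .
  qed
  show ?thesis
  proof
    show "0 \<le> B" using nn by (simp add: B_def)
    show "\<bar>F z\<bar> \<le> B" if "z \<in> K" for z
    proof -
      have "\<bar>F z\<bar> \<le> B0" using B0 that by simp
      then show ?thesis using nn unfolding B_def by linarith
    qed
    show "cmod (dz F z j) \<le> B" if "z \<in> K" for z j
      using B1[OF that, of j] m1[of j] nn unfolding B_def by linarith
    show "cmod (levi F z j k) \<le> B" if "z \<in> K" for z j k
      using B2[OF that, of j k] m2[of j k] nn unfolding B_def by linarith
  qed
qed

lemma cc_fun_smooth:
  "smooth_on UNIV f \<Longrightarrow> compact L \<Longrightarrow> L \<subseteq> \<Omega> \<Longrightarrow> (\<And>z. z \<notin> L \<Longrightarrow> f z = 0) \<Longrightarrow> cc_fun \<Omega> f"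
  using smooth_on_imp_continuous_on unfolding cc_fun_def by blast

context pluriharmonic_current_on
begin

lemma pairing_id_lincomb:
  assumes "cc_fun \<Omega> w" "cc_fun \<Omega> w'" "smooth_on \<Omega> v"
  shows "pairing (\<lambda>z j k. of_real (a * w z + b * w' z) * id_mat j k) (levi v)
    = a * pairing (\<lambda>z j k. of_real (w z) * id_mat j k) (levi v) + b * pairing (\<lambda>z j k. of_real (w' z) * id_mat j k) (levi v)"
proof -
  have vc: "continuous_on \<Omega> (\<lambda>z. levi v z j k)" for j k
    by (rule smooth_on_imp_continuous_on[OF smooth_on_levi[OF open_domain assms(3)]])
  have cc: "cc_fun \<Omega> (\<lambda>z. of_real (f z) * id_mat j k)" if "cc_fun \<Omega> f" for f and j k :: 'n
    using cc_fun_cmult[OF cc_fun_of_real[OF that], of "id_mat j k"] by (simp only: mult.commute)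
  have "pairing (\<lambda>z j k. of_real a * (of_real (w z) * id_mat j k) + of_real b * (of_real (w' z) * id_mat j k)) (levi v)
    = a * pairing (\<lambda>z j k. of_real (w z) * id_mat j k) (levi v) + b * pairing (\<lambda>z j k. of_real (w' z) * id_mat j k) (levi v)"
    unfolding pairing_cmult[OF cc[OF assms(1)] vc, symmetric] pairing_cmult[OF cc[OF assms(2)] vc, symmetric]
    by (rule pairing_add[OF cc_fun_cmult[OF cc[OF assms(1)]] cc_fun_cmult[OF cc[OF assms(2)]] vc])
  then show ?thesis by (simp add: distrib_right mult.assoc)
qed

text \<open>The integration step shared by the three tests: the Levi forms of \<open>u\<close> and
  \<open>v\<close> pair to zero, so a pointwise inequality between Hermitian forms becomes an
  integral inequality from which \<open>u\<close> has disappeared. The sign of \<open>a\<close>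
  decides whether \<open>u\<close> or its negative is tested.\<close>

lemma pairing_nonneg_of_levi:
  assumes u: "smooth_on UNIV u" "compact L" "L \<subseteq> \<Omega>" "\<And>z. z \<notin> L \<Longrightarrow> u z = 0"
    and v: "smooth_on \<Omega> v" "\<And>z. z \<in> \<Omega> \<Longrightarrow> psd (levi v z)" and H: "smooth_on \<Omega> H"
    and \<kappa>: "cc_fun \<Omega> \<kappa>" and \<theta>: "cc_fun \<Omega> \<theta>"
    and ge: "\<And>z x. z \<in> \<Omega> \<Longrightarrow> 0 \<le> a * Re (herm_form (levi u z) x)
      + (\<kappa> z * (\<Sum>j\<in>UNIV. (cmod (x j))\<^sup>2) + \<theta> z * Re (herm_form (levi H z) x))"
  shows "0 \<le> pairing (\<lambda>z j k. of_real (\<kappa> z) * id_mat j k) (levi v)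
    + pairing (\<lambda>z j k. of_real (\<theta> z) * levi H z j k) (levi v)"
proof -
  have cont: "continuous_on \<Omega> (\<lambda>z. levi f z j k)" if "smooth_on \<Omega> f" for f j k
    by (rule smooth_on_imp_continuous_on[OF smooth_on_levi[OF open_domain that]])
  have "open (- L)" using u(2) by (simp add: open_Compl compact_imp_closed)
  then have "levi u z j k = 0" if "z \<notin> L" for z j k
    using levi_cong[of "- L" z u "\<lambda>_. 0"] u(4) that by simp
  then have M: "cc_fun \<Omega> (\<lambda>z. levi u z j k)" for j k
    by (rule cc_fun_smooth[OF smooth_on_levi[OF open_UNIV u(1)] u(2,3)])
  have N: "cc_fun \<Omega> (\<lambda>z. of_real (\<kappa> z) * id_mat j k)" for j k :: 'n
    using cc_fun_cmult[OF cc_fun_of_real[OF \<kappa>], of "id_mat j k"] by (simp only: mult.commute)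
  have N': "cc_fun \<Omega> (\<lambda>z. of_real (\<theta> z) * levi H z j k)" for j k
    by (rule cc_fun_mult_continuous[OF open_domain cc_fun_of_real[OF \<theta>] cont[OF H]])
  have "psd (\<lambda>j k. of_real a * levi u z j k + (of_real (\<kappa> z) * id_mat j k + of_real (\<theta> z) * levi H z j k))"
    if z: "z \<in> \<Omega>" for z
    unfolding psd_def herm_form_add herm_form_cmult herm_form_id
    using ge[OF z] by (auto intro!: Reals_add Reals_mult herm_form_levi_real[OF open_UNIV u(1)] herm_form_levi_real[OF open_domain H z])
  then have "0 \<le> pairing (\<lambda>z j k. of_real a * levi u z j k + (of_real (\<kappa> z) * id_mat j k + of_real (\<theta> z) * levi H z j k)) (levi v)"
    by (intro pairing_nonneg cc_fun_add cc_fun_cmult M N N' cont v)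
  also have "\<dots> = a * pairing (levi u) (levi v) + (pairing (\<lambda>z j k. of_real (\<kappa> z) * id_mat j k) (levi v)
      + pairing (\<lambda>z j k. of_real (\<theta> z) * levi H z j k) (levi v))"
    unfolding pairing_cmult[OF M cont[OF v(1)], symmetric] pairing_add[OF N N' cont[OF v(1)], symmetric]
    by (rule pairing_add[OF cc_fun_cmult[OF M] cc_fun_add[OF N N'] cont[OF v(1)]])
  also have "pairing (levi u) (levi v) = 0" by (rule pairing_levi_levi[OF u v(1)])
  finally show ?thesis by simp
qed

text \<open>The constant is fixed before \<open>H\<close>, which will be \<open>gs j\<close> minus a
  constant. Of the derivatives of \<open>H\<close> only a bound on the first ones enters, and only
  on \<open>L1 - V\<close>, the region of \<open>L1\<close> where the cutoffs may vary.\<close>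

lemma uniform_estimate:
  fixes \<eta> \<eta>1 :: "complex^('n::{finite,linorder}) \<Rightarrow> real"
  assumes e: "smooth_on UNIV \<eta>" "\<And>z. 0 \<le> \<eta> z" "\<And>z. \<eta> z \<le> 1" "open V" "\<And>z. z \<in> V \<Longrightarrow> \<eta> z = 1"
      "compact L" "V \<subseteq> L" "\<And>z. z \<notin> L \<Longrightarrow> \<eta> z = 0"
    and e1: "smooth_on UNIV \<eta>1" "\<And>z. 0 \<le> \<eta>1 z" "\<And>z. \<eta>1 z \<le> 1" "open V1" "\<And>z. z \<in> V1 \<Longrightarrow> \<eta>1 z = 1"
      "compact L1" "V1 \<subseteq> L1" "\<And>z. z \<notin> L1 \<Longrightarrow> \<eta>1 z = 0"
    and LV: "L \<subseteq> V1" "L1 \<subseteq> \<Omega>" and s: "0 < s" "s < 1"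
  shows "\<exists>C. \<forall>H. smooth_on \<Omega> H \<longrightarrow> (\<forall>z\<in>\<Omega>. psd (levi H z)) \<longrightarrow> (\<forall>z\<in>L1. H z \<le> -1) \<longrightarrow>
    (\<forall>z\<in>L1 - V. - A \<le> H z \<and> (\<forall>j. cmod (dz H z j) \<le> A)) \<longrightarrow>
    mass (\<lambda>z. \<eta> z * (- H z) powr (1 + s)) \<le> C"
proof -
  let ?n = "real CARD('n)"
  define N :: "complex^('n::{finite,linorder}) \<Rightarrow> real" where "N z = (norm z)\<^sup>2" for z
  have N: "smooth_on UNIV N" using smooth_on_norm_square[of 0] by (simp add: N_def[abs_def])
  have Nlevi: "levi N z = id_mat" and Ndz: "dz N z j = cnj (z $ j)" for z j
    unfolding N_def[abs_def] by (rule levi_norm_square dz_norm_square)+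
  obtain BN where BN: "0 \<le> BN" "\<And>z. z \<in> L1 \<Longrightarrow> \<bar>N z\<bar> \<le> BN"
    using C2_bound_on_compact[OF N e1(6)] by metis
  define R where "R = BN + 1"
  have R: "0 < R" and NR: "\<And>z. z \<in> L1 \<Longrightarrow> N z \<le> R" using BN by (auto simp: R_def abs_le_iff) (smt (verit))
  define r where "r = 1 + s"
  \<comment> \<open>Chosen so that \<open>(R - b2) * (s - 1) = 2 * R * s\<close> and, as
    \<open>r - 1 = s\<close>, \<open>b3 * (r - 1) = 2 * R * r\<close>. Since \<open>N\<close> lies
    between 0 and \<open>R\<close> on \<open>L1\<close>, the coefficient of the square of dG then
    covers the loss in \<open>absorb_cross_term\<close>.\<close>
  define b2 where "b2 = R + 2 * R * s / (1 - s)"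
  define b3 where "b3 = 2 * R * r / s"
  define F2 where "F2 z = \<eta> z * (N z + - b2)" for z
  define F3 where "F3 z = \<eta> z * (N z + b3)" for z
  have F2: "smooth_on UNIV F2" and F3: "smooth_on UNIV F3"
    unfolding F2_def[abs_def] F3_def[abs_def] by (intro smooth_on_mult smooth_on_add smooth_on_const e N open_UNIV)+
  have LL1: "L \<subseteq> L1" using LV e1(7) by blast
  obtain B1 where B1: "0 \<le> B1" "\<And>z. z \<in> L1 \<Longrightarrow> \<bar>\<eta>1 z\<bar> \<le> B1" "\<And>z j. z \<in> L1 \<Longrightarrow> cmod (dz \<eta>1 z j) \<le> B1"
    "\<And>z j k. z \<in> L1 \<Longrightarrow> cmod (levi \<eta>1 z j k) \<le> B1" by (rule C2_bound_on_compact[OF e1(1,6)]) (rule that)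
  obtain B2 where B2: "0 \<le> B2" "\<And>z. z \<in> L1 \<Longrightarrow> \<bar>F2 z\<bar> \<le> B2" "\<And>z j. z \<in> L1 \<Longrightarrow> cmod (dz F2 z j) \<le> B2"
    "\<And>z j k. z \<in> L1 \<Longrightarrow> cmod (levi F2 z j k) \<le> B2" by (rule C2_bound_on_compact[OF F2 e1(6)]) (rule that)
  obtain B3 where B3: "0 \<le> B3" "\<And>z. z \<in> L1 \<Longrightarrow> \<bar>F3 z\<bar> \<le> B3" "\<And>z j. z \<in> L1 \<Longrightarrow> cmod (dz F3 z j) \<le> B3"
    "\<And>z j k. z \<in> L1 \<Longrightarrow> cmod (levi F3 z j k) \<le> B3" by (rule C2_bound_on_compact[OF F3 e1(6)]) (rule that)
  define B where "B = B1 + B2 + B3"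
  \<comment> \<open>\<open>C0\<close> comes from \<open>boundary_scalar_bound\<close>. The
    additional \<open>A\<^sup>2\<close> in \<open>C1\<close> pays, on \<open>L1 - V\<close>, for the
    half of \<open>\<eta> z * G z powr t\<close> that the tests gain on \<open>V\<close>.\<close>
  define C0 where "C0 = 7 * ?n * B * A\<^sup>2"
  define C1 where "C1 = C0 + A\<^sup>2"
  have B: "0 \<le> B" using B1(1) B2(1) B3(1) by (simp add: B_def)
  have Bi: "B1 \<le> B" "B2 \<le> B" "B3 \<le> B" using B1(1) B2(1) B3(1) by (simp_all add: B_def)
  have bd1: "\<bar>\<eta>1 z\<bar> \<le> B" "cmod (dz \<eta>1 z j) \<le> B" "cmod (levi \<eta>1 z j k) \<le> B" if "z \<in> L1" for z j k
    using order_trans[OF B1(2)[OF that] Bi(1)] order_trans[OF B1(3)[OF that] Bi(1)] order_trans[OF B1(4)[OF that] Bi(1)] .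
  have bd2: "\<bar>F2 z\<bar> \<le> B" "cmod (dz F2 z j) \<le> B" "cmod (levi F2 z j k) \<le> B" if "z \<in> L1" for z j k
    using order_trans[OF B2(2)[OF that] Bi(2)] order_trans[OF B2(3)[OF that] Bi(2)] order_trans[OF B2(4)[OF that] Bi(2)] .
  have bd3: "\<bar>F3 z\<bar> \<le> B" "cmod (dz F3 z j) \<le> B" "cmod (levi F3 z j k) \<le> B" if "z \<in> L1" for z j k
    using order_trans[OF B3(2)[OF that] Bi(3)] order_trans[OF B3(3)[OF that] Bi(3)] order_trans[OF B3(4)[OF that] Bi(3)] .
  have C0: "0 \<le> C0" using B by (simp add: C0_def)
  have C1: "0 \<le> C1" using C0 by (simp add: C1_def)
  define X where "X x = (\<Sum>j\<in>UNIV. (cmod (x j))\<^sup>2)" for x :: "'n \<Rightarrow> complex"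
  have X: "0 \<le> X x" for x unfolding X_def by (intro sum_nonneg) simp
  \<comment> \<open>A third cutoff, equal to 1 on \<open>L1\<close>, dominates the boundary terms of
    the test with \<open>\<eta>1\<close>.\<close>
  obtain \<eta>2 :: "complex^('n::{finite,linorder}) \<Rightarrow> real" and V2 L2 where e2: "smooth_on UNIV \<eta>2" "\<And>z. 0 \<le> \<eta>2 z" "\<And>z. \<eta>2 z \<le> 1"
    "open V2" "L1 \<subseteq> V2" "\<And>z. z \<in> V2 \<Longrightarrow> \<eta>2 z = 1" "compact L2" "L2 \<subseteq> \<Omega>" "V2 \<subseteq> L2" "\<And>z. z \<notin> L2 \<Longrightarrow> \<eta>2 z = 0"
    by (rule smooth_cutoff[OF e1(6) open_domain LV(2)]) (rule that)
  have cc_eta1: "cc_fun \<Omega> \<eta>1" by (rule cc_fun_smooth[OF e1(1,6) LV(2) e1(8)])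
  have cc_eta2: "cc_fun \<Omega> \<eta>2" by (rule cc_fun_smooth[OF e2(1,7,8,10)])
  have L\<Omega>: "L \<subseteq> \<Omega>" using LL1 LV(2) by blast
  \<comment> \<open>\<open>D\<close> bounds \<open>r * (N z + b3)\<close>, the factor in front of
    the Levi form of \<open>H\<close> in the third test; \<open>c1\<close>, \<open>c2\<close> and
    \<open>c3\<close> are the outcomes of the three tests.\<close>
  define D where "D = r * (R + b3)"
  define c1 where "c1 = C0 * mass \<eta>2"
  define c2 where "c2 = 2 * (C1 * c1)"
  define c3 where "c3 = 2 * (D * c2 + C1 * mass \<eta>1)"
  have r1: "1 < r" "r < 2" using s by (auto simp: r_def)
  have b2: "R < b2" using R s by (simp add: b2_def)
  have b3: "0 < b3" using R s r1 by (simp add: b3_def)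
  have D: "0 \<le> D" using R b3 r1 by (simp add: D_def)
  show ?thesis
  proof (intro exI[of _ c3] allI impI)
    fix H
    assume H: "smooth_on \<Omega> H" and Hpsd: "\<forall>z\<in>\<Omega>. psd (levi H z)" and H1: "\<forall>z\<in>L1. H z \<le> -1"
      and HA: "\<forall>z\<in>L1 - V. - A \<le> H z \<and> (\<forall>j. cmod (dz H z j) \<le> A)"
    define G where "G z = - H z" for z
    have G: "smooth_on \<Omega> G"
      unfolding G_def[abs_def] using smooth_on_bounded_linear_comp[OF bounded_linear_minus[OF bounded_linear_ident] open_domain H] .
    have G1: "1 \<le> G z" if "z \<in> L1" for z using H1 that by (auto simp: G_def)
    \<comment> \<open>Powers of \<open>G\<close> are smooth where \<open>G\<close> is positive;
      \<open>S\<close> is an open set of such points containing \<open>L1\<close>, from which the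
      cutoffs extend by zero.\<close>
    define S where "S = \<Omega> \<inter> G -` {0<..}"
    have S: "open S" unfolding S_def
      by (rule continuous_open_preimage[OF smooth_on_imp_continuous_on[OF G] open_domain]) simp
    have L1S: "L1 \<subseteq> S" using G1 LV(2) by (force simp: S_def)
    have GS: "smooth_on S G" by (rule smooth_on_subset[OF G]) (auto simp: S_def)
    have Gpos: "0 < G z" if "z \<in> S" for z using that by (simp add: S_def)
    define \<pi> where "\<pi> z x = Re (herm_form (levi H z) x)" for z x
    have \<pi>: "0 \<le> \<pi> z x" if "z \<in> \<Omega>" for z x using psdD(2) Hpsd that by (auto simp: \<pi>_def)
    have Glevi: "Re (herm_form (levi G z) x) = - \<pi> z x" if "z \<in> \<Omega>" for z x
    proof -
      have "levi G z = (\<lambda>j k. (-1) * levi H z j k)"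
        unfolding G_def[abs_def] using levi_uminus[OF open_domain H that] by (intro ext) simp
      then show ?thesis by (simp only: herm_form_cmult \<pi>_def) simp
    qed
    have Gdz: "cmod (dz G z j) \<le> A" if "z \<in> L1 - V" for z j
      using HA that LV(2) dz_uminus[OF smooth_on_imp_differentiable[OF H]] by (auto simp: G_def[abs_def])
    have GA: "G z \<le> A" if "z \<in> L1 - V" for z
    proof -
      have "- A \<le> H z" using HA that by blast
      then show ?thesis by (simp add: G_def)
    qed
    define g where "g z x = (\<Sum>j\<in>UNIV. dz G z j * x j)" for z x
    define h where "h F z x = (\<Sum>j\<in>UNIV. dz F z j * x j)" for F z and x :: "'n \<Rightarrow> complex"
    define u where "u F t z = F z * G z powr t" for F t z
    have u_smooth: "smooth_on UNIV (u F t)" if "smooth_on UNIV F" "\<And>z. z \<notin> L1 \<Longrightarrow> F z = 0" for F t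
      unfolding u_def[abs_def]
      by (rule smooth_on_mult_cutoff[OF that(1) e1(6) L1S S that(2) smooth_on_powr[OF S GS Gpos]])
    have levi0: "levi (u F t) z = (\<lambda>j k. 0)" if "z \<notin> K" "compact K" "\<And>z. z \<notin> K \<Longrightarrow> F z = 0" for F t z K
    proof -
      have "open (- K)" using that(2) by (simp add: open_Compl compact_imp_closed)
      then have "levi (u F t) z = levi (\<lambda>_. 0) z" using that(1,3) by (intro levi_cong[of "- K"]) (auto simp: u_def)
      then show ?thesis by (intro ext) simp
    qed
    have val: "Re (herm_form (levi (u F t) z) x) = G z powr t * Re (herm_form (levi F z) x)
        - F z * t * G z powr (t - 1) * \<pi> z x
        + F z * t * (t - 1) * G z powr (t - 2) * (cmod (g z x))\<^sup>2
        + 2 * t * G z powr (t - 1) * Re (h F z x * cnj (g z x))"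
      if "smooth_on UNIV F" "z \<in> L1" for F t z x
      using Re_herm_form_levi_mult_powr[OF S smooth_on_subset[OF that(1)] GS subsetD[OF L1S that(2)] Gpos, of t x]
        Glevi[of z x] that(2) LV(2) by (auto simp: u_def[abs_def] g_def h_def)
    \<comment> \<open>Outside \<open>V\<close> every term is bounded except the one with
      \<open>\<pi>\<close>: second derivatives of \<open>H\<close> are uncontrolled, so that term is
      kept and its sign is used later.\<close>
    have boundary: "\<bar>Re (herm_form (levi (u F t) z) x) + F z * t * G z powr (t - 1) * \<pi> z x\<bar> \<le> C0 * X x"
      if F: "smooth_on UNIV F" "\<And>z. z \<in> L1 \<Longrightarrow> \<bar>F z\<bar> \<le> B" "\<And>z j. z \<in> L1 \<Longrightarrow> cmod (dz F z j) \<le> B"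
        "\<And>z j k. z \<in> L1 \<Longrightarrow> cmod (levi F z j k) \<le> B" and t: "0 \<le> t" "t \<le> 2" and z: "z \<in> L1 - V" for F t z x
    proof -
      have zL: "z \<in> L1" using z by simp
      have A: "1 \<le> A" using G1[OF zL] GA[OF z] by linarith
      have g2: "(cmod (g z x))\<^sup>2 \<le> ?n * A\<^sup>2 * X x"
        unfolding g_def X_def by (rule cmod_sum_mult_le_card[OF Gdz[OF z]])
      have h2: "(cmod (h F z x))\<^sup>2 \<le> ?n * B\<^sup>2 * X x"
        unfolding h_def X_def by (rule cmod_sum_mult_le_card[OF F(3)[OF zL]])
      have "(cmod (h F z x) * cmod (g z x))\<^sup>2 \<le> (?n * B\<^sup>2 * X x) * (?n * A\<^sup>2 * X x)"
        unfolding power_mult_distrib using g2 h2 X[of x] by (intro mult_mono) auto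
      also have "\<dots> = (?n * A * B * X x)\<^sup>2" by (simp add: power2_eq_square)
      finally have sq: "(cmod (h F z x) * cmod (g z x))\<^sup>2 \<le> (?n * A * B * X x)\<^sup>2" .
      have "0 \<le> ?n * A * B * X x" using A B X[of x] by (intro mult_nonneg_nonneg) linarith+
      from power2_le_imp_le[OF sq this] have c: "\<bar>Re (h F z x * cnj (g z x))\<bar> \<le> ?n * A * B * X x"
        using abs_Re_le_cmod[of "h F z x * cnj (g z x)"] by (simp add: norm_mult)
      have l: "\<bar>Re (herm_form (levi F z) x)\<bar> \<le> ?n * B * X x"
        unfolding X_def by (rule order_trans[OF abs_Re_le_cmod cmod_herm_form_le[OF F(4)[OF zL]]])
      have "\<bar>G z powr t * Re (herm_form (levi F z) x) + F z * t * (t - 1) * G z powr (t - 2) * (cmod (g z x))\<^sup>2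
          + 2 * t * G z powr (t - 1) * Re (h F z x * cnj (g z x))\<bar> \<le> C0 * X x"
        unfolding C0_def
        by (rule boundary_scalar_bound[OF G1[OF zL] GA[OF z] t F(2)[OF zL] X _ l _ g2 c]) auto
      then show ?thesis unfolding val[OF F(1) zL] by simp
    qed
    \<comment> \<open>On \<open>V\<close> the multiplier is \<open>N z + b\<close>, whose Levi form
      is the identity; half of the resulting \<open>G z powr t * X x\<close> is spent on the cross
      term.\<close>
    have interior: "Re (herm_form (levi (u F t) z) x) \<ge> G z powr t * X x / 2 - (N z + b) * t * G z powr (t - 1) * \<pi> z x
        + ((N z + b) * (t - 1) - 2 * R * t) * t * G z powr (t - 2) * (cmod (g z x))\<^sup>2"
      if F: "\<And>z. F z = \<eta> z * (N z + b)" and Fs: "smooth_on UNIV F" and t: "0 \<le> t" and z: "z \<in> V" for F b t z x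
    proof -
      have zL: "z \<in> L1" using z e(7) LL1 by blast
      have Fz: "F z = N z + b" using F e(5)[OF z] by simp
      have "levi F z = levi (\<lambda>z. N z + b) z" "dz F z = dz (\<lambda>z. N z + b) z"
        using F e(5) by (auto intro!: levi_cong[OF e(4) z] dz_cong[OF e(4) z])
      then have F': "levi F z = id_mat" "dz F z = dz N z" using levi_add_const[OF open_UNIV N UNIV_I] Nlevi by simp_all
      have l: "Re (herm_form (levi F z) x) = X x" unfolding F' herm_form_id X_def by simp
      have "(cmod (h F z x))\<^sup>2 \<le> (\<Sum>l\<in>UNIV. (cmod (cnj (z $ l)))\<^sup>2) * X x"
        unfolding h_def F' Ndz X_def by (rule cmod_sum_mult_le)
      also have "(\<Sum>l\<in>UNIV. (cmod (cnj (z $ l)))\<^sup>2) = N z"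
        by (simp add: N_def norm_vec_def L2_set_def sum_nonneg)
      also have "N z * X x \<le> R * X x" using NR[OF zL] X[of x] by (intro mult_right_mono) auto
      finally have h2: "(cmod (h F z x))\<^sup>2 \<le> R * X x" .
      have "0 < G z" using G1[OF zL] by simp
      from absorb_cross_term[OF this t R h2, of "g z x"] show ?thesis
        unfolding val[OF Fs zL] l Fz by (simp add: abs_le_iff power2_eq_square algebra_simps)
    qed
    have eta_powr_le: "1/2 * u \<eta> t z \<le> A\<^sup>2" if t: "0 \<le> t" "t \<le> 2" and z: "z \<in> L1 - V" for t z
    proof -
      have G: "1 \<le> G z" "G z \<le> A" using G1 GA[OF z] z by auto
      have "u \<eta> t z \<le> 1 * G z powr t" unfolding u_def using e(3)[of z] by (intro mult_right_mono) auto
      also have "\<dots> \<le> G z powr 2" using powr_mono[of t 2 "G z"] G t by simp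
      also have "\<dots> \<le> A\<^sup>2" using G by (simp add: powr_numeral power_mono)
      finally have "u \<eta> t z \<le> A\<^sup>2" .
      then show ?thesis using zero_le_power2[of A] by linarith
    qed
    have id_levi: "(\<lambda>z. id_mat) = levi N" by (rule ext) (simp add: Nlevi)
    have id_psd: "psd (levi N z)" for z by (simp add: Nlevi psd_id)
    have mass_N: "mass w = pairing (\<lambda>z j k. of_real (w z) * id_mat j k) (levi N)" for w
      unfolding mass_eq_pairing id_levi ..
    have u_cc: "cc_fun \<Omega> (u \<eta> t)" for t
      using e(8) LL1 by (intro cc_fun_smooth[OF u_smooth[OF e(1)] e(6) L\<Omega>]) (auto simp: u_def)
    have Nsm: "smooth_on \<Omega> N" by (rule smooth_on_subset[OF N]) simp
    have F2_0: "F2 z = 0" if "z \<notin> L" for z using e(8)[OF that] by (simp add: F2_def)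
    have F3_0: "F3 z = 0" if "z \<notin> L" for z using e(8)[OF that] by (simp add: F3_def)
    have F2_L1: "\<And>z. z \<notin> L1 \<Longrightarrow> F2 z = 0" and F3_L1: "\<And>z. z \<notin> L1 \<Longrightarrow> F3 z = 0" using F2_0 F3_0 LL1 by auto
    have us1: "smooth_on UNIV (u \<eta>1 1)" by (rule u_smooth[OF e1(1,8)])
    have us2: "smooth_on UNIV (u F2 s)" by (rule u_smooth[OF F2 F2_L1])
    have us3: "smooth_on UNIV (u F3 r)" by (rule u_smooth[OF F3 F3_L1])

    have H_id: "pairing (\<lambda>z j k. of_real (w z) * levi H z j k) (levi N) = pairing (\<lambda>z j k. of_real (w z) * id_mat j k) (levi H)" for w
      using pairing_commute[of w "levi H" "levi N"] by (simp only: Nlevi)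
    \<comment> \<open>The test is taken with \<open>a = -1\<close> because the Levi form of
      \<open>G\<close> is minus that of \<open>H\<close>: on \<open>V1\<close> the Levi form of
      \<open>u \<eta>1 1\<close> is \<open>- levi H\<close>, which cancels the term to be
      bounded.\<close>
    have E1: "pairing (\<lambda>z j k. of_real (\<eta>1 z) * levi H z j k) (levi N) \<le> c1"
    proof -
      have "0 \<le> pairing (\<lambda>z j k. of_real (C0 * \<eta>2 z + 0 * \<eta>1 z) * id_mat j k) (levi N)
          + pairing (\<lambda>z j k. of_real (- 1 * \<eta>1 z) * levi H z j k) (levi N)"
      proof (rule pairing_nonneg_of_levi[OF us1 e1(6) LV(2) _ Nsm id_psd H, where a = "-1"])
        show "u \<eta>1 1 z = 0" if "z \<notin> L1" for z using e1(8)[OF that] by (simp add: u_def)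
        show "cc_fun \<Omega> (\<lambda>z. C0 * \<eta>2 z + 0 * \<eta>1 z)" "cc_fun \<Omega> (\<lambda>z. - 1 * \<eta>1 z)"
          by (rule cc_fun_add[OF cc_fun_cmult[OF cc_eta2] cc_fun_cmult[OF cc_eta1]], rule cc_fun_cmult[OF cc_eta1])
        fix z x assume z: "z \<in> \<Omega>"
        have "0 \<le> - Re (herm_form (levi (u \<eta>1 1) z) x) - \<eta>1 z * \<pi> z x + C0 * \<eta>2 z * X x"
        proof (cases "z \<in> L1")
          case False
          then show ?thesis using levi0[where t = 1, OF False e1(6,8)] e1(8)[OF False] e2(2)[of z] C0 X[of x]
            by (simp add: herm_form_def)
        next
          case True
          then have e2z: "\<eta>2 z = 1" using e2(5,6) by blast
          show ?thesis
          proof (cases "z \<in> V1")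
            case zV: True
            have "levi \<eta>1 z = levi (\<lambda>_. 1) z" "dz \<eta>1 z = dz (\<lambda>_. 1) z"
              using e1(5) by (auto intro!: levi_cong[OF e1(4) zV] dz_cong[OF e1(4) zV])
            then have "herm_form (levi \<eta>1 z) x = 0" "h \<eta>1 z x = 0" by (simp_all add: herm_form_def h_def)
            then show ?thesis unfolding val[OF e1(1) True] e2z using e1(5)[OF zV] C0 X[of x] G1[OF True] by simp
          next
            case False
            then have zV: "z \<in> L1 - V" using True e(7) LV(1) by blast
            have "\<bar>Re (herm_form (levi (u \<eta>1 1) z) x) + \<eta>1 z * 1 * G z powr (1 - 1) * \<pi> z x\<bar> \<le> C0 * X x"
              by (rule boundary[OF e1(1) bd1 _ _ zV]) auto
            then show ?thesis using G1[OF True] by (simp add: e2z abs_le_iff)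
          qed
        qed
        then show "0 \<le> -1 * Re (herm_form (levi (u \<eta>1 1) z) x)
            + ((C0 * \<eta>2 z + 0 * \<eta>1 z) * (\<Sum>j\<in>UNIV. (cmod (x j))\<^sup>2) + - 1 * \<eta>1 z * Re (herm_form (levi H z) x))"
          by (simp add: \<pi>_def X_def)
      qed
      moreover have "pairing (\<lambda>z j k. of_real (- 1 * \<eta>1 z) * levi H z j k) (levi N)
          = - pairing (\<lambda>z j k. of_real (\<eta>1 z) * levi H z j k) (levi N)"
        using pairing_id_lincomb[OF cc_eta1 cc_eta1 H, of "-1" 0] unfolding H_id by simp
      ultimately show ?thesis
        unfolding pairing_id_lincomb[OF cc_eta2 cc_eta1 Nsm] c1_def by (simp add: mass_N)
    qed

    \<comment> \<open>Here the second factor is \<open>levi H\<close> itself. As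
      \<open>N - b2\<close> is negative on \<open>L1\<close>, the term with \<open>\<pi>\<close> is
      favourable there, and so is the square of dG left on \<open>V\<close> by
      \<open>interior\<close>. What remains against the gain is \<open>C1 * \<eta>1\<close>, whose
      pairing with \<open>levi H\<close> is bounded by \<open>E1\<close>.\<close>
    have E2: "pairing (\<lambda>z j k. of_real (u \<eta> s z) * levi H z j k) (levi N) \<le> c2"
    proof -
      have "0 \<le> pairing (\<lambda>z j k. of_real (C1 * \<eta>1 z + - (1/2) * u \<eta> s z) * id_mat j k) (levi H)
          + pairing (\<lambda>z j k. of_real 0 * levi H z j k) (levi H)"
      proof (rule pairing_nonneg_of_levi[OF us2 e(6) L\<Omega> _ H _ H _ cc_fun_zero, where a = 1])
        show "u F2 s z = 0" if "z \<notin> L" for z using F2_0[OF that] by (simp add: u_def)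
        show "psd (levi H z)" if "z \<in> \<Omega>" for z using Hpsd that by blast
        show "cc_fun \<Omega> (\<lambda>z. C1 * \<eta>1 z + - (1/2) * u \<eta> s z)"
          by (rule cc_fun_add[OF cc_fun_cmult[OF cc_eta1] cc_fun_cmult[OF u_cc]])
        fix z x assume z: "z \<in> \<Omega>"
        have "0 \<le> Re (herm_form (levi (u F2 s) z) x) - 1/2 * u \<eta> s z * X x + C1 * \<eta>1 z * X x"
        proof (cases "z \<in> L")
          case False
          then show ?thesis using levi0[where t = s, OF False e(6) F2_0] e(8)[OF False] e1(2)[of z] C1 X[of x]
            by (simp add: herm_form_def u_def)
        next
          case True
          then have zL: "z \<in> L1" using LL1 by blast
          have e1z: "\<eta>1 z = 1" using True LV(1) e1(5) by blast
          show ?thesis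
          proof (cases "z \<in> V")
            case zV: True
            have neg: "N z + - b2 \<le> R - b2" using NR[OF zL] by simp
            have "(R - b2) * (s - 1) = 2 * R * s" using s by (simp add: b2_def field_simps)
            moreover have "(R - b2) * (s - 1) \<le> (N z + - b2) * (s - 1)"
              using neg s by (intro mult_right_mono_neg) auto
            ultimately have "0 \<le> ((N z + - b2) * (s - 1) - 2 * R * s) * s * G z powr (s - 2) * (cmod (g z x))\<^sup>2"
              using s by simp
            moreover have "0 \<le> - ((N z + - b2) * s * G z powr (s - 1) * \<pi> z x)"
            proof -
              have "0 \<le> (- (N z + - b2)) * (s * G z powr (s - 1) * \<pi> z x)"
                using neg b2 s \<pi>[OF z, of x] by (intro mult_nonneg_nonneg) auto
              then show ?thesis by (simp only: mult.assoc mult_minus_left)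
            qed
            moreover have "0 \<le> C1 * X x" using C1 X[of x] by simp
            ultimately show ?thesis
              using interior[of F2 "- b2" s z x, OF F2_def F2 _ zV] s e(5)[OF zV] by (simp add: u_def e1z)
          next
            case False
            then have zV: "z \<in> L1 - V" using zL by blast
            have "\<bar>Re (herm_form (levi (u F2 s) z) x) + F2 z * s * G z powr (s - 1) * \<pi> z x\<bar> \<le> C0 * X x"
              by (rule boundary[OF F2 bd2 _ _ zV]) (use s in auto)
            moreover have "F2 z * s * G z powr (s - 1) * \<pi> z x \<le> 0"
            proof -
              have "F2 z \<le> 0" unfolding F2_def using e(2)[of z] NR[OF zL] b2 by (intro mult_nonneg_nonpos) auto
              then have "F2 z * (s * G z powr (s - 1) * \<pi> z x) \<le> 0"
                using s \<pi>[OF z, of x] by (intro mult_nonpos_nonneg) auto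
              then show ?thesis by (simp add: mult.assoc)
            qed
            moreover have "1/2 * u \<eta> s z * X x \<le> A\<^sup>2 * X x"
              using eta_powr_le[OF _ _ zV, of s] s X[of x] by (intro mult_right_mono) auto
            ultimately show ?thesis by (simp add: e1z C1_def algebra_simps)
          qed
        qed
        then show "0 \<le> 1 * Re (herm_form (levi (u F2 s) z) x)
            + ((C1 * \<eta>1 z + - (1/2) * u \<eta> s z) * (\<Sum>j\<in>UNIV. (cmod (x j))\<^sup>2) + 0 * Re (herm_form (levi H z) x))"
          by (simp add: X_def[symmetric] algebra_simps)
      qed
      moreover have "pairing (\<lambda>z j k. of_real 0 * levi H z j k) (levi H) = 0"
        by (simp add: pairing_def dbl_wedge_eq T_zero)
      ultimately show ?thesis
        using mult_left_mono[OF E1 C1] unfolding pairing_id_lincomb[OF cc_eta1 u_cc H] H_id c2_def by simp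
    qed

    \<comment> \<open>\<open>N + b3\<close> is positive, which is right for the square of dG as
      \<open>r > 1\<close> but makes the term with \<open>\<pi>\<close> negative. Because
      \<open>r - 1 = s\<close>, the weight of that term is at most \<open>D * u \<eta> s z\<close>,
      the quantity bounded by \<open>E2\<close>.\<close>
    have E3: "1/2 * mass (u \<eta> r) \<le> D * c2 + C1 * mass \<eta>1"
    proof -
      have "0 \<le> pairing (\<lambda>z j k. of_real (C1 * \<eta>1 z + - (1/2) * u \<eta> r z) * id_mat j k) (levi N)
          + pairing (\<lambda>z j k. of_real (D * u \<eta> s z) * levi H z j k) (levi N)"
      proof (rule pairing_nonneg_of_levi[OF us3 e(6) L\<Omega> _ Nsm id_psd H, where a = 1])
        show "u F3 r z = 0" if "z \<notin> L" for z using F3_0[OF that] by (simp add: u_def)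
        show "cc_fun \<Omega> (\<lambda>z. C1 * \<eta>1 z + - (1/2) * u \<eta> r z)" "cc_fun \<Omega> (\<lambda>z. D * u \<eta> s z)"
          by (rule cc_fun_add[OF cc_fun_cmult[OF cc_eta1] cc_fun_cmult[OF u_cc]], rule cc_fun_cmult[OF u_cc])
        fix z x assume z: "z \<in> \<Omega>"
        have "0 \<le> Re (herm_form (levi (u F3 r) z) x) - 1/2 * u \<eta> r z * X x + D * u \<eta> s z * \<pi> z x + C1 * \<eta>1 z * X x"
        proof (cases "z \<in> L")
          case False
          then show ?thesis using levi0[where t = r, OF False e(6) F3_0] e(8)[OF False] e1(2)[of z] C1 X[of x]
            by (simp add: herm_form_def u_def)
        next
          case True
          then have zL: "z \<in> L1" using LL1 by blast
          have e1z: "\<eta>1 z = 1" using True LV(1) e1(5) by blast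
          have rs: "r - 1 = s" by (simp add: r_def)
          have Nb: "r * (N z + b3) \<le> D" unfolding D_def using NR[OF zL] r1 by (intro mult_left_mono) auto
          show ?thesis
          proof (cases "z \<in> V")
            case zV: True
            have "b3 * s = 2 * R * r" using s by (simp add: b3_def)
            moreover have "b3 * s \<le> (N z + b3) * (r - 1)" unfolding rs using s by (intro mult_right_mono) (auto simp: N_def)
            ultimately have "0 \<le> ((N z + b3) * (r - 1) - 2 * R * r) * r * G z powr (r - 2) * (cmod (g z x))\<^sup>2"
              using r1 by simp
            moreover have "(N z + b3) * r * G z powr (r - 1) * \<pi> z x \<le> D * G z powr s * \<pi> z x"
              unfolding rs using Nb \<pi>[OF z, of x] by (intro mult_right_mono) (auto simp: mult.commute)
            moreover have "0 \<le> C1 * X x" using C1 X[of x] by simp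
            ultimately show ?thesis
              using interior[of F3 b3 r z x, OF F3_def F3 _ zV] r1 e(5)[OF zV] by (simp add: u_def e1z)
          next
            case False
            then have zV: "z \<in> L1 - V" using zL by blast
            have "\<bar>Re (herm_form (levi (u F3 r) z) x) + F3 z * r * G z powr (r - 1) * \<pi> z x\<bar> \<le> C0 * X x"
              by (rule boundary[OF F3 bd3 _ _ zV]) (use r1 in auto)
            moreover have "F3 z * r * G z powr (r - 1) * \<pi> z x \<le> D * u \<eta> s z * \<pi> z x"
            proof -
              have "F3 z * r = \<eta> z * (r * (N z + b3))" by (simp add: F3_def mult_ac)
              also have "\<dots> \<le> \<eta> z * D" using Nb e(2) by (intro mult_left_mono)
              finally have "F3 z * r * (G z powr s * \<pi> z x) \<le> \<eta> z * D * (G z powr s * \<pi> z x)"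
                using \<pi>[OF z, of x] by (intro mult_right_mono) auto
              then show ?thesis by (simp add: rs u_def mult_ac)
            qed
            moreover have "1/2 * u \<eta> r z * X x \<le> A\<^sup>2 * X x"
              using eta_powr_le[OF _ _ zV, of r] r1 X[of x] by (intro mult_right_mono) auto
            ultimately show ?thesis by (simp add: e1z C1_def algebra_simps)
          qed
        qed
        then show "0 \<le> 1 * Re (herm_form (levi (u F3 r) z) x)
            + ((C1 * \<eta>1 z + - (1/2) * u \<eta> r z) * (\<Sum>j\<in>UNIV. (cmod (x j))\<^sup>2) + D * u \<eta> s z * Re (herm_form (levi H z) x))"
          by (simp add: X_def[symmetric] \<pi>_def algebra_simps)
      qed
      moreover have "pairing (\<lambda>z j k. of_real (D * u \<eta> s z) * levi H z j k) (levi N)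
          = D * pairing (\<lambda>z j k. of_real (u \<eta> s z) * levi H z j k) (levi N)"
        using pairing_id_lincomb[OF u_cc u_cc H, where a = D and b = 0] unfolding H_id by simp
      moreover have "\<dots> \<le> D * c2" using E2 D by (rule mult_left_mono)
      ultimately show ?thesis
        unfolding pairing_id_lincomb[OF cc_eta1 u_cc Nsm] by (simp add: mass_N)
    qed
    have "(\<lambda>z. \<eta> z * (- H z) powr (1 + s)) = u \<eta> r" by (rule ext) (simp add: u_def G_def r_def)
    then show "mass (\<lambda>z. \<eta> z * (- H z) powr (1 + s)) \<le> c3"
      using E3 unfolding c3_def by simp
  qed
qed

end

section \<open>Convergence\<close>

lemma uniform_limit_decreasing:
  fixes f :: "nat \<Rightarrow> 'a::topological_space \<Rightarrow> real"
  assumes K: "compact K" and f: "\<And>j. continuous_on K (f j)" and l: "continuous_on K l"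
    and dec: "\<And>j z. z \<in> K \<Longrightarrow> f (Suc j) z \<le> f j z" and lim: "\<And>z. z \<in> K \<Longrightarrow> (\<lambda>j. f j z) \<longlonglongrightarrow> l z"
  shows "uniform_limit K f l sequentially"
proof (rule uniform_limitI)
  fix e :: real assume e: "e > 0"
  have anti: "f j z \<le> f i z" if "i \<le> j" "z \<in> K" for i j z
    using that(1) by (rule lift_Suc_antimono_le[of "\<lambda>j. f j z", rotated]) (rule dec[OF that(2)])
  have ge: "l z \<le> f j z" if "z \<in> K" for j z
  proof (rule LIMSEQ_le_const2[OF lim[OF that]])
    show "\<exists>N. \<forall>n\<ge>N. f n z \<le> f j z" using anti[OF _ that] by blast
  qed
  have "\<exists>U. open U \<and> U \<inter> K = (\<lambda>z. f j z - l z) -` {..<e} \<inter> K" for j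
    using continuous_on_open_invariant[THEN iffD1, OF continuous_on_diff[OF f l], rule_format, of "{..<e}" j]
    by auto
  then obtain U where U: "\<And>j. open (U j)" "\<And>j. U j \<inter> K = (\<lambda>z. f j z - l z) -` {..<e} \<inter> K" by metis
  have "K \<subseteq> (\<Union>j\<in>UNIV. U j)"
  proof
    fix z assume z: "z \<in> K"
    have "eventually (\<lambda>j. f j z < l z + e) sequentially"
      using order_tendstoD(2)[OF lim[OF z], of "l z + e"] e by simp
    then obtain j where "f j z < l z + e" by (auto simp: eventually_sequentially)
    then have "z \<in> U j \<inter> K" unfolding U(2) using z by simp
    then show "z \<in> (\<Union>j\<in>UNIV. U j)" by blast
  qed
  from compactE_image[OF K U(1) this] obtain J where J: "finite J" "K \<subseteq> (\<Union>j\<in>J. U j)" by metis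
  \<comment> \<open>\<open>insert 0 J\<close> keeps \<open>Max\<close> meaningful when the finite
    subcover is empty.\<close>
  have "dist (f j z) (l z) < e" if j: "Max (insert 0 J) \<le> j" and z: "z \<in> K" for j z
  proof -
    obtain i where i: "i \<in> J" "z \<in> U i" using J z by blast
    then have "z \<in> U i \<inter> K" using z by blast
    then have "f i z < l z + e" unfolding U(2) by simp
    moreover have "i \<le> j" using i(1) J(1) j by simp
    ultimately show ?thesis using anti[OF _ z, of i j] ge[OF z, of j] by (simp add: dist_real_def)
  qed
  then show "eventually (\<lambda>j. \<forall>z\<in>K. dist (f j z) (l z) < e) sequentially"
    unfolding eventually_sequentially by blast
qed

lemma cmod_dz_le:
  assumes "u differentiable at z"
  shows "cmod (dz u z j) \<le> \<bar>dd (axis j 1) u z\<bar> + \<bar>dd (axis j \<i>) u z\<bar>"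
proof -
  have "cmod (dz u z j) \<le> (\<bar>dd (axis j 1) u z\<bar> + \<bar>dd (axis j \<i>) u z\<bar>) / 2"
    using norm_triangle_ineq4[of "of_real (dd (axis j 1) u z) :: complex" "\<i> * of_real (dd (axis j \<i>) u z)"]
    by (simp add: dz_eq[OF assms] norm_divide norm_mult)
  then show ?thesis by simp
qed

lemma cc_fun_mult_powr:
  fixes \<eta> G :: "'a::euclidean_space \<Rightarrow> real"
  assumes "open \<Omega>" "continuous_on UNIV \<eta>" "compact L" "L \<subseteq> \<Omega>" "\<And>z. z \<notin> L \<Longrightarrow> \<eta> z = 0"
    and G: "continuous_on \<Omega> G" "\<And>z. z \<in> L \<Longrightarrow> 0 < G z"
  shows "cc_fun \<Omega> (\<lambda>z. \<eta> z * G z powr t)"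
proof -
  let ?S = "\<Omega> \<inter> G -` {0<..}"
  have "open ?S" by (rule continuous_open_preimage[OF G(1) assms(1)]) simp
  moreover have "cc_fun ?S \<eta>" using assms unfolding cc_fun_def by (intro conjI exI[of _ L]) auto
  moreover have "continuous_on ?S (\<lambda>z. G z powr t)"
    by (intro continuous_on_powr continuous_on_subset[OF G(1)] continuous_on_const) auto
  ultimately have "cc_fun ?S (\<lambda>z. \<eta> z * G z powr t)" by (rule cc_fun_mult_continuous)
  then show ?thesis by (rule cc_fun_mono) auto
qed

section \<open>Truncation and its error\<close>

definition clip :: "real \<Rightarrow> real \<Rightarrow> real" where "clip M x = max (- M) (min M x)"

text \<open>Truncation of \<open>g\<close> at level \<open>M\<close>; on the polar set \<^const>\<open>real_of_ereal\<close> would return the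
  junk value \<open>0\<close>.\<close>

definition trunc :: "('a \<Rightarrow> ereal) \<Rightarrow> real \<Rightarrow> 'a \<Rightarrow> real" where
  "trunc g M z = (if g z = -\<infinity> then - M else clip M (real_of_ereal (g z)))"

lemma abs_clip: "0 \<le> M \<Longrightarrow> \<bar>clip M x\<bar> = min \<bar>x\<bar> M"
  by (auto simp: clip_def)

text \<open>Nothing changes where |x| \<le> M; elsewhere |x|^(1+\<epsilon>) = |x|^(\<epsilon>-s)
  |x|^(1+s), and the first factor is at most M^(\<epsilon>-s). The factor 1 + c compares |x| with c
  - x also for positive x, a value the approximants may take.\<close>

lemma tail_bound:
  fixes x c M s \<epsilon> :: real
  assumes M: "1 \<le> M" and \<epsilon>: "0 < \<epsilon>" "\<epsilon> < s" and c: "0 \<le> c" and G: "1 \<le> c - x"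
  shows "\<bar>\<bar>x\<bar> powr (1 + \<epsilon>) - \<bar>clip M x\<bar> powr (1 + \<epsilon>)\<bar> \<le> M powr (\<epsilon> - s) * ((1 + c) powr (1 + s) * (c - x) powr (1 + s))"
proof (cases "\<bar>x\<bar> \<le> M")
  case True
  then show ?thesis using M by (simp add: abs_clip min_def)
next
  case False
  then have x: "M < \<bar>x\<bar>" by simp
  have "\<bar>clip M x\<bar> powr (1 + \<epsilon>) \<le> \<bar>x\<bar> powr (1 + \<epsilon>)"
    using M x \<epsilon> by (intro powr_mono2) (auto simp: abs_clip)
  then have "\<bar>\<bar>x\<bar> powr (1 + \<epsilon>) - \<bar>clip M x\<bar> powr (1 + \<epsilon>)\<bar> \<le> \<bar>x\<bar> powr (1 + \<epsilon>)" by simp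
  also have "\<dots> = \<bar>x\<bar> powr (\<epsilon> - s) * \<bar>x\<bar> powr (1 + s)"
    using powr_add[of "\<bar>x\<bar>" "\<epsilon> - s" "1 + s"] by (simp add: add.commute)
  also have "\<dots> \<le> M powr (\<epsilon> - s) * ((1 + c) powr (1 + s) * (c - x) powr (1 + s))"
  proof (rule mult_mono)
    show "\<bar>x\<bar> powr (\<epsilon> - s) \<le> M powr (\<epsilon> - s)" using M x \<epsilon> by (intro powr_mono2') auto
    have "c * 1 \<le> c * (c - x)" using c G by (intro mult_left_mono) auto
    then have "\<bar>x\<bar> \<le> (1 + c) * (c - x)" using c G by (simp add: algebra_simps abs_le_iff)
    then have "\<bar>x\<bar> powr (1 + s) \<le> ((1 + c) * (c - x)) powr (1 + s)" using \<epsilon> by (intro powr_mono2) auto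
    then show "\<bar>x\<bar> powr (1 + s) \<le> (1 + c) powr (1 + s) * (c - x) powr (1 + s)" using c G by (simp add: powr_mult)
  qed auto
  finally show ?thesis .
qed

lemma psh_neg_real:
  assumes "psh_neg \<Omega> g" "z \<in> \<Omega>" "z \<notin> polar_set \<Omega> g"
  shows "ereal (real_of_ereal (g z)) = g z"
proof -
  have "g z \<noteq> -\<infinity>" "g z \<le> 0" using assms by (auto simp: polar_set_def psh_neg_def)
  then show ?thesis by (auto simp: ereal_real)
qed

lemma C1_on_imp_continuous_on: "C1_on S f \<Longrightarrow> continuous_on S f"
  by (intro continuous_at_imp_continuous_on) (auto simp: C1_on_def intro: differentiable_imp_continuous_within)

lemma admissible_seq_antimono:
  "admissible_seq \<Omega> g gs \<Longrightarrow> z \<in> \<Omega> \<Longrightarrow> i \<le> j \<Longrightarrow> gs j z \<le> gs i z"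
  by (rule lift_Suc_antimono_le[of "\<lambda>j. gs j z"]) (auto simp: admissible_seq_def)

lemma admissible_seq_ge:
  assumes "admissible_seq \<Omega> g gs" "z \<in> \<Omega>" shows "g z \<le> ereal (gs j z)"
proof (rule LIMSEQ_le_const2)
  show "(\<lambda>j. ereal (gs j z)) \<longlonglongrightarrow> g z" using assms by (auto simp: admissible_seq_def)
  show "\<exists>N. \<forall>n\<ge>N. ereal (gs n z) \<le> ereal (gs j z)" using admissible_seq_antimono[OF assms] by auto
qed

context pluriharmonic_current_on
begin

text \<open>The inner cutoff is 1 near \<open>K\<close> and near the compact set
  \<open>unbdd_locus \<Omega> g\<close>, so \<open>L1 - V\<close> is a compact set off that locus.
  There \<open>g\<close> bounds every \<open>gs j\<close> from below, and C^1 convergence bounds the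
  gradients for large \<open>j\<close>, which is why the conclusion is eventual.\<close>

lemma admissible_mass_bound:
  assumes g: "psh_neg \<Omega> g" "C1_on (\<Omega> - unbdd_locus \<Omega> g) (\<lambda>z. real_of_ereal (g z))"
      "compact (unbdd_locus \<Omega> g)" "unbdd_locus \<Omega> g = polar_set \<Omega> g"
    and gs: "admissible_seq \<Omega> g gs" and K: "compact K" "K \<subseteq> \<Omega>" and s: "0 < s" "s < 1"
  obtains \<eta> L c C where "continuous_on UNIV \<eta>" "\<And>z. 0 \<le> \<eta> z" "\<And>z. z \<in> K \<Longrightarrow> \<eta> z = 1"
    "compact L" "L \<subseteq> \<Omega>" "\<And>z. z \<notin> L \<Longrightarrow> \<eta> z = 0" "0 \<le> c" "\<And>j z. z \<in> L \<Longrightarrow> 1 \<le> c - gs j z"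
    "eventually (\<lambda>j. mass (\<lambda>z. \<eta> z * (c - gs j z) powr (1 + s)) \<le> C) sequentially"
proof -
  let ?P = "unbdd_locus \<Omega> g"
  have P\<Omega>: "?P \<subseteq> \<Omega>" by (auto simp: unbdd_locus_def)
  have KP: "compact (K \<union> ?P)" "K \<union> ?P \<subseteq> \<Omega>" using K g(3) P\<Omega> by auto
  obtain \<eta> :: "complex^('n::{finite,linorder}) \<Rightarrow> real" and V L where e: "smooth_on UNIV \<eta>" "\<And>z. 0 \<le> \<eta> z" "\<And>z. \<eta> z \<le> 1"
    "open V" "K \<union> ?P \<subseteq> V" "\<And>z. z \<in> V \<Longrightarrow> \<eta> z = 1" "compact L" "L \<subseteq> \<Omega>" "V \<subseteq> L" "\<And>z. z \<notin> L \<Longrightarrow> \<eta> z = 0"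
    by (rule smooth_cutoff[OF KP(1) open_domain KP(2)]) (rule that)
  obtain \<eta>1 :: "complex^('n::{finite,linorder}) \<Rightarrow> real" and V1 L1 where e1: "smooth_on UNIV \<eta>1" "\<And>z. 0 \<le> \<eta>1 z" "\<And>z. \<eta>1 z \<le> 1"
    "open V1" "L \<subseteq> V1" "\<And>z. z \<in> V1 \<Longrightarrow> \<eta>1 z = 1" "compact L1" "L1 \<subseteq> \<Omega>" "V1 \<subseteq> L1" "\<And>z. z \<notin> L1 \<Longrightarrow> \<eta>1 z = 0"
    by (rule smooth_cutoff[OF e(7) open_domain e(8)]) (rule that)
  have smooth: "smooth_on \<Omega> (gs j)" and psh: "psh_real \<Omega> (gs j)" for j using gs by (auto simp: admissible_seq_def)
  have "compact (gs 0 ` L1)"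
    by (rule compact_continuous_image[OF continuous_on_subset[OF smooth_on_imp_continuous_on[OF smooth] e1(8)] e1(7)])
  from compact_imp_bounded[OF this] obtain m0 where m0: "\<And>z. z \<in> L1 \<Longrightarrow> \<bar>gs 0 z\<bar> \<le> m0"
    unfolding bounded_iff by auto
  \<comment> \<open>By monotonicity \<open>gs 0\<close> bounds every \<open>gs j\<close> from above,
    so one \<open>c\<close> gives \<open>1 \<le> c - gs j z\<close> on \<open>L1\<close> for all
    \<open>j\<close>.\<close>
  define c where "c = \<bar>m0\<bar> + 1"
  have cg: "gs j z \<le> c - 1" if "z \<in> L1" for j z
    using admissible_seq_antimono[OF gs, of z 0 j] m0[OF that] that e1(8) by (auto simp: c_def)
  define Q where "Q = L1 - V"
  have Q: "compact Q" "Q \<subseteq> \<Omega> - ?P" "Q \<subseteq> \<Omega>" using e(4,5) e1(7,8) by (auto simp: Q_def compact_diff)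
  have bound: "\<exists>m. \<forall>z\<in>Q. \<bar>f z\<bar> \<le> m" if "continuous_on (\<Omega> - ?P) f" for f :: "_ \<Rightarrow> real"
  proof -
    have "compact (f ` Q)" by (rule compact_continuous_image[OF continuous_on_subset[OF that Q(2)] Q(1)])
    from compact_imp_bounded[OF this] show ?thesis unfolding bounded_iff by auto
  qed
  let ?g = "\<lambda>z. real_of_ereal (g z)"
  have "continuous_on (\<Omega> - ?P) ?g"
    by (rule C1_on_imp_continuous_on[OF g(2)])
  from bound[OF this] obtain m where m: "\<And>z. z \<in> Q \<Longrightarrow> \<bar>?g z\<bar> \<le> m" by blast
  have lower: "- m \<le> gs j z" if z: "z \<in> Q" for j z
  proof -
    have "z \<in> \<Omega>" "z \<notin> polar_set \<Omega> g" using z Q(2) g(4) by auto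
    then have "ereal (?g z) = g z" by (rule psh_neg_real[OF g(1)])
    then have "?g z \<le> gs j z" using admissible_seq_ge[OF gs, of z j] z Q(3) by (metis ereal_less_eq(3) subsetD)
    moreover have "- ?g z \<le> m" using m[OF z] abs_ge_minus_self order_trans by blast
    ultimately show ?thesis by linarith
  qed
  have "\<exists>b. eventually (\<lambda>j. \<forall>z\<in>Q. \<bar>dd v (gs j) z\<bar> \<le> b) sequentially" for v
  proof -
    have "continuous_on (\<Omega> - ?P) (dd v ?g)" using g(2) by (auto simp: C1_on_def)
    from bound[OF this] obtain b where b: "\<And>z. z \<in> Q \<Longrightarrow> \<bar>dd v ?g z\<bar> \<le> b" by blast
    have "uniform_limit Q (\<lambda>j. dd v (gs j)) (dd v ?g) sequentially"
      using gs Q(1,2) by (auto simp: admissible_seq_def)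
    from uniform_limitD[OF this, of 1] have "eventually (\<lambda>j. \<forall>z\<in>Q. dist (dd v (gs j) z) (dd v ?g z) < 1) sequentially" by simp
    then have "eventually (\<lambda>j. \<forall>z\<in>Q. \<bar>dd v (gs j) z\<bar> \<le> b + 1) sequentially"
    proof (rule eventually_mono)
      fix j assume *: "\<forall>z\<in>Q. dist (dd v (gs j) z) (dd v ?g z) < 1"
      show "\<forall>z\<in>Q. \<bar>dd v (gs j) z\<bar> \<le> b + 1"
      proof
        fix z assume "z \<in> Q"
        with * b show "\<bar>dd v (gs j) z\<bar> \<le> b + 1" by (fastforce simp: dist_real_def)
      qed
    qed
    then show ?thesis by blast
  qed
  then have "\<forall>v. \<exists>b. eventually (\<lambda>j. \<forall>z\<in>Q. \<bar>dd v (gs j) z\<bar> \<le> b) sequentially" by (rule allI)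
  from choice[OF this] obtain b where b: "\<forall>v. eventually (\<lambda>j. \<forall>z\<in>Q. \<bar>dd v (gs j) z\<bar> \<le> b v) sequentially" ..
  define b' where "b' = (\<Sum>k\<in>(UNIV::'n set). \<bar>b (axis k 1)\<bar> + \<bar>b (axis k \<i>)\<bar>)"
  have b'_ge: "\<bar>b (axis k 1)\<bar> + \<bar>b (axis k \<i>)\<bar> \<le> b'" for k :: 'n unfolding b'_def by (rule member_le_sum) auto
  \<comment> \<open>Serves both requirements of \<open>uniform_estimate\<close> on
    \<open>gs j z - c\<close>: \<open>m + c\<close> for the lower bound and \<open>b'\<close> for
    the gradient.\<close>
  define A where "A = \<bar>m\<bar> + c + \<bar>b'\<bar>"
  obtain C where C: "\<And>H. smooth_on \<Omega> H \<Longrightarrow> (\<forall>z\<in>\<Omega>. psd (levi H z)) \<Longrightarrow> (\<forall>z\<in>L1. H z \<le> -1) \<Longrightarrow>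
    (\<forall>z\<in>L1 - V. - A \<le> H z \<and> (\<forall>j. cmod (dz H z j) \<le> A)) \<Longrightarrow>
    mass (\<lambda>z. \<eta> z * (- H z) powr (1 + s)) \<le> C"
    using uniform_estimate[OF e(1,2,3,4,6,7,9,10) e1(1,2,3,4,6,7,9,10) e1(5,8) s, of A] by blast
  have "eventually (\<lambda>j. \<forall>k::'n. \<forall>z\<in>Q. \<bar>dd (axis k 1) (gs j) z\<bar> \<le> b (axis k 1) \<and> \<bar>dd (axis k \<i>) (gs j) z\<bar> \<le> b (axis k \<i>)) sequentially"
    using b by (intro eventually_all_finite) (simp add: ball_conj_distrib eventually_conj_iff)
  then have ev: "eventually (\<lambda>j. mass (\<lambda>z. \<eta> z * (c - gs j z) powr (1 + s)) \<le> C) sequentially"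
  proof (rule eventually_mono)
    fix j assume dj: "\<forall>k::'n. \<forall>z\<in>Q. \<bar>dd (axis k 1) (gs j) z\<bar> \<le> b (axis k 1) \<and> \<bar>dd (axis k \<i>) (gs j) z\<bar> \<le> b (axis k \<i>)"
    define H where "H z = gs j z + - c" for z
    have "mass (\<lambda>z. \<eta> z * (- H z) powr (1 + s)) \<le> C"
    proof (rule C)
      show "smooth_on \<Omega> H" unfolding H_def[abs_def] by (intro smooth_on_add open_domain smooth smooth_on_const)
      show "\<forall>z\<in>\<Omega>. psd (levi H z)"
      proof
        fix z assume z: "z \<in> \<Omega>"
        show "psd (levi H z)" unfolding H_def[abs_def] levi_add_const(1)[OF open_domain smooth z]
          by (rule psd_levi[OF open_domain smooth z psh])
      qed
      show "\<forall>z\<in>L1. H z \<le> -1"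
      proof
        fix z assume "z \<in> L1" from cg[OF this, of j] show "H z \<le> -1" by (simp add: H_def)
      qed
      show "\<forall>z\<in>L1 - V. - A \<le> H z \<and> (\<forall>k. cmod (dz H z k) \<le> A)"
      proof (intro ballI conjI allI)
        fix z k assume "z \<in> L1 - V"
        then have z: "z \<in> Q" by (simp add: Q_def)
        then have z\<Omega>: "z \<in> \<Omega>" using Q(3) by blast
        show "- A \<le> H z" using lower[OF z, of j] by (simp add: H_def A_def)
        have "cmod (dz H z k) = cmod (dz (gs j) z k)"
          unfolding H_def[abs_def] levi_add_const(2)[OF open_domain smooth z\<Omega>] ..
        also have "\<dots> \<le> \<bar>dd (axis k 1) (gs j) z\<bar> + \<bar>dd (axis k \<i>) (gs j) z\<bar>"
          by (rule cmod_dz_le[OF smooth_on_imp_differentiable[OF smooth z\<Omega>]])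
        also have "\<dots> \<le> \<bar>b (axis k 1)\<bar> + \<bar>b (axis k \<i>)\<bar>"
          using dj[rule_format, OF z, of k] by linarith
        also have "\<dots> \<le> b'" by (rule b'_ge)
        also have "\<dots> \<le> A" by (simp add: A_def c_def)
        finally show "cmod (dz H z k) \<le> A" .
      qed
    qed
    then show "mass (\<lambda>z. \<eta> z * (c - gs j z) powr (1 + s)) \<le> C" by (simp add: H_def)
  qed
  show ?thesis
  proof (rule that[of \<eta> L c C])
    show "continuous_on UNIV \<eta>" by (rule smooth_on_imp_continuous_on[OF e(1)])
    show "\<eta> z = 1" if "z \<in> K" for z using e(5,6) that by blast
    show "0 \<le> c" by (simp add: c_def)
    show "1 \<le> c - gs j z" if "z \<in> L" for j z using cg[of z j] that e1(5,9) by fastforce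
  qed (use e ev in auto)
qed

end

lemma clip_in: "0 \<le> M \<Longrightarrow> clip M x \<in> {-M..M}"
  by (auto simp: clip_def)

lemma clip_mono: "x \<le> y \<Longrightarrow> clip M x \<le> clip M y"
  by (auto simp: clip_def)

lemma trunc_in: "0 \<le> M \<Longrightarrow> trunc g M z \<in> {-M..M}"
  using clip_in[of M] by (auto simp: trunc_def)

lemma psh_neg_open_sublevel:
  assumes "open \<Omega>" "psh_neg \<Omega> g" shows "open {z \<in> \<Omega>. g z < c}"
  unfolding open_contains_ball
proof
  fix z assume z: "z \<in> {z \<in> \<Omega>. g z < c}"
  then have "eventually (\<lambda>w. g w < c) (at z)" using assms(2) by (auto simp: psh_neg_def)
  then have "eventually (\<lambda>w. g w < c) (nhds z)" using z by (auto simp: eventually_nhds_conv_at)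
  moreover have "eventually (\<lambda>w. w \<in> \<Omega>) (nhds z)" using z assms(1) by (auto intro: eventually_nhds_in_open)
  ultimately have "eventually (\<lambda>w. w \<in> {z \<in> \<Omega>. g z < c}) (nhds z)" by eventually_elim auto
  then obtain d where "d > 0" "\<And>y. dist y z < d \<Longrightarrow> y \<in> {z \<in> \<Omega>. g z < c}"
    unfolding eventually_nhds_metric by blast
  then show "\<exists>d>0. ball z d \<subseteq> {z \<in> \<Omega>. g z < c}"
    by (intro exI[of _ d]) (auto simp: dist_commute)
qed

text \<open>Two open sets cover \<open>\<Omega>\<close> because the unbounded locus is the polar
  set: off the locus \<open>g\<close> is continuous, and on {g < -M}, open by upper semicontinuity,
  the truncation is constant.\<close>

lemma continuous_on_trunc:
  assumes \<Omega>: "open \<Omega>" and g: "psh_neg \<Omega> g" "C1_on (\<Omega> - unbdd_locus \<Omega> g) (\<lambda>z. real_of_ereal (g z))"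
      "compact (unbdd_locus \<Omega> g)" "unbdd_locus \<Omega> g = polar_set \<Omega> g"
  shows "continuous_on \<Omega> (trunc g M)"
proof -
  let ?P = "unbdd_locus \<Omega> g"
  let ?W = "{z \<in> \<Omega>. g z < ereal (- M)}"
  have "continuous_on (\<Omega> - ?P) (\<lambda>z. real_of_ereal (g z))"
    by (rule C1_on_imp_continuous_on[OF g(2)])
  then have "continuous_on (\<Omega> - ?P) (\<lambda>z. clip M (real_of_ereal (g z)))"
    unfolding clip_def by (intro continuous_intros)
  then have 1: "continuous_on (\<Omega> - ?P) (trunc g M)"
    by (rule continuous_on_eq) (auto simp: g(4) polar_set_def trunc_def)
  have "trunc g M z = - M" if "z \<in> ?W" for z
    using that by (cases "g z") (auto simp: trunc_def clip_def)
  then have 2: "continuous_on ?W (trunc g M)"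
    by (intro continuous_on_eq[OF continuous_on_const[of _ "- M"]]) auto
  have "open (\<Omega> - ?P)" using \<Omega> g(3) by (intro open_Diff compact_imp_closed)
  from continuous_on_open_Un[OF this psh_neg_open_sublevel[OF \<Omega> g(1)] 1 2]
  show ?thesis by (rule continuous_on_subset) (auto simp: g(4) polar_set_def)
qed

lemma admissible_clip_uniform:
  assumes \<Omega>: "open \<Omega>" and g: "psh_neg \<Omega> g" "C1_on (\<Omega> - unbdd_locus \<Omega> g) (\<lambda>z. real_of_ereal (g z))"
      "compact (unbdd_locus \<Omega> g)" "unbdd_locus \<Omega> g = polar_set \<Omega> g"
    and gs: "admissible_seq \<Omega> g gs" and K: "compact K" "K \<subseteq> \<Omega>"
  shows "uniform_limit K (\<lambda>j z. clip M (gs j z)) (trunc g M) sequentially"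
proof (rule uniform_limit_decreasing[OF K(1)])
  show "continuous_on K (\<lambda>z. clip M (gs j z))" for j
  proof -
    have "continuous_on K (gs j)"
      using gs by (intro continuous_on_subset[OF smooth_on_imp_continuous_on K(2)]) (auto simp: admissible_seq_def)
    then show ?thesis unfolding clip_def by (intro continuous_intros)
  qed
  show "continuous_on K (trunc g M)" by (rule continuous_on_subset[OF continuous_on_trunc[OF \<Omega> g] K(2)])
  fix z assume "z \<in> K"
  then have z: "z \<in> \<Omega>" using K by blast
  show "clip M (gs (Suc j) z) \<le> clip M (gs j z)" for j
    using gs z by (intro clip_mono) (auto simp: admissible_seq_def)
  have lim: "(\<lambda>j. ereal (gs j z)) \<longlonglongrightarrow> g z" using gs z by (auto simp: admissible_seq_def)
  show "(\<lambda>j. clip M (gs j z)) \<longlonglongrightarrow> trunc g M z"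
  proof (cases "g z = -\<infinity>")
    case True
    have "eventually (\<lambda>j. ereal (gs j z) < ereal (- M)) sequentially"
      using lim unfolding True by (rule order_tendstoD) simp
    then have "eventually (\<lambda>j. clip M (gs j z) = trunc g M z) sequentially"
      by (rule eventually_mono) (use True in \<open>auto simp: clip_def trunc_def\<close>)
    then show ?thesis by (rule tendsto_eventually)
  next
    case False
    then have "z \<notin> polar_set \<Omega> g" by (simp add: polar_set_def)
    then have "(\<lambda>j. gs j z) \<longlonglongrightarrow> real_of_ereal (g z)"
      using lim psh_neg_real[OF g(1) z] by (metis lim_ereal)
    then have "(\<lambda>j. clip M (gs j z)) \<longlonglongrightarrow> clip M (real_of_ereal (g z))"
      unfolding clip_def by (intro tendsto_intros)
    then show ?thesis using False by (simp add: trunc_def)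
  qed
qed

lemma continuous_on_abs_powr: "0 \<le> a \<Longrightarrow> continuous_on S f \<Longrightarrow> continuous_on S (\<lambda>x. \<bar>f x :: real\<bar> powr (1 + a))"
  by (intro continuous_on_powr' continuous_intros) auto

lemma uniform_limit_abs_powr:
  assumes "uniform_limit K f l sequentially" "0 \<le> a"
    and "\<And>j z. f j z \<in> {-M..M}" "\<And>z. l z \<in> {-M..M::real}" and "\<delta> > 0"
  shows "eventually (\<lambda>j. \<forall>z\<in>K. \<bar>\<bar>f j z\<bar> powr (1 + a) - \<bar>l z\<bar> powr (1 + a)\<bar> < \<delta>) sequentially"
proof -
  have "uniformly_continuous_on {-M..M} (\<lambda>x. \<bar>x\<bar> powr (1 + a))"
    using continuous_on_abs_powr[OF assms(2) continuous_on_id] by (intro compact_uniformly_continuous) auto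
  then obtain d where d: "d > 0" "\<And>x y. x \<in> {-M..M} \<Longrightarrow> y \<in> {-M..M} \<Longrightarrow> dist y x < d \<Longrightarrow>
      dist (\<bar>y\<bar> powr (1 + a)) (\<bar>x\<bar> powr (1 + a)) < \<delta>"
    using assms(5) unfolding uniformly_continuous_on_def by meson
  from uniform_limitD[OF assms(1) d(1)] show ?thesis
    by (rule eventually_mono) (use d(2) assms(3,4) in \<open>auto simp: dist_real_def\<close>)
qed

text \<open>For large \<open>j\<close> both \<open>a M\<close> and \<open>a N\<close> are close to
  the same \<open>x j\<close>, so \<open>a\<close> is Cauchy and \<open>x\<close> inherits its
  limit. Expressing the limit through \<open>a\<close> alone is what makes it independent of the
  approximating sequence.\<close>

lemma double_limit:
  fixes x a :: "nat \<Rightarrow> complex" and r :: "nat \<Rightarrow> real"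
  assumes r: "r \<longlonglongrightarrow> 0"
    and ev: "\<And>M \<delta>. 1 \<le> M \<Longrightarrow> 0 < \<delta> \<Longrightarrow> eventually (\<lambda>j. cmod (x j - a M) \<le> r M + \<delta>) sequentially"
  shows "x \<longlonglongrightarrow> lim a"
proof -
  have aa: "cmod (a M - a N) \<le> r M + r N" if "1 \<le> M" "1 \<le> N" for M N
  proof (rule field_le_epsilon)
    fix e :: real assume "0 < e"
    then have "eventually (\<lambda>j. cmod (x j - a M) \<le> r M + e / 2 \<and> cmod (x j - a N) \<le> r N + e / 2) sequentially"
      using ev[OF that(1), of "e / 2"] ev[OF that(2), of "e / 2"] by (simp add: eventually_conj)
    then obtain j where "cmod (x j - a M) \<le> r M + e / 2" "cmod (x j - a N) \<le> r N + e / 2"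
      by (auto simp: eventually_sequentially)
    then show "cmod (a M - a N) \<le> r M + r N + e"
      using norm_triangle_ineq4[of "x j - a N" "x j - a M"] by simp
  qed
  have small: "\<exists>N\<ge>1. \<forall>n\<ge>N. r n < e" if "e > 0" for e
  proof -
    have "eventually (\<lambda>n. r n < e \<and> 1 \<le> n) sequentially"
      using order_tendstoD(2)[OF r that] eventually_ge_at_top[of 1] by eventually_elim simp
    then obtain N where "\<And>n. n \<ge> N \<Longrightarrow> r n < e \<and> 1 \<le> n" by (auto simp: eventually_sequentially)
    then show ?thesis by (intro exI[of _ "max N 1"]) auto
  qed
  have "Cauchy a"
  proof (rule metric_CauchyI)
    fix e :: real assume "0 < e"
    then obtain N where N: "N \<ge> 1" "\<And>n. n \<ge> N \<Longrightarrow> r n < e / 2" using small[of "e / 2"] by auto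
    show "\<exists>N. \<forall>m\<ge>N. \<forall>n\<ge>N. dist (a m) (a n) < e"
    proof (intro exI[of _ N] allI impI)
      fix m n assume "m \<ge> N" "n \<ge> N"
      then show "dist (a m) (a n) < e" using aa[of m n] N(1) N(2)[of m] N(2)[of n] by (simp add: dist_norm)
    qed
  qed
  then have l: "a \<longlonglongrightarrow> lim a" by (simp add: Cauchy_convergent_iff convergent_LIMSEQ_iff)
  show ?thesis
  proof (rule metric_LIMSEQ_I)
    fix e :: real assume e: "0 < e"
    obtain N where N: "N \<ge> 1" "\<And>n. n \<ge> N \<Longrightarrow> r n < e / 3" using small[of "e / 3"] e by auto
    obtain N' where N': "\<And>n. n \<ge> N' \<Longrightarrow> dist (a n) (lim a) < e / 3" using metric_LIMSEQ_D[OF l, of "e / 3"] e by auto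
    define n where "n = max N N'"
    have n: "1 \<le> n" "r n < e / 3" "dist (a n) (lim a) < e / 3" using N N' by (auto simp: n_def)
    have "eventually (\<lambda>j. cmod (x j - a n) \<le> r n + e / 3) sequentially" using ev[OF n(1), of "e / 3"] e by simp
    then obtain J where J: "\<And>j. j \<ge> J \<Longrightarrow> cmod (x j - a n) \<le> r n + e / 3" by (auto simp: eventually_sequentially)
    show "\<exists>J. \<forall>j\<ge>J. dist (x j) (lim a) < e"
    proof (intro exI[of _ J] allI impI)
      fix j assume "j \<ge> J"
      from J[OF this] n show "dist (x j) (lim a) < e"
        using dist_triangle[of "x j" "lim a" "a n"] by (simp add: dist_norm)
    qed
  qed
qed

lemma test_form_imp_cc_form: "test_form p \<Omega> \<phi> \<Longrightarrow> cc_form p \<Omega> \<phi>"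
  unfolding test_form_def cc_form_def using smooth_on_imp_continuous_on by blast

lemma cc_form_bounded:
  fixes \<phi> :: "'n::{finite,linorder} form"
  assumes "cc_form p \<Omega> \<phi>"
  obtains B where "0 \<le> B" "\<And>I J z. cmod (\<phi> I J z) \<le> B"
proof -
  have "\<exists>b. \<forall>z. cmod (\<phi> I J z) \<le> b" for I J
  proof -
    obtain K where K: "compact K" "\<And>z. z \<notin> K \<Longrightarrow> \<phi> I J z = 0" and c: "continuous_on UNIV (\<phi> I J)"
      using cc_formD(1)[OF assms, of I J] unfolding cc_fun_def by blast
    have "compact (\<phi> I J ` K)" by (rule compact_continuous_image[OF continuous_on_subset[OF c subset_UNIV] K(1)])
    from compact_imp_bounded[OF this] obtain b where b: "\<And>z. z \<in> K \<Longrightarrow> cmod (\<phi> I J z) \<le> b"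
      unfolding bounded_iff by auto
    have "cmod (\<phi> I J z) \<le> \<bar>b\<bar>" for z using b[of z] K(2)[of z] by (cases "z \<in> K") auto
    then show ?thesis by blast
  qed
  then obtain b where b: "\<And>I J z. cmod (\<phi> I J z) \<le> b I J" by metis
  have b0: "0 \<le> b I J" for I J using b[of I J undefined] norm_ge_zero order_trans by blast
  define B where "B = (\<Sum>I\<in>UNIV. \<Sum>J\<in>UNIV. b I J)"
  have "b I J \<le> B" for I J
  proof -
    have "b I J \<le> (\<Sum>J\<in>UNIV. b I J)" using b0 by (intro member_le_sum) auto
    also have "\<dots> \<le> B" unfolding B_def using b0 by (intro member_le_sum) (auto intro: sum_nonneg)
    finally show ?thesis .
  qed
  moreover from this have "0 \<le> B" using b0 order_trans by blast
  ultimately show ?thesis using that[of B] b order_trans by blast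
qed

context pluriharmonic_current_on
begin

lemma cc_form_weight:
  assumes "cc_form p \<Omega> \<phi>" "continuous_on \<Omega> (f :: _ \<Rightarrow> real)"
  shows "cc_form p \<Omega> (\<lambda>I J z. of_real (f z) * \<phi> I J z)"
proof (rule cc_formI)
  have "continuous_on \<Omega> (\<lambda>z. of_real (f z) :: complex)" using assms(2) by (rule continuous_on_of_real)
  from cc_fun_mult_continuous[OF open_domain cc_formD(1)[OF assms(1)] this]
  show "cc_fun \<Omega> (\<lambda>z. of_real (f z) * \<phi> I J z)" for I J by (simp only: mult.commute)
qed (simp add: cc_formD(2)[OF assms(1)])

text \<open>The constant may depend on the sequence and on \<open>\<phi>\<close>, but the comparison
  value involves \<open>g\<close> and not \<open>gs\<close>, as \<open>double_limit\<close> will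
  exploit.\<close>

lemma truncation_estimate:
  assumes g: "psh_neg \<Omega> g" "C1_on (\<Omega> - unbdd_locus \<Omega> g) (\<lambda>z. real_of_ereal (g z))"
      "compact (unbdd_locus \<Omega> g)" "unbdd_locus \<Omega> g = polar_set \<Omega> g"
    and gs: "admissible_seq \<Omega> g gs" and \<phi>: "test_form p \<Omega> \<phi>" and \<epsilon>: "0 < \<epsilon>" "\<epsilon> < 1"
  obtains C where "\<And>M \<delta>. 1 \<le> M \<Longrightarrow> 0 < \<delta> \<Longrightarrow> eventually (\<lambda>j. cmod (mult_current (\<lambda>z. \<bar>gs j z\<bar> powr (1 + \<epsilon>)) T \<phi>
     - mult_current (\<lambda>z. \<bar>trunc g M z\<bar> powr (1 + \<epsilon>)) T \<phi>) \<le> C * M powr (- ((1 - \<epsilon>) / 2)) + \<delta>) sequentially"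
proof -
  have \<phi>cc: "cc_form p \<Omega> \<phi>" by (rule test_form_imp_cc_form[OF \<phi>])
  obtain K where K: "compact K" "K \<subseteq> \<Omega>" "\<And>I J z. z \<notin> K \<Longrightarrow> \<phi> I J z = 0"
    using \<phi> unfolding test_form_def form_support_ok_def by blast
  obtain B where B: "0 \<le> B" "\<And>I J z. cmod (\<phi> I J z) \<le> B" by (rule cc_form_bounded[OF \<phi>cc]) (rule that)
  \<comment> \<open>The midpoint of \<epsilon> and 1: \<open>s < 1\<close> is required by the mass
    bound and \<open>\<epsilon> < s\<close> makes the tail decay, at the rate
    M^(-(1-\<epsilon>)/2).\<close>
  define s where "s = (1 + \<epsilon>) / 2"
  have s: "0 < s" "s < 1" "\<epsilon> < s" "\<epsilon> - s = - ((1 - \<epsilon>) / 2)" using \<epsilon> by (auto simp: s_def field_simps)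
  obtain \<eta> L c C where e: "continuous_on UNIV \<eta>" "\<And>z. 0 \<le> \<eta> z" "\<And>z. z \<in> K \<Longrightarrow> \<eta> z = 1"
    "compact L" "L \<subseteq> \<Omega>" "\<And>z. z \<notin> L \<Longrightarrow> \<eta> z = 0" "0 \<le> c" "\<And>j z. z \<in> L \<Longrightarrow> 1 \<le> c - gs j z"
    and C: "eventually (\<lambda>j. mass (\<lambda>z. \<eta> z * (c - gs j z) powr (1 + s)) \<le> C) sequentially"
    by (rule admissible_mass_bound[OF g gs K(1,2) s(1,2)]) (rule that)
  obtain CT where CT: "0 \<le> CT" "\<And>\<phi> w. cc_form p \<Omega> \<phi> \<Longrightarrow> cc_fun \<Omega> w \<Longrightarrow> (\<And>I J z. cmod (\<phi> I J z) \<le> w z) \<Longrightarrow>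
    cmod (T \<phi>) \<le> CT * mass w" using T_bound by metis
  have \<eta>cc: "cc_fun \<Omega> \<eta>" unfolding cc_fun_def using e by blast
  have m\<eta>: "0 \<le> mass \<eta>" by (rule mass_nonneg[OF \<eta>cc e(2)])
  have gsc: "continuous_on \<Omega> (gs j)" for j
    using gs by (intro smooth_on_imp_continuous_on) (auto simp: admissible_seq_def)
  have diff: "cmod (mult_current f T \<phi> - mult_current f' T \<phi>) \<le> CT * mass w"
    if f: "continuous_on \<Omega> f" "continuous_on \<Omega> f'" and w: "cc_fun \<Omega> w" "\<And>z. 0 \<le> w z"
      and le: "\<And>z. z \<in> K \<Longrightarrow> \<bar>f z - f' z\<bar> * B \<le> w z" for f f' w
  proof -
    have "mult_current f T \<phi> - mult_current f' T \<phi> = T (\<lambda>I J z. of_real (f z - f' z) * \<phi> I J z)"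
      using T_diff[OF cc_form_weight[OF \<phi>cc f(1)] cc_form_weight[OF \<phi>cc f(2)]]
      by (simp add: mult_current_def left_diff_distrib)
    also have "cmod \<dots> \<le> CT * mass w"
    proof (rule CT(2)[OF cc_form_weight[OF \<phi>cc continuous_on_diff[OF f]] w(1)])
      fix I J z
      show "cmod (of_real (f z - f' z) * \<phi> I J z) \<le> w z"
      proof (cases "z \<in> K")
        case True
        have "cmod (of_real (f z - f' z) * \<phi> I J z) \<le> \<bar>f z - f' z\<bar> * B"
          unfolding norm_mult norm_of_real real_norm_def using B(2) by (intro mult_left_mono) auto
        with le[OF True] show ?thesis by simp
      next
        case False then show ?thesis using K(3) w(2) by simp
      qed
    qed
    finally show ?thesis .
  qed
  define C' where "C' = CT * (B * (1 + c) powr (1 + s)) * C"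
  show ?thesis
  proof (rule that[of C'])
    fix M \<delta> :: real assume M: "1 \<le> M" and \<delta>: "0 < \<delta>"
    \<comment> \<open>Scaled so that a uniform error \<open>\<delta>'\<close> on \<open>K\<close>
      changes the value of the current by at most \<open>\<delta>\<close>; the summand 1 keeps the
      denominator positive.\<close>
    define \<delta>' where "\<delta>' = \<delta> / (CT * B * mass \<eta> + 1)"
    have den: "0 \<le> CT * B * mass \<eta>" using CT(1) B(1) m\<eta> by simp
    then have \<delta>': "0 < \<delta>'" "CT * (\<delta>' * B * mass \<eta>) \<le> \<delta>" using \<delta> by (auto simp: \<delta>'_def field_simps)
    have M0: "0 \<le> M" using M by simp
    have "eventually (\<lambda>j. \<forall>z\<in>K. \<bar>\<bar>clip M (gs j z)\<bar> powr (1 + \<epsilon>) - \<bar>trunc g M z\<bar> powr (1 + \<epsilon>)\<bar> < \<delta>') sequentially"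
      using \<epsilon>(1) by (intro uniform_limit_abs_powr[OF admissible_clip_uniform[OF open_domain g gs K(1,2)] _ clip_in[OF M0] trunc_in[OF M0] \<delta>'(1)]) simp
    with C show "eventually (\<lambda>j. cmod (mult_current (\<lambda>z. \<bar>gs j z\<bar> powr (1 + \<epsilon>)) T \<phi>
       - mult_current (\<lambda>z. \<bar>trunc g M z\<bar> powr (1 + \<epsilon>)) T \<phi>) \<le> C' * M powr (- ((1 - \<epsilon>) / 2)) + \<delta>) sequentially"
    proof eventually_elim
      fix j
      assume Cj: "mass (\<lambda>z. \<eta> z * (c - gs j z) powr (1 + s)) \<le> C"
        and uj: "\<forall>z\<in>K. \<bar>\<bar>clip M (gs j z)\<bar> powr (1 + \<epsilon>) - \<bar>trunc g M z\<bar> powr (1 + \<epsilon>)\<bar> < \<delta>'"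
      \<comment> \<open>\<open>y\<close> is intermediate: passing from \<open>x\<close> to
        \<open>y\<close> costs the tail, controlled by the uniform mass bound, and passing from
        \<open>y\<close> to \<open>a\<close> costs the uniform convergence of the clipped functions
        on \<open>K\<close>.\<close>
      define x where "x = mult_current (\<lambda>z. \<bar>gs j z\<bar> powr (1 + \<epsilon>)) T \<phi>"
      define y where "y = mult_current (\<lambda>z. \<bar>clip M (gs j z)\<bar> powr (1 + \<epsilon>)) T \<phi>"
      define a where "a = mult_current (\<lambda>z. \<bar>trunc g M z\<bar> powr (1 + \<epsilon>)) T \<phi>"
      have c1: "continuous_on \<Omega> (\<lambda>z. \<bar>gs j z\<bar> powr (1 + \<epsilon>))" using \<epsilon> by (intro continuous_on_abs_powr gsc) auto
      have c2: "continuous_on \<Omega> (\<lambda>z. \<bar>clip M (gs j z)\<bar> powr (1 + \<epsilon>))"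
        using \<epsilon> gsc unfolding clip_def by (intro continuous_on_abs_powr continuous_intros) auto
      have c3: "continuous_on \<Omega> (\<lambda>z. \<bar>trunc g M z\<bar> powr (1 + \<epsilon>))"
        using \<epsilon> by (intro continuous_on_abs_powr continuous_on_trunc[OF open_domain g]) auto
      define w where "w z = \<eta> z * (c - gs j z) powr (1 + s)" for z
      have w: "cc_fun \<Omega> w" unfolding w_def[abs_def]
      proof (rule cc_fun_mult_powr[OF open_domain e(1,4,5,6)])
        show "continuous_on \<Omega> (\<lambda>z. c - gs j z)" by (intro continuous_on_diff continuous_on_const gsc)
        show "0 < c - gs j z" if "z \<in> L" for z using e(8)[OF that, of j] by simp
      qed
      have w0: "0 \<le> w z" for z unfolding w_def using e(2) by simp
      define k where "k = M powr (\<epsilon> - s) * (B * (1 + c) powr (1 + s))"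
      have k0: "0 \<le> k" using B(1) by (simp add: k_def)
      have "cmod (x - y) \<le> CT * mass (\<lambda>z. k * w z)"
        unfolding x_def y_def
      proof (rule diff[OF c1 c2])
        show "cc_fun \<Omega> (\<lambda>z. k * w z)" by (rule cc_fun_cmult[OF w])
        show "0 \<le> k * w z" for z using k0 w0 by simp
        fix z assume z: "z \<in> K"
        have zL: "z \<in> L" using e(3)[OF z] e(6)[of z] by force
        have "\<bar>\<bar>gs j z\<bar> powr (1 + \<epsilon>) - \<bar>clip M (gs j z)\<bar> powr (1 + \<epsilon>)\<bar>
            \<le> M powr (\<epsilon> - s) * ((1 + c) powr (1 + s) * (c - gs j z) powr (1 + s))"
          by (rule tail_bound[OF M \<epsilon>(1) s(3) e(7) e(8)[OF zL]])
        from mult_right_mono[OF this B(1)] show "\<bar>\<bar>gs j z\<bar> powr (1 + \<epsilon>) - \<bar>clip M (gs j z)\<bar> powr (1 + \<epsilon>)\<bar> * B \<le> k * w z"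
          by (simp add: k_def w_def e(3)[OF z] mult_ac)
      qed
      also have "\<dots> = CT * (k * mass w)" by (simp add: mass_cmult[OF w])
      also have "\<dots> \<le> CT * (k * C)" using Cj CT(1) k0 by (intro mult_left_mono) (auto simp: w_def[abs_def])
      also have "\<dots> = C' * M powr (- ((1 - \<epsilon>) / 2))" unfolding k_def C'_def s(4) by (simp add: mult_ac)
      finally have xy: "cmod (x - y) \<le> C' * M powr (- ((1 - \<epsilon>) / 2))" .
      have "cmod (y - a) \<le> CT * mass (\<lambda>z. (\<delta>' * B) * \<eta> z)"
        unfolding y_def a_def
      proof (rule diff[OF c2 c3])
        show "cc_fun \<Omega> (\<lambda>z. \<delta>' * B * \<eta> z)" by (rule cc_fun_cmult[OF \<eta>cc])
        show "0 \<le> \<delta>' * B * \<eta> z" for z using \<delta>'(1) B(1) e(2) by simp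
        fix z assume z: "z \<in> K"
        show "\<bar>\<bar>clip M (gs j z)\<bar> powr (1 + \<epsilon>) - \<bar>trunc g M z\<bar> powr (1 + \<epsilon>)\<bar> * B \<le> \<delta>' * B * \<eta> z"
          using mult_right_mono[OF less_imp_le[OF bspec[OF uj z]] B(1)] by (simp add: e(3)[OF z])
      qed
      also have "\<dots> \<le> \<delta>" using \<delta>'(2) by (simp add: mass_cmult[OF \<eta>cc])
      finally show "cmod (mult_current (\<lambda>z. \<bar>gs j z\<bar> powr (1 + \<epsilon>)) T \<phi>
         - mult_current (\<lambda>z. \<bar>trunc g M z\<bar> powr (1 + \<epsilon>)) T \<phi>) \<le> C' * M powr (- ((1 - \<epsilon>) / 2)) + \<delta>"
        using xy norm_triangle_ineq[of "x - y" "y - a"] by (simp add: x_def[symmetric] a_def[symmetric])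
    qed
  qed
qed

end

theorem theorem2p4:
  fixes \<Omega> :: "(complex^('n::{finite,linorder})) set"
    and T :: "('n::{finite,linorder}) form \<Rightarrow> complex"
    and p :: nat
    and g :: "complex^('n::{finite,linorder}) \<Rightarrow> ereal"
  assumes "open \<Omega>"
    and "2 \<le> p" and "p \<le> CARD('n::{finite,linorder})"
    and "positive_current p \<Omega> T"
    and "pluriharmonic_current p \<Omega> T"
    and "psh_neg \<Omega> g"
    and "C1_on (\<Omega> - unbdd_locus \<Omega> g) (\<lambda>z. real_of_ereal (g z))"
    and "compact (unbdd_locus \<Omega> g)"
    and "unbdd_locus \<Omega> g = polar_set \<Omega> g"
  shows "\<forall>\<epsilon>::real. 0 < \<epsilon> \<and> \<epsilon> < 1 \<longrightarrow>
           (\<exists>S. \<forall>gs. admissible_seq \<Omega> g gs \<longrightarrow>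
              (\<forall>\<phi>. test_form p \<Omega> \<phi> \<longrightarrow>
                 (\<lambda>j. mult_current (\<lambda>z. \<bar>gs j z\<bar> powr (1 + \<epsilon>)) T \<phi>) \<longlonglongrightarrow> S \<phi>))"
proof (intro allI impI)
  fix \<epsilon> :: real assume \<epsilon>: "0 < \<epsilon> \<and> \<epsilon> < 1"
  interpret pluriharmonic_current_on p \<Omega> T "p - 2"
    using assms(1,2,4,5) by unfold_locales auto
  \<comment> \<open>Built from \<open>g\<close> alone, so that its limit can be named as the witness
    before any sequence \<open>gs\<close> is given.\<close>
  define a where "a \<phi> M = mult_current (\<lambda>z. \<bar>trunc g (real M) z\<bar> powr (1 + \<epsilon>)) T \<phi>" for \<phi> and M :: nat
  show "\<exists>S. \<forall>gs. admissible_seq \<Omega> g gs \<longrightarrow> (\<forall>\<phi>. test_form p \<Omega> \<phi> \<longrightarrow>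
      (\<lambda>j. mult_current (\<lambda>z. \<bar>gs j z\<bar> powr (1 + \<epsilon>)) T \<phi>) \<longlonglongrightarrow> S \<phi>)"
  proof (intro exI[of _ "\<lambda>\<phi>. lim (a \<phi>)"] allI impI)
    fix gs \<phi> assume gs: "admissible_seq \<Omega> g gs" and \<phi>: "test_form p \<Omega> \<phi>"
    obtain C where C: "\<And>M \<delta>. 1 \<le> M \<Longrightarrow> 0 < \<delta> \<Longrightarrow> eventually (\<lambda>j. cmod (mult_current (\<lambda>z. \<bar>gs j z\<bar> powr (1 + \<epsilon>)) T \<phi>
       - mult_current (\<lambda>z. \<bar>trunc g M z\<bar> powr (1 + \<epsilon>)) T \<phi>) \<le> C * M powr (- ((1 - \<epsilon>) / 2)) + \<delta>) sequentially"
      by (rule truncation_estimate[OF assms(6-9) gs \<phi> conjunct1[OF \<epsilon>] conjunct2[OF \<epsilon>]]) (rule that)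
    have "(\<lambda>M. real M powr (- ((1 - \<epsilon>) / 2))) \<longlonglongrightarrow> 0"
      using \<epsilon> by (intro tendsto_neg_powr filterlim_real_sequentially) auto
    from tendsto_mult_left[OF this, of C] have "(\<lambda>M. C * real M powr (- ((1 - \<epsilon>) / 2))) \<longlonglongrightarrow> 0" by simp
    then show "(\<lambda>j. mult_current (\<lambda>z. \<bar>gs j z\<bar> powr (1 + \<epsilon>)) T \<phi>) \<longlonglongrightarrow> lim (a \<phi>)"
    proof (rule double_limit)
      fix M :: nat and \<delta> :: real assume "1 \<le> M" "0 < \<delta>"
      then show "eventually (\<lambda>j. cmod (mult_current (\<lambda>z. \<bar>gs j z\<bar> powr (1 + \<epsilon>)) T \<phi> - a \<phi> M)
          \<le> C * real M powr (- ((1 - \<epsilon>) / 2)) + \<delta>) sequentially"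
        unfolding a_def by (intro C) auto
    qed
  qed
qed

end
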